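(* Let $0<\alpha<4$, let $\phi\in L^2_w(\mathbb R^4)$ be a distributional solution of $$\Delta^2\phi(x)=\left(\int_{\mathbb R^4}\frac{e^{U(y)}\phi(y)}{|x-y|^\alpha}\,dy\right)e^{U(x)}+\left(\int_{\mathbb R^4}\frac{e^{U(y)}}{|x-y|^\alpha}\,dy\right)e^{U(x)}\phi(x)\quad\text{in }\mathbb R^4,$$ and put $\Phi=\phi\circ S^{-1}$. Then $\Phi\in L^2(\mathbb S^4)$ and $$\mathcal L_\alpha\Phi=0\quad\text{in }\mathcal D'(\mathbb S^4\setminus\{p\}).$$
   Context: All functions are real-valued. $C_\alpha=\left(\frac{12(8-\alpha)(6-\alpha)(4-\alpha)}{\pi^2}\right)^{1/(8-\alpha)}$ and $U(x)=\frac{8-\alpha}2\log\frac{C_\alpha}{1+|x|^2}$. $L^2_w(\mathbb R^4)$ is the space of measurable $\phi$ with $\int_{\mathbb R^4}|\phi|^2(1+|x|^2)^{-4}dx<\infty$. Distributional solution: the equation holds when tested against every $\varphi\in C_c^\infty(\mathbb R^4)$, with $\Delta^2$ moved onto $\varphi$. $S:\mathbb R^4\to\mathbb S^4\setminus\{p\}$, $p=(0,0,0,0,-1)$, is $S(x)=\left(\frac{2x}{1+|x|^2},\frac{1-|x|^2}{1+|x|^2}\right)$. On the unit round sphere $\mathbb S^4\subset\mathbb R^5$ with surface measure, $$\mathcal L_\alpha=P_4^{\mathbb S^4}-\kappa_\alpha(\mathcal R_\alpha+\mu_0(\alpha)I),$$ where $P_4^{\mathbb S^4}=(-\Delta_{\mathbb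 S^4})(-\Delta_{\mathbb S^4}+2)$, $\mathcal R_\alpha\Phi(\xi)=\int_{\mathbb S^4}|\xi-\eta|^{-\alpha}\Phi(\eta)d\eta$ (chordal distance), $\mu_0(\alpha)=\int_{\mathbb S^4}|\xi-\eta|^{-\alpha}d\eta=\frac{2^{6-\alpha}\pi^2}{(6-\alpha)(4-\alpha)}$, and $\kappa_\alpha=C_\alpha^{8-\alpha}2^{-(8-\alpha)}$. For $\Phi\in L^2(\mathbb S^4)$ the distribution $\mathcal L_\alpha\Phi$ is defined by $\langle\mathcal L_\alpha\Phi,\chi\rangle=\int_{\mathbb S^4}\Phi\,\mathcal L_\alpha\chi\,d\xi$ for smooth $\chi$; vanishing in $\mathcal D'(\mathbb S^4\setminus\{p\})$ means this is $0$ for all $\chi\in C_c^\infty(\mathbb S^4\setminus\{p\})$. *)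

theory Defs
  imports "HOL-Analysis.Analysis"
begin

definition partial_deriv :: "'a::euclidean_space \<Rightarrow> ('a \<Rightarrow> real) \<Rightarrow> 'a \<Rightarrow> real" where
  "partial_deriv b f x = frechet_derivative f (at x) b"

fun Ck_on :: "nat \<Rightarrow> 'a::euclidean_space set \<Rightarrow> ('a \<Rightarrow> real) \<Rightarrow> bool" where
  "Ck_on 0 W f \<longleftrightarrow> continuous_on W f"
| "Ck_on (Suc k) W f \<longleftrightarrow>
     (\<forall>x\<in>W. f differentiable at x) \<and> (\<forall>b\<in>Basis. Ck_on k W (partial_deriv b f))"

text \<open>Only meant for open \<open>W\<close>: derivatives are taken in the ambient space.\<close>

definition smooth_on :: "'a::euclidean_space set \<Rightarrow> ('a \<Rightarrow> real) \<Rightarrow> bool" where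
  "smooth_on W f \<longleftrightarrow> (\<forall>k. Ck_on k W f)"

definition test_fun :: "('a::euclidean_space \<Rightarrow> real) \<Rightarrow> bool" where
  "test_fun f \<longleftrightarrow> smooth_on UNIV f \<and> compact (closure {x. f x \<noteq> 0})"

definition laplacian :: "('a::euclidean_space \<Rightarrow> real) \<Rightarrow> 'a \<Rightarrow> real" where
  "laplacian f x = (\<Sum>b\<in>Basis. partial_deriv b (partial_deriv b f) x)"

definition L2 :: "'a measure \<Rightarrow> ('a \<Rightarrow> real) \<Rightarrow> bool" where
  "L2 M f \<longleftrightarrow> f \<in> borel_measurable M \<and> integrable M (\<lambda>x. \<bar>f x\<bar>\<^sup>2)"

type_synonym R4 = "real ^ 4"

definition C_const :: "real \<Rightarrow> real" where
  "C_const \<alpha> = (12 * (8 - \<alpha>) * (6 - \<alpha>) * (4 - \<alpha>) / pi\<^sup>2) powr (1 / (8 - \<alpha>))"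

definition U_sol :: "real \<Rightarrow> R4 \<Rightarrow> real" where
  "U_sol \<alpha> x = (8 - \<alpha>) / 2 * ln (C_const \<alpha> / (1 + (norm x)\<^sup>2))"

definition L2w :: "(R4 \<Rightarrow> real) \<Rightarrow> bool" where
  "L2w \<phi> \<longleftrightarrow> \<phi> \<in> borel_measurable lebesgue \<and>
     integrable lebesgue (\<lambda>x. \<bar>\<phi> x\<bar>\<^sup>2 / (1 + (norm x)\<^sup>2) ^ 4)"

definition lin_rhs :: "real \<Rightarrow> (R4 \<Rightarrow> real) \<Rightarrow> R4 \<Rightarrow> real" where
  "lin_rhs \<alpha> \<phi> x =
     (LINT y|lebesgue. exp (U_sol \<alpha> y) * \<phi> y / norm (x - y) powr \<alpha>) * exp (U_sol \<alpha> x)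
   + (LINT y|lebesgue. exp (U_sol \<alpha> y) / norm (x - y) powr \<alpha>) * exp (U_sol \<alpha> x) * \<phi> x"

definition lin_dist_sol :: "real \<Rightarrow> (R4 \<Rightarrow> real) \<Rightarrow> bool" where
  "lin_dist_sol \<alpha> \<phi> \<longleftrightarrow>
     (\<forall>\<psi>. test_fun \<psi> \<longrightarrow>
        (LINT x|lebesgue. \<phi> x * laplacian (laplacian \<psi>) x)
      = (LINT x|lebesgue. lin_rhs \<alpha> \<phi> x * \<psi> x))"

text \<open>
  Functions on the unit sphere are represented by functions on the ambient space whose values off
  the sphere are irrelevant. Since \<open>sgn y = y /\<^sub>R norm y\<close>, the function \<open>\<lambda>y. f (sgn y)\<close> is the
  extension of \<open>f\<close> that is constant along rays.

  The surface measure is the polar-coordinate one: \<open>A\<close> has measure \<open>n\<close> times the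
  \<open>n\<close>-dimensional volume of the cone over \<open>A\<close> in the unit ball, \<open>n\<close> being the dimension of the
  ambient space. It is completed, as is Lebesgue measure.
\<close>

definition sphere_measure :: "'a::euclidean_space measure" where
  "sphere_measure = completion (scale_measure (of_nat DIM('a))
     (distr (restrict_space lborel (cball 0 1 - {0})) (restrict_space borel (sphere 0 1)) sgn))"

definition sph_smooth :: "('a::euclidean_space \<Rightarrow> real) \<Rightarrow> bool" where
  "sph_smooth f \<longleftrightarrow> smooth_on (- {0}) (\<lambda>y. f (sgn y))"

text \<open>Compactness of the support is automatic, the sphere being compact.\<close>

definition sph_test_fun :: "'a::euclidean_space set \<Rightarrow> ('a \<Rightarrow> real) \<Rightarrow> bool" where
  "sph_test_fun W f \<longleftrightarrow> sph_smooth f \<and> closure {\<xi> \<in> sphere 0 1. f \<xi> \<noteq> 0} \<subseteq> W"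

text \<open>
  At a point \<open>\<xi>\<close> of the sphere the differential of a ray-constant extension kills the normal
  direction \<open>\<xi>\<close> and agrees with the tangential differential on the orthogonal complement of \<open>\<xi>\<close>.
  Hence the Euclidean gradient of the extension is the Riemannian gradient. For a tangential field
  \<open>X\<close>, the trace of the differential of the extension is the trace of the tangential part of \<open>DX\<close>,
  i.e. of the Levi-Civita derivative of \<open>X\<close>, so it is the Riemannian divergence.
\<close>

definition sph_grad :: "('a::euclidean_space \<Rightarrow> real) \<Rightarrow> 'a \<Rightarrow> 'a" where
  "sph_grad f \<xi> = (\<Sum>b\<in>Basis. frechet_derivative (\<lambda>y. f (sgn y)) (at \<xi>) b *\<^sub>R b)"

definition sph_div :: "('a::euclidean_space \<Rightarrow> 'a) \<Rightarrow> 'a \<Rightarrow> real" where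
  "sph_div X \<xi> = (\<Sum>b\<in>Basis. frechet_derivative (\<lambda>y. X (sgn y)) (at \<xi>) b \<bullet> b)"

definition sph_laplacian :: "('a::euclidean_space \<Rightarrow> real) \<Rightarrow> 'a \<Rightarrow> real" where
  "sph_laplacian f = sph_div (sph_grad f)"

text \<open>\<open>\<real>\<^sup>5\<close> is \<open>\<real>\<^sup>4 \<times> \<real>\<close>, whose library inner product is the Euclidean one.\<close>

type_synonym R5 = "R4 \<times> real"

definition stereo :: "R4 \<Rightarrow> R5" where
  "stereo x = ((2 / (1 + (norm x)\<^sup>2)) *\<^sub>R x, (1 - (norm x)\<^sup>2) / (1 + (norm x)\<^sup>2))"

definition south_pole :: R5 where
  "south_pole = (0, - 1)"

definition paneitz :: "(R5 \<Rightarrow> real) \<Rightarrow> R5 \<Rightarrow> real" where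
  "paneitz f \<xi> = - sph_laplacian (\<lambda>\<eta>. - sph_laplacian f \<eta> + 2 * f \<eta>) \<xi>"

definition riesz :: "real \<Rightarrow> (R5 \<Rightarrow> real) \<Rightarrow> R5 \<Rightarrow> real" where
  "riesz \<alpha> f \<xi> = (LINT \<eta>|sphere_measure. norm (\<xi> - \<eta>) powr (- \<alpha>) * f \<eta>)"

text \<open>
  For \<open>0 < \<alpha> < 4\<close> this is the value, for every \<open>\<xi>\<close> in the sphere, of the integral of
  \<open>norm (\<xi> - \<eta>) powr (- \<alpha>)\<close> over \<open>\<eta>\<close> in the sphere.
\<close>

definition mu0 :: "real \<Rightarrow> real" where
  "mu0 \<alpha> = 2 powr (6 - \<alpha>) * pi\<^sup>2 / ((6 - \<alpha>) * (4 - \<alpha>))"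

definition kappa :: "real \<Rightarrow> real" where
  "kappa \<alpha> = C_const \<alpha> powr (8 - \<alpha>) * 2 powr (- (8 - \<alpha>))"

definition L_op :: "real \<Rightarrow> (R5 \<Rightarrow> real) \<Rightarrow> R5 \<Rightarrow> real" where
  "L_op \<alpha> f \<xi> = paneitz f \<xi> - kappa \<alpha> * (riesz \<alpha> f \<xi> + mu0 \<alpha> * f \<xi>)"

text \<open>The distribution \<open>L_op \<alpha> \<Phi>\<close> for \<open>\<Phi>\<close> in \<open>L\<^sup>2\<close> of the sphere, evaluated at smooth \<open>\<psi>\<close>.\<close>

definition L_dist :: "real \<Rightarrow> (R5 \<Rightarrow> real) \<Rightarrow> (R5 \<Rightarrow> real) \<Rightarrow> real" where
  "L_dist \<alpha> \<Phi> \<psi> = (LINT \<xi>|sphere_measure. \<Phi> \<xi> * L_op \<alpha> \<psi> \<xi>)"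

end

theory Submission
  imports Defs "HOL-Real_Asymp.Real_Asymp"
begin

text \<open>
  Put \<open>m = (1 + |x|\<^sup>2) / 2\<close>. In stereographic coordinates the Laplacian of the sphere is
  \<open>L = m\<^sup>2 \<Delta> - 2 m x \<cdot> \<nabla>\<close>, and the commutator relation \<open>[\<Delta>, x \<cdot> \<nabla>] = 2 \<Delta>\<close> gives
  \<open>L (L - 2) = m\<^sup>4 \<Delta>\<^sup>2\<close>, the conformal covariance of the Paneitz operator. The surface measure
  pulls back to \<open>m\<^sup>-\<^sup>4 dx\<close>, and the Riesz kernel, weighted by both Jacobians, becomes
  \<open>e\<^bsup>U(x)\<^esup> e\<^bsup>U(y)\<^esup> |x - y|\<^bsup>-\<alpha>\<^esup>\<close> up to the constant \<open>kappa \<alpha>\<close>; rotation invariance shows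
  that its integral over the sphere does not depend on the base point, and evaluating it at the south
  pole yields \<open>mu0 \<alpha>\<close>. A test function supported away from the south pole pulls back to a test
  function on \<open>\<real>\<^sup>4\<close>, so the equation on the sphere is the equation on \<open>\<real>\<^sup>4\<close> tested
  against that pull-back; Fubini moves the symmetric kernel onto the test function.
\<close>

subsection \<open>Calculus of smooth functions\<close>

text \<open>The sphere operators are defined extrinsically, through extensions constant along rays,
  and the surface measure through cones in the unit ball, so neither a chart formula nor a Jacobian
  comes for free. For the Laplacian the chain rule in R^5 is used: a ray-constant F satisfies y .
  grad F = 0, hence also Hess F(y, y) = 0, and these two identities remove every normal term. For
  the measure, slicing a cone by hyperplanes produces central projection, not stereographic
  projection; the two are compared on each open hemisphere, where the singularity of central
  projection at the equator cancels between its Jacobian and the cone weight. The other burden is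
  integrability: the Bochner integral of a non-integrable function is 0, so every splitting or
  exchange of integrals needs a bound. The bounds rest on the finite area of the sphere, which
  embeds L^2 in L^1, and on the constancy of the Riesz potential of 1. Since \<phi> is only Lebesgue
  measurable, a Borel representative stands in for it under Fubini. The south pole is excluded
  because compact support of a pull-back requires vanishing near it.\<close>

lemma partial_deriv_eq:
  "(f has_derivative f') (at x) \<Longrightarrow> partial_deriv b f x = f' b"
  by (simp add: partial_deriv_def frechet_derivative_at[symmetric])

lemma has_derivative_partial_deriv:
  fixes f :: "'a::euclidean_space \<Rightarrow> real"
  assumes "f differentiable at x"
  shows "(f has_derivative (\<lambda>v. \<Sum>b\<in>Basis. (v \<bullet> b) * partial_deriv b f x)) (at x)"
proof -
  have lin: "linear (frechet_derivative f (at x))"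
    using assms by (rule linear_frechet_derivative)
  have "frechet_derivative f (at x) v = (\<Sum>b\<in>Basis. (v \<bullet> b) * partial_deriv b f x)" for v
  proof -
    have "frechet_derivative f (at x) v
        = frechet_derivative f (at x) (\<Sum>b\<in>Basis. (v \<bullet> b) *\<^sub>R b)"
      by (simp add: euclidean_representation)
    also have "\<dots> = (\<Sum>b\<in>Basis. (v \<bullet> b) * partial_deriv b f x)"
      by (simp add: linear_sum[OF lin] linear_cmul[OF lin] partial_deriv_def)
    finally show ?thesis .
  qed
  then have "frechet_derivative f (at x) = (\<lambda>v. \<Sum>b\<in>Basis. (v \<bullet> b) * partial_deriv b f x)"
    by blast
  then show ?thesis
    using assms frechet_derivative_works by metis
qed

text \<open>\<open>frechet_derivative\<close> is a choice operator: both functions have the same set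
  of derivatives at the point, so the same one is chosen, even when that set is empty.\<close>

lemma frechet_derivative_cong_open:
  assumes "open W" "x \<in> W" "\<And>y. y \<in> W \<Longrightarrow> f y = g y"
  shows "frechet_derivative f (at x) = frechet_derivative g (at x)"
proof -
  have "(f has_derivative f') (at x) \<longleftrightarrow> (g has_derivative f') (at x)" for f'
    using assms has_derivative_transform_within_open[of f f' x UNIV W g]
      has_derivative_transform_within_open[of g f' x UNIV W f] by auto
  then show ?thesis
    unfolding frechet_derivative_def by simp
qed

lemma partial_deriv_cong_open:
  assumes "open W" "x \<in> W" "\<And>y. y \<in> W \<Longrightarrow> f y = g y"
  shows "partial_deriv b f x = partial_deriv b g x"
  unfolding partial_deriv_def using frechet_derivative_cong_open[OF assms] by simp

lemma partial_deriv_const [simp]: "partial_deriv b (\<lambda>x. c) = (\<lambda>x. 0)"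
  by (simp add: fun_eq_iff partial_deriv_def)

lemma partial_deriv_inner [simp]: "partial_deriv b (\<lambda>x. x \<bullet> c) = (\<lambda>x. b \<bullet> c)"
  by (intro ext partial_deriv_eq) (auto intro!: derivative_eq_intros)

lemma partial_deriv_add:
  assumes "f differentiable at x" "g differentiable at x"
  shows "partial_deriv b (\<lambda>x. f x + g x) x = partial_deriv b f x + partial_deriv b g x"
  unfolding partial_deriv_def
  by (subst frechet_derivative_at[symmetric,
        OF has_derivative_add[OF assms[unfolded frechet_derivative_works]]]) simp

lemma partial_deriv_mult:
  assumes "f differentiable at x" "g differentiable at x"
  shows "partial_deriv b (\<lambda>x. f x * g x) x = partial_deriv b f x * g x + f x * partial_deriv b g x"
  unfolding partial_deriv_def
  by (subst frechet_derivative_at[symmetric,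
        OF has_derivative_mult[OF assms[unfolded frechet_derivative_works]]]) simp

lemma partial_deriv_sum:
  assumes "\<And>i. i \<in> I \<Longrightarrow> f i differentiable at x"
  shows "partial_deriv b (\<lambda>x. \<Sum>i\<in>I. f i x) x = (\<Sum>i\<in>I. partial_deriv b (f i) x)"
proof (rule trans[OF partial_deriv_eq[OF has_derivative_sum]])
  show "(f i has_derivative frechet_derivative (f i) (at x)) (at x)" if "i \<in> I" for i
    using assms[OF that] frechet_derivative_works by blast
qed (simp add: partial_deriv_def)

lemma partial_deriv_inverse:
  assumes "f differentiable at x" "f x \<noteq> 0"
  shows "partial_deriv b (\<lambda>x. inverse (f x)) x = - partial_deriv b f x * (inverse (f x) * inverse (f x))"
  using partial_deriv_eq[OF Deriv.has_derivative_inverse[OF assms(2) assms(1)[unfolded frechet_derivative_works]]]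
  by (simp add: partial_deriv_def)

lemma partial_deriv_sqrt:
  assumes "f differentiable at x" "0 < f x"
  shows "partial_deriv b (\<lambda>x. sqrt (f x)) x = partial_deriv b f x * (1 / 2 * inverse (sqrt (f x)))"
  using partial_deriv_eq[OF has_derivative_real_sqrt[OF assms(2) assms(1)[unfolded frechet_derivative_works]]]
  by (simp add: partial_deriv_def field_simps)

lemma differentiable_componentwise:
  fixes g :: "'a::real_normed_vector \<Rightarrow> 'b::euclidean_space"
  assumes "\<And>c. c \<in> Basis \<Longrightarrow> (\<lambda>x. g x \<bullet> c) differentiable at x"
  shows "g differentiable at x"
  using assms by (subst differentiable_componentwise_within) simp

lemma partial_deriv_compose:
  fixes f :: "'b::euclidean_space \<Rightarrow> real" and g :: "'a::euclidean_space \<Rightarrow> 'b"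
  assumes f: "f differentiable at (g x)"
    and g: "\<And>c. c \<in> Basis \<Longrightarrow> (\<lambda>x. g x \<bullet> c) differentiable at x"
  shows "partial_deriv b (\<lambda>x. f (g x)) x
    = (\<Sum>c\<in>Basis. partial_deriv c f (g x) * partial_deriv b (\<lambda>x. g x \<bullet> c) x)"
proof -
  have dg: "(g has_derivative frechet_derivative g (at x)) (at x)"
    using differentiable_componentwise[OF g] frechet_derivative_works by metis
  have *: "((\<lambda>x. f (g x)) has_derivative
      (\<lambda>v. \<Sum>c\<in>Basis. (frechet_derivative g (at x) v \<bullet> c) * partial_deriv c f (g x))) (at x)"
    using diff_chain_at[OF dg has_derivative_partial_deriv[OF f]] by (simp add: o_def)
  have "partial_deriv b (\<lambda>x. g x \<bullet> c) x = frechet_derivative g (at x) b \<bullet> c" for c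
    by (rule partial_deriv_eq) (rule has_derivative_inner_left[OF dg])
  then show ?thesis
    unfolding partial_deriv_eq[OF *] by (simp add: mult.commute)
qed

lemma Ck_on_cong:
  assumes "open W" "\<And>x. x \<in> W \<Longrightarrow> f x = g x" "Ck_on k W f"
  shows "Ck_on k W g"
  using assms(2,3)
proof (induction k arbitrary: f g)
  case 0
  then show ?case by (simp cong: continuous_on_cong)
next
  case (Suc k)
  have "g differentiable at x" if "x \<in> W" for x
    using Suc.prems that assms(1) has_derivative_transform_within_open[of f _ x UNIV W g]
    unfolding Ck_on.simps differentiable_def by metis
  moreover have "Ck_on k W (partial_deriv b g)" if "b \<in> Basis" for b
    using Suc.IH[of "partial_deriv b f" "partial_deriv b g"] Suc.prems that
      partial_deriv_cong_open[OF assms(1), of _ f g b] by simp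
  ultimately show ?case by simp
qed

lemma Ck_on_Suc_imp: "Ck_on (Suc k) W f \<Longrightarrow> Ck_on k W f"
proof (induction k arbitrary: f)
  case 0
  then show ?case
    by (auto intro!: continuous_at_imp_continuous_on differentiable_imp_continuous_within)
next
  case (Suc k)
  then show ?case by simp
qed

lemma Ck_on_subset: "Ck_on k W f \<Longrightarrow> V \<subseteq> W \<Longrightarrow> Ck_on k V f"
  by (induction k arbitrary: f) (auto intro: continuous_on_subset)

lemma Ck_on_const: "Ck_on k W (\<lambda>x. c)"
proof (induction k arbitrary: c)
  case (Suc k)
  then show ?case by simp
qed simp

lemma Ck_on_inner: "Ck_on k W (\<lambda>x. x \<bullet> c)"
proof (cases k)
  case (Suc j)
  then show ?thesis by (simp add: Suc Ck_on_const)
qed (auto intro!: continuous_intros)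

lemma Ck_on_add:
  assumes "open W" "Ck_on k W f" "Ck_on k W g"
  shows "Ck_on k W (\<lambda>x. f x + g x)"
  using assms(2,3)
proof (induction k arbitrary: f g)
  case (Suc k)
  have "Ck_on k W (partial_deriv b (\<lambda>x. f x + g x))" if "b \<in> Basis" for b
    by (rule Ck_on_cong[OF assms(1) _ Suc.IH[of "partial_deriv b f" "partial_deriv b g"]])
       (use Suc.prems that in \<open>auto simp: partial_deriv_add\<close>)
  then show ?case using Suc.prems by auto
qed (auto intro!: continuous_intros)

text \<open>Both factors vary in the induction, since the product rule pairs the derivative of one
  with the other itself, read at one order less.\<close>

lemma Ck_on_mult:
  assumes "open W" "Ck_on k W f" "Ck_on k W g"
  shows "Ck_on k W (\<lambda>x. f x * g x)"
  using assms(2,3)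
proof (induction k arbitrary: f g)
  case (Suc k)
  have "Ck_on k W f" "Ck_on k W g"
    using Suc.prems Ck_on_Suc_imp by blast+
  note fg = this
  have "Ck_on k W (partial_deriv b (\<lambda>x. f x * g x))" if "b \<in> Basis" for b
    by (rule Ck_on_cong[OF assms(1) _ Ck_on_add[OF assms(1)
        Suc.IH[of "partial_deriv b f" g] Suc.IH[of f "partial_deriv b g"]]])
       (use Suc.prems that fg in \<open>auto simp: partial_deriv_mult\<close>)
  then show ?case using Suc.prems by auto
qed (auto intro!: continuous_intros)

lemma Ck_on_sum:
  assumes "open W" "\<And>i. i \<in> I \<Longrightarrow> Ck_on k W (f i)"
  shows "Ck_on k W (\<lambda>x. \<Sum>i\<in>I. f i x)"
  using assms(2)
  by (induction I rule: infinite_finite_induct) (auto simp: Ck_on_const intro!: Ck_on_add[OF assms(1)])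

text \<open>The derivative of \<open>1 / f\<close> is built from that of \<open>f\<close> and from
  \<open>1 / f\<close> itself, so the induction hypothesis for the same \<open>f\<close> supplies
  the next order.\<close>

lemma Ck_on_inverse:
  assumes "open W" "Ck_on k W f" "\<And>x. x \<in> W \<Longrightarrow> f x \<noteq> 0"
  shows "Ck_on k W (\<lambda>x. inverse (f x))"
  using assms(2)
proof (induction k)
  case (Suc k)
  then have IH: "Ck_on k W (\<lambda>x. inverse (f x))" using Ck_on_Suc_imp by blast
  have "Ck_on k W (partial_deriv b (\<lambda>x. inverse (f x)))" if "b \<in> Basis" for b
    by (rule Ck_on_cong[OF assms(1) _ Ck_on_mult[OF assms(1) Ck_on_mult[OF assms(1)
        Ck_on_const[of k W "- 1"], of "partial_deriv b f"] Ck_on_mult[OF assms(1) IH IH]]])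
       (use Suc.prems that assms(3) in \<open>auto simp: partial_deriv_inverse\<close>)
  then show ?case using Suc.prems assms(3) by (auto intro!: differentiable_inverse)
qed (use assms(3) in \<open>auto intro!: continuous_intros\<close>)

lemma Ck_on_sqrt:
  assumes "open W" "Ck_on k W f" "\<And>x. x \<in> W \<Longrightarrow> 0 < f x"
  shows "Ck_on k W (\<lambda>x. sqrt (f x))"
  using assms(2)
proof (induction k)
  case (Suc k)
  then have "Ck_on k W (\<lambda>x. sqrt (f x))" using Ck_on_Suc_imp by blast
  then have IH: "Ck_on k W (\<lambda>x. inverse (sqrt (f x)))"
    using assms(3) by (intro Ck_on_inverse[OF assms(1)]) force+
  have "Ck_on k W (partial_deriv b (\<lambda>x. sqrt (f x)))" if "b \<in> Basis" for b
    by (rule Ck_on_cong[OF assms(1) _ Ck_on_mult[OF assms(1) _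
          Ck_on_mult[OF assms(1) Ck_on_const[of k W "1 / 2"] IH], of "partial_deriv b f"]])
       (use Suc.prems that assms(3) in \<open>auto simp: partial_deriv_sqrt\<close>)
  moreover have "(\<lambda>x. sqrt (f x)) differentiable at x" if "x \<in> W" for x
    using Suc.prems that assms(3)[OF that] has_derivative_real_sqrt[of f x "frechet_derivative f (at x)"]
    unfolding differentiable_def Ck_on.simps by (metis frechet_derivative_works differentiable_def)
  ultimately show ?case by simp
qed (use assms(3) in \<open>auto intro!: continuous_intros\<close>)

text \<open>The inner map enters through its coordinate functions because \<open>Ck_on\<close>
  speaks of real-valued functions. In the induction the outer function is replaced by its partial
  derivatives while \<open>g\<close> stays.\<close>

lemma Ck_on_compose:
  fixes f :: "'b::euclidean_space \<Rightarrow> real" and g :: "'a::euclidean_space \<Rightarrow> 'b"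
  assumes "open W" and V: "\<And>x. x \<in> W \<Longrightarrow> g x \<in> V"
    and "Ck_on k V f" "\<And>c. c \<in> Basis \<Longrightarrow> Ck_on k W (\<lambda>x. g x \<bullet> c)"
  shows "Ck_on k W (\<lambda>x. f (g x))"
  using assms(3,4)
proof (induction k arbitrary: f)
  case 0
  then have "continuous_on W g"
    using continuous_on_componentwise[of W g] by simp
  with 0 V show ?case
    using continuous_on_compose2[of V f W g] by auto
next
  case (Suc k)
  have g: "(\<lambda>x. g x \<bullet> c) differentiable at x" if "c \<in> Basis" "x \<in> W" for x c
    using Suc.prems that by auto
  have f: "f differentiable at (g x)" if "x \<in> W" for x
    using Suc.prems that V by auto
  have gk: "Ck_on k W (\<lambda>x. g x \<bullet> c)" if "c \<in> Basis" for c
    using Suc.prems(2)[OF that] by (rule Ck_on_Suc_imp)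
  have "Ck_on k W (partial_deriv b (\<lambda>x. f (g x)))" if "b \<in> Basis" for b
  proof (rule Ck_on_cong[OF assms(1)])
    show "Ck_on k W (\<lambda>x. \<Sum>c\<in>Basis. partial_deriv c f (g x) * partial_deriv b (\<lambda>x. g x \<bullet> c) x)"
    proof (rule Ck_on_sum[OF assms(1)], rule Ck_on_mult[OF assms(1)])
      fix c :: 'b assume c: "c \<in> Basis"
      show "Ck_on k W (\<lambda>x. partial_deriv c f (g x))"
        by (rule Suc.IH[OF _ gk]) (use Suc.prems(1) c in auto)
      show "Ck_on k W (partial_deriv b (\<lambda>x. g x \<bullet> c))"
        using Suc.prems(2)[OF c] that by simp
    qed
    show "(\<Sum>c\<in>Basis. partial_deriv c f (g x) * partial_deriv b (\<lambda>x. g x \<bullet> c) x)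
        = partial_deriv b (\<lambda>x. f (g x)) x" if "x \<in> W" for x
      using partial_deriv_compose[OF f[OF that] g[OF _ that]] by simp
  qed
  moreover have "(\<lambda>x. f (g x)) differentiable at x" if "x \<in> W" for x
    using differentiable_chain_at[OF differentiable_componentwise[OF g[OF _ that]] f[OF that]]
    by (simp add: o_def)
  ultimately show ?case by simp
qed

lemma smooth_on_cong:
  "open W \<Longrightarrow> (\<And>x. x \<in> W \<Longrightarrow> f x = g x) \<Longrightarrow> smooth_on W f \<Longrightarrow> smooth_on W g"
  unfolding smooth_on_def by (meson Ck_on_cong)

lemma smooth_on_subset: "smooth_on W f \<Longrightarrow> V \<subseteq> W \<Longrightarrow> smooth_on V f"
  unfolding smooth_on_def by (meson Ck_on_subset)

lemma smooth_on_const: "smooth_on W (\<lambda>x. c)"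
  by (simp add: smooth_on_def Ck_on_const)

lemma smooth_on_inner: "smooth_on W (\<lambda>x. x \<bullet> c)"
  by (simp add: smooth_on_def Ck_on_inner)

lemma smooth_on_add:
  "open W \<Longrightarrow> smooth_on W f \<Longrightarrow> smooth_on W g \<Longrightarrow> smooth_on W (\<lambda>x. f x + g x)"
  by (simp add: smooth_on_def Ck_on_add)

lemma smooth_on_mult:
  "open W \<Longrightarrow> smooth_on W f \<Longrightarrow> smooth_on W g \<Longrightarrow> smooth_on W (\<lambda>x. f x * g x)"
  by (simp add: smooth_on_def Ck_on_mult)

lemma smooth_on_sum:
  "open W \<Longrightarrow> (\<And>i. i \<in> I \<Longrightarrow> smooth_on W (f i)) \<Longrightarrow> smooth_on W (\<lambda>x. \<Sum>i\<in>I. f i x)"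
  by (simp add: smooth_on_def Ck_on_sum)

lemma smooth_on_inverse:
  "open W \<Longrightarrow> smooth_on W f \<Longrightarrow> (\<And>x. x \<in> W \<Longrightarrow> f x \<noteq> 0) \<Longrightarrow> smooth_on W (\<lambda>x. inverse (f x))"
  by (simp add: smooth_on_def Ck_on_inverse)

lemma smooth_on_sqrt:
  "open W \<Longrightarrow> smooth_on W f \<Longrightarrow> (\<And>x. x \<in> W \<Longrightarrow> 0 < f x) \<Longrightarrow> smooth_on W (\<lambda>x. sqrt (f x))"
  by (simp add: smooth_on_def Ck_on_sqrt)

lemma smooth_on_compose:
  fixes f :: "'b::euclidean_space \<Rightarrow> real" and g :: "'a::euclidean_space \<Rightarrow> 'b"
  assumes "open W" "\<And>x. x \<in> W \<Longrightarrow> g x \<in> V" "smooth_on V f"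
    "\<And>c. c \<in> Basis \<Longrightarrow> smooth_on W (\<lambda>x. g x \<bullet> c)"
  shows "smooth_on W (\<lambda>x. f (g x))"
  unfolding smooth_on_def
proof
  fix k
  show "Ck_on k W (\<lambda>x. f (g x))"
    by (rule Ck_on_compose[OF assms(1,2)]) (use assms(3,4) in \<open>auto simp: smooth_on_def\<close>)
qed

lemma smooth_on_partial_deriv:
  "smooth_on W f \<Longrightarrow> b \<in> Basis \<Longrightarrow> smooth_on W (partial_deriv b f)"
  unfolding smooth_on_def by (rule allI, drule_tac x = "Suc k" in spec) simp

lemma smooth_on_laplacian:
  assumes "open W" "smooth_on W f" shows "smooth_on W (laplacian f)"
  unfolding laplacian_def[abs_def] using assms
  by (intro smooth_on_sum smooth_on_partial_deriv) auto

lemma smooth_on_norm_square: "smooth_on W (\<lambda>x. (norm x)\<^sup>2)"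
proof -
  have "smooth_on UNIV (\<lambda>x::'a. \<Sum>b\<in>Basis. (x \<bullet> b) * (x \<bullet> b))"
    by (intro smooth_on_sum smooth_on_mult smooth_on_inner) auto
  moreover have "(\<lambda>x::'a. \<Sum>b\<in>Basis. (x \<bullet> b) * (x \<bullet> b)) = (\<lambda>x. (norm x)\<^sup>2)"
    by (simp add: fun_eq_iff power2_norm_eq_inner euclidean_inner[symmetric])
  ultimately show ?thesis using smooth_on_subset[of UNIV _ W] by simp
qed

text \<open>The norm is written as the root of its square, a polynomial that is positive off the
  origin.\<close>

lemma smooth_on_sgn: "smooth_on (- {0}) (\<lambda>x. sgn x \<bullet> c)"
proof -
  have "smooth_on (- {0}) (\<lambda>x::'a. inverse (sqrt ((norm x)\<^sup>2)) * (x \<bullet> c))"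
    by (intro smooth_on_mult smooth_on_inverse smooth_on_sqrt smooth_on_norm_square smooth_on_inner) auto
  then show ?thesis by (simp add: sgn_div_norm)
qed

lemma smooth_on_differentiable: "smooth_on W f \<Longrightarrow> x \<in> W \<Longrightarrow> f differentiable at x"
  unfolding smooth_on_def by (drule spec[of _ "Suc 0"]) simp

lemma smooth_on_continuous: "smooth_on W f \<Longrightarrow> continuous_on W f"
  unfolding smooth_on_def by (drule spec[of _ 0]) simp

section \<open>Symmetry of second derivatives\<close>

lemma partial_deriv_along_line:
  assumes "f differentiable at (x + t *\<^sub>R b)"
  shows "((\<lambda>t. f (x + t *\<^sub>R b)) has_real_derivative partial_deriv b f (x + t *\<^sub>R b)) (at t)"
proof -
  have "((\<lambda>t. x + t *\<^sub>R b) has_derivative (\<lambda>h. h *\<^sub>R b)) (at t)"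
    by (auto intro!: derivative_eq_intros)
  from diff_chain_at[OF this assms[unfolded frechet_derivative_works]]
  have "((\<lambda>t. f (x + t *\<^sub>R b)) has_derivative
      (\<lambda>h. frechet_derivative f (at (x + t *\<^sub>R b)) (h *\<^sub>R b))) (at t)"
    by (simp add: o_def)
  moreover have "(\<lambda>h. frechet_derivative f (at (x + t *\<^sub>R b)) (h *\<^sub>R b))
      = (*) (partial_deriv b f (x + t *\<^sub>R b))"
    using linear_frechet_derivative[OF assms]
    by (auto simp: partial_deriv_def linear_cmul fun_eq_iff)
  ultimately show ?thesis by (simp add: has_field_derivative_def)
qed

text \<open>The mean value theorem is applied along \<open>b\<close> to the increment in direction
  \<open>c\<close>, then along \<open>c\<close> to the partial derivative so obtained. The second
  difference is symmetric in \<open>b\<close> and \<open>c\<close>, while the order of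
  differentiation on the right is not; comparing both orders gives Schwarz's theorem.\<close>

lemma second_difference_mean_value:
  fixes f :: "'a::euclidean_space \<Rightarrow> real"
  assumes f: "smooth_on UNIV f" and b: "b \<in> Basis" and h: "0 < h"
  obtains s t where "0 < s" "s < h" "0 < t" "t < h"
    "f (x + h *\<^sub>R b + h *\<^sub>R c) - f (x + h *\<^sub>R b) - f (x + h *\<^sub>R c) + f x
      = h * h * partial_deriv c (partial_deriv b f) (x + s *\<^sub>R b + t *\<^sub>R c)"
proof -
  define g where "g s = f (x + h *\<^sub>R c + s *\<^sub>R b) - f (x + s *\<^sub>R b)" for s
  have df: "f differentiable at y" "partial_deriv b f differentiable at y" for y
    using f b smooth_on_differentiable smooth_on_partial_deriv by blast+
  have "(g has_real_derivative
      partial_deriv b f (x + h *\<^sub>R c + s *\<^sub>R b) - partial_deriv b f (x + s *\<^sub>R b)) (at s)" for s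
    unfolding g_def by (intro DERIV_diff partial_deriv_along_line df)
  from MVT2[OF h this] obtain s where s: "0 < s" "s < h"
    "g h - g 0 = h * (partial_deriv b f (x + h *\<^sub>R c + s *\<^sub>R b) - partial_deriv b f (x + s *\<^sub>R b))"
    by auto
  from MVT2[OF h partial_deriv_along_line[OF df(2), of "x + s *\<^sub>R b" c]]
  obtain t where t: "0 < t" "t < h"
    "partial_deriv b f (x + s *\<^sub>R b + h *\<^sub>R c) - partial_deriv b f (x + s *\<^sub>R b)
      = h * partial_deriv c (partial_deriv b f) (x + s *\<^sub>R b + t *\<^sub>R c)"
    by auto
  have "x + h *\<^sub>R c + s *\<^sub>R b = x + s *\<^sub>R b + h *\<^sub>R c" "x + h *\<^sub>R c + h *\<^sub>R b = x + h *\<^sub>R b + h *\<^sub>R c"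
    by (simp_all add: algebra_simps)
  with s t that[of s t] show ?thesis by (simp add: g_def algebra_simps)
qed

lemma partial_deriv_commute:
  fixes f :: "'a::euclidean_space \<Rightarrow> real"
  assumes f: "smooth_on UNIV f" and b: "b \<in> Basis" and c: "c \<in> Basis"
  shows "partial_deriv b (partial_deriv c f) x = partial_deriv c (partial_deriv b f) x"
proof (rule ccontr)
  let ?B = "partial_deriv b (partial_deriv c f)" and ?C = "partial_deriv c (partial_deriv b f)"
  assume ne: "?B x \<noteq> ?C x"
  \<comment> \<open>Half the gap: two equal numbers cannot lie within \<open>e\<close> of
    \<open>?B x\<close> and of \<open>?C x\<close> respectively.\<close>
  define e where "e = \<bar>?B x - ?C x\<bar> / 2"
  have e: "e > 0" using ne by (simp add: e_def)
  have cont: "continuous (at x) ?B" "continuous (at x) ?C"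
    using smooth_on_continuous[OF smooth_on_partial_deriv[OF smooth_on_partial_deriv[OF f]]] b c
    by (auto simp: continuous_on_eq_continuous_at)
  obtain d where d: "d > 0" "\<And>y. dist y x < d \<Longrightarrow> \<bar>?B y - ?B x\<bar> < e"
      "\<And>y. dist y x < d \<Longrightarrow> \<bar>?C y - ?C x\<bar> < e"
  proof -
    obtain d1 where "d1 > 0" "\<And>y. dist y x < d1 \<Longrightarrow> \<bar>?B y - ?B x\<bar> < e"
      using cont(1) e unfolding continuous_at_eps_delta dist_real_def by blast
    moreover obtain d2 where "d2 > 0" "\<And>y. dist y x < d2 \<Longrightarrow> \<bar>?C y - ?C x\<bar> < e"
      using cont(2) e unfolding continuous_at_eps_delta dist_real_def by blast
    ultimately show ?thesis using that[of "min d1 d2"] by auto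
  qed
  \<comment> \<open>The intermediate points are displaced by less than \<open>2 * h\<close>, which
    has to stay below \<open>d\<close>.\<close>
  define h where "h = d / 3"
  have h: "h > 0" using d by (simp add: h_def)
  obtain s t where st: "0 < s" "s < h" "0 < t" "t < h"
    "f (x + h *\<^sub>R b + h *\<^sub>R c) - f (x + h *\<^sub>R b) - f (x + h *\<^sub>R c) + f x
      = h * h * ?C (x + s *\<^sub>R b + t *\<^sub>R c)"
    using second_difference_mean_value[OF f b h] by metis
  obtain s' t' where st': "0 < s'" "s' < h" "0 < t'" "t' < h"
    "f (x + h *\<^sub>R c + h *\<^sub>R b) - f (x + h *\<^sub>R c) - f (x + h *\<^sub>R b) + f x
      = h * h * ?B (x + s' *\<^sub>R c + t' *\<^sub>R b)"
    using second_difference_mean_value[OF f c h] by metis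
  have "x + h *\<^sub>R c + h *\<^sub>R b = x + h *\<^sub>R b + h *\<^sub>R c" by (simp add: algebra_simps)
  with st(5) st'(5) have "h * h * ?B (x + s' *\<^sub>R c + t' *\<^sub>R b) = h * h * ?C (x + s *\<^sub>R b + t *\<^sub>R c)"
    by (simp only:)
  with h have eq: "?B (x + s' *\<^sub>R c + t' *\<^sub>R b) = ?C (x + s *\<^sub>R b + t *\<^sub>R c)" by simp
  have near: "dist (x + s *\<^sub>R u + t *\<^sub>R v) x < d"
    if "u \<in> Basis" "v \<in> Basis" "0 < s" "s < h" "0 < t" "t < h" for s t u v
  proof -
    have "norm (s *\<^sub>R u + t *\<^sub>R v) \<le> s + t"
      using norm_triangle_ineq[of "s *\<^sub>R u" "t *\<^sub>R v"] that by simp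
    moreover have "s + t < d" using that h by (simp add: h_def)
    ultimately show ?thesis by (simp add: dist_norm add.assoc)
  qed
  have "\<bar>?B (x + s' *\<^sub>R c + t' *\<^sub>R b) - ?B x\<bar> < e" "\<bar>?C (x + s *\<^sub>R b + t *\<^sub>R c) - ?C x\<bar> < e"
    using d near b c st st' by blast+
  with eq e_def show False by (simp only:) argo
qed

subsection \<open>The Paneitz operator in stereographic coordinates\<close>

text \<open>The operator x . grad. It is the first-order term of the Laplacian in the chart, and it
  kills functions constant along rays.\<close>

definition euler :: "('a::euclidean_space \<Rightarrow> real) \<Rightarrow> 'a \<Rightarrow> real" where
  "euler f x = (\<Sum>b\<in>Basis. (x \<bullet> b) * partial_deriv b f x)"

lemma smooth_on_euler:
  assumes "open W" "smooth_on W f" shows "smooth_on W (euler f)"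
  unfolding euler_def[abs_def] using assms
  by (intro smooth_on_sum smooth_on_mult smooth_on_inner smooth_on_partial_deriv) auto

lemma partial_deriv_mult_smooth:
  assumes "smooth_on UNIV f" "smooth_on UNIV g"
  shows "partial_deriv b (\<lambda>x. f x * g x) = (\<lambda>x. partial_deriv b f x * g x + f x * partial_deriv b g x)"
  using assms by (intro ext partial_deriv_mult smooth_on_differentiable[of UNIV]) auto

lemma partial_deriv_add_smooth:
  assumes "smooth_on UNIV f" "smooth_on UNIV g"
  shows "partial_deriv b (\<lambda>x. f x + g x) = (\<lambda>x. partial_deriv b f x + partial_deriv b g x)"
  using assms by (intro ext partial_deriv_add smooth_on_differentiable[of UNIV]) auto

lemma laplacian_add:
  assumes f: "smooth_on UNIV f" and g: "smooth_on UNIV g"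
  shows "laplacian (\<lambda>x. f x + g x) x = laplacian f x + laplacian g x"
  unfolding laplacian_def
  by (simp add: partial_deriv_add_smooth f g smooth_on_partial_deriv sum.distrib)

lemma laplacian_mult:
  assumes f: "smooth_on UNIV f" and g: "smooth_on UNIV g"
  shows "laplacian (\<lambda>x. f x * g x) x
    = laplacian f x * g x + 2 * (\<Sum>b\<in>Basis. partial_deriv b f x * partial_deriv b g x) + f x * laplacian g x"
proof -
  have "partial_deriv b (partial_deriv b (\<lambda>x. f x * g x)) x
    = partial_deriv b (partial_deriv b f) x * g x + 2 * (partial_deriv b f x * partial_deriv b g x)
      + f x * partial_deriv b (partial_deriv b g) x" if "b \<in> Basis" for b
    using that f g
    by (simp add: partial_deriv_mult_smooth partial_deriv_add_smooth smooth_on_partial_deriv smooth_on_mult)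
  then show ?thesis
    by (simp add: laplacian_def sum.distrib sum_distrib_left sum_distrib_right)
qed

lemma laplacian_const [simp]: "laplacian (\<lambda>x. c) x = 0"
  by (simp add: laplacian_def)

lemma laplacian_cmult:
  "smooth_on UNIV f \<Longrightarrow> laplacian (\<lambda>x. c * f x) x = c * laplacian f x"
  using laplacian_mult[OF smooth_on_const[of UNIV c], of f x] by simp

lemma euler_add:
  "smooth_on UNIV f \<Longrightarrow> smooth_on UNIV g \<Longrightarrow> euler (\<lambda>x. f x + g x) x = euler f x + euler g x"
  by (simp add: euler_def partial_deriv_add_smooth sum.distrib distrib_left)

lemma euler_mult:
  "smooth_on UNIV f \<Longrightarrow> smooth_on UNIV g \<Longrightarrow>
    euler (\<lambda>x. f x * g x) x = euler f x * g x + f x * euler g x"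
  by (simp add: euler_def partial_deriv_mult_smooth sum.distrib distrib_left sum_distrib_left
      sum_distrib_right mult_ac)

lemma euler_cmult: "smooth_on UNIV f \<Longrightarrow> euler (\<lambda>x. c * f x) x = c * euler f x"
  by (simp add: euler_def partial_deriv_mult_smooth smooth_on_const sum_distrib_left mult_ac)

text \<open>Local in an open set because it serves functions on the whole space and also
  ray-constant extensions, whose smoothness is given only off the origin.\<close>

lemma partial_deriv_euler:
  fixes f :: "'a::euclidean_space \<Rightarrow> real"
  assumes "open W" "x \<in> W" "smooth_on W f" and b: "b \<in> Basis"
  shows "partial_deriv b (euler f) x
    = partial_deriv b f x + (\<Sum>c\<in>Basis. (x \<bullet> c) * partial_deriv b (partial_deriv c f) x)"
proof -
  have d: "partial_deriv c f differentiable at x" if "c \<in> Basis" for c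
    using smooth_on_differentiable[OF smooth_on_partial_deriv[OF assms(3) that] assms(2)] .
  have d': "(\<lambda>x. x \<bullet> c) differentiable at x" for c
    using smooth_on_differentiable[OF smooth_on_inner[of UNIV c]] by simp
  have "partial_deriv b (euler f) x
      = (\<Sum>c\<in>Basis. partial_deriv b (\<lambda>x. (x \<bullet> c) * partial_deriv c f x) x)"
    unfolding euler_def[abs_def] using d d' by (intro partial_deriv_sum) auto
  also have "\<dots> = (\<Sum>c\<in>Basis. (b \<bullet> c) * partial_deriv c f x
      + (x \<bullet> c) * partial_deriv b (partial_deriv c f) x)"
    using d d' by (intro sum.cong refl) (simp add: partial_deriv_mult)
  also have "(\<Sum>c\<in>Basis. (b \<bullet> c) * partial_deriv c f x) = partial_deriv b f x"
    using b by (simp add: inner_Basis if_distrib[of "\<lambda>t. t * _"] cong: if_cong)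
  ultimately show ?thesis
    by (simp add: sum.distrib)
qed

text \<open>Each of the two derivatives in the Laplacian can hit the coefficient x once, leaving one
  second derivative each time. What remains is the Euler operator on the Laplacian, by symmetry of
  second derivatives.\<close>

lemma laplacian_euler:
  assumes f: "smooth_on UNIV f"
  shows "laplacian (euler f) x = euler (laplacian f) x + 2 * laplacian f x"
proof -
  note pd = smooth_on_partial_deriv[OF f]
  have E: "partial_deriv b (euler f) = (\<lambda>x. partial_deriv b f x + euler (partial_deriv b f) x)"
    if "b \<in> Basis" for b
    using that partial_deriv_euler[OF open_UNIV UNIV_I f that] partial_deriv_commute[OF f that]
    by (auto simp: euler_def)
  have "partial_deriv b (partial_deriv b (euler f)) x
      = 2 * partial_deriv b (partial_deriv b f) x
        + (\<Sum>c\<in>Basis. (x \<bullet> c) * partial_deriv c (partial_deriv b (partial_deriv b f)) x)"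
    if b: "b \<in> Basis" for b
    using b partial_deriv_euler[OF open_UNIV UNIV_I pd[OF b] b, of x]
      partial_deriv_commute[OF pd[OF b] b]
    by (simp add: E partial_deriv_add_smooth pd smooth_on_euler)
  moreover have "euler (laplacian f) x
      = (\<Sum>c\<in>Basis. (x \<bullet> c) * (\<Sum>b\<in>Basis. partial_deriv c (partial_deriv b (partial_deriv b f)) x))"
    unfolding euler_def laplacian_def[abs_def]
    by (intro sum.cong refl arg_cong2[where f = "(*)"] partial_deriv_sum smooth_on_differentiable[of UNIV]
        smooth_on_partial_deriv f) auto
  then have "euler (laplacian f) x
      = (\<Sum>b\<in>Basis. \<Sum>c\<in>Basis. (x \<bullet> c) * partial_deriv c (partial_deriv b (partial_deriv b f)) x)"
    by (simp only: sum_distrib_left) (rule sum.swap)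
  ultimately show ?thesis
    by (simp add: laplacian_def[of "euler f"] laplacian_def[of f] sum.distrib sum_distrib_left)
qed

definition stereo_inv_factor :: "R4 \<Rightarrow> real" where
  "stereo_inv_factor x = (1 + (norm x)\<^sup>2) / 2"

text \<open>The Laplace--Beltrami operator of the round metric \<open>m\<^sup>-\<^sup>2 dx\<^sup>2\<close> in stereographic coordinates.\<close>

definition stereo_laplacian :: "(R4 \<Rightarrow> real) \<Rightarrow> R4 \<Rightarrow> real" where
  "stereo_laplacian f x =
     stereo_inv_factor x * (stereo_inv_factor x * laplacian f x - 2 * euler f x)"

lemma stereo_inv_factor_pos: "0 < stereo_inv_factor x"
  by (simp add: stereo_inv_factor_def add_pos_nonneg)

lemma smooth_on_stereo_inv_factor: "smooth_on UNIV stereo_inv_factor"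
proof -
  have "smooth_on UNIV (\<lambda>x::R4. 1 / 2 * (1 + (norm x)\<^sup>2))"
    by (intro smooth_on_mult smooth_on_add smooth_on_const smooth_on_norm_square) auto
  then show ?thesis by (simp add: stereo_inv_factor_def[abs_def])
qed

lemma has_derivative_stereo_inv_factor: "(stereo_inv_factor has_derivative (\<lambda>v. x \<bullet> v)) (at x)"
  unfolding stereo_inv_factor_def[abs_def] power2_norm_eq_inner
  by (auto intro!: derivative_eq_intros simp: inner_commute)

lemma partial_deriv_stereo_inv_factor: "partial_deriv b stereo_inv_factor = (\<lambda>x. x \<bullet> b)"
  using partial_deriv_eq[OF has_derivative_stereo_inv_factor] by (rule ext)

text \<open>The gradient of m is x, so the mixed term of the product rule is the Euler operator; the
  Laplacian of m is the dimension 4.\<close>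

lemma laplacian_stereo_inv_factor_mult:
  assumes h: "smooth_on UNIV h"
  shows "laplacian (\<lambda>x. stereo_inv_factor x * h x) x
    = 4 * h x + 2 * euler h x + stereo_inv_factor x * laplacian h x"
proof -
  have "laplacian stereo_inv_factor x = 4"
    by (simp add: laplacian_def partial_deriv_stereo_inv_factor)
  then show ?thesis
    by (simp add: laplacian_mult[OF smooth_on_stereo_inv_factor h] partial_deriv_stereo_inv_factor euler_def)
qed

lemma euler_stereo_inv_factor_mult:
  assumes h: "smooth_on UNIV h"
  shows "euler (\<lambda>x. stereo_inv_factor x * h x) x
    = (2 * stereo_inv_factor x - 1) * h x + stereo_inv_factor x * euler h x"
proof -
  have "euler stereo_inv_factor x = 2 * stereo_inv_factor x - 1"
    by (simp add: euler_def partial_deriv_stereo_inv_factor euclidean_inner[symmetric]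
        power2_norm_eq_inner stereo_inv_factor_def add_divide_distrib)
  then show ?thesis by (simp add: euler_mult[OF smooth_on_stereo_inv_factor h])
qed

lemma smooth_on_stereo_laplacian:
  assumes "smooth_on UNIV f" shows "smooth_on UNIV (stereo_laplacian f)"
proof -
  have "smooth_on UNIV (\<lambda>x. stereo_inv_factor x *
      (stereo_inv_factor x * laplacian f x + (- 2) * euler f x))"
    by (intro smooth_on_mult smooth_on_add smooth_on_const smooth_on_stereo_inv_factor
        smooth_on_laplacian smooth_on_euler assms open_UNIV)
  then show ?thesis by (simp add: stereo_laplacian_def[abs_def])
qed

lemma stereo_laplacian_add:
  "smooth_on UNIV f \<Longrightarrow> smooth_on UNIV g \<Longrightarrow>
    stereo_laplacian (\<lambda>x. f x + g x) x = stereo_laplacian f x + stereo_laplacian g x"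
  by (simp add: stereo_laplacian_def laplacian_add euler_add algebra_simps)

lemma stereo_laplacian_cmult:
  "smooth_on UNIV f \<Longrightarrow> stereo_laplacian (\<lambda>x. c * f x) x = c * stereo_laplacian f x"
  by (simp add: stereo_laplacian_def laplacian_cmult euler_cmult algebra_simps)

text \<open>The first-order terms cancel because \<open>[\<Delta>, x \<cdot> \<nabla>] = 2 \<Delta>\<close>; this is special to dimension 4,
  where \<open>\<Delta> m = 4\<close>.\<close>

lemma stereo_laplacian_twice:
  assumes f: "smooth_on UNIV f"
  shows "stereo_laplacian (stereo_laplacian f) x
    = stereo_inv_factor x ^ 4 * laplacian (laplacian f) x + 2 * stereo_laplacian f x"
proof -
  let ?m = stereo_inv_factor
  define g where "g = laplacian f"
  define h where "h = (\<lambda>x. ?m x * g x + (- 2) * euler f x)"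
  have g: "smooth_on UNIV g" and e: "smooth_on UNIV (euler f)"
    unfolding g_def using f by (simp_all add: smooth_on_laplacian smooth_on_euler)
  have h: "smooth_on UNIV h"
    unfolding h_def
    by (intro smooth_on_mult smooth_on_add smooth_on_const smooth_on_stereo_inv_factor g e open_UNIV)
  have mg: "smooth_on UNIV (\<lambda>x. ?m x * g x)" and e2: "smooth_on UNIV (\<lambda>x. (- 2) * euler f x)"
    by (intro smooth_on_mult smooth_on_const smooth_on_stereo_inv_factor g e open_UNIV)+
  have Lf: "stereo_laplacian f = (\<lambda>x. ?m x * h x)"
    by (simp add: stereo_laplacian_def[abs_def] h_def g_def)
  \<comment> \<open>The part \<open>4 g + 2 euler g\<close> coming from \<open>m g\<close> cancels
    against \<open>- 2 (euler g + 2 g)\<close> from the commutator.\<close>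
  have "laplacian h x = ?m x * laplacian g x"
    unfolding h_def laplacian_add[OF mg e2] laplacian_stereo_inv_factor_mult[OF g]
      laplacian_cmult[OF e] laplacian_euler[OF f] g_def[symmetric] by simp
  \<comment> \<open>The terms in \<open>euler h\<close> cancel. Because the Euler operator sends m
    to \<open>2 * m - 1\<close>, the terms in \<open>h\<close> leave \<open>2 * m * h\<close>, which
    is twice \<open>stereo_laplacian f\<close>.\<close>
  then show ?thesis
    unfolding Lf stereo_laplacian_def[of "\<lambda>x. ?m x * h x"] laplacian_stereo_inv_factor_mult[OF h]
      euler_stereo_inv_factor_mult[OF h] g_def[symmetric]
    by (simp add: algebra_simps power4_eq_xxxx)
qed

section \<open>First and second derivatives of stereographic projection\<close>

lemma sum_inner_Basis:
  fixes c :: "'a::euclidean_space"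
  assumes "c \<in> Basis" shows "(\<Sum>d\<in>Basis. g d * (d \<bullet> c)) = g c"
  using assms by (simp add: inner_Basis if_distrib[of "\<lambda>t. _ * t"] cong: if_cong)

text \<open>Up to a constant, every coordinate of \<open>stereo\<close> is an affine function
  divided by m. Taking \<open>c\<close> general treats the four horizontal coordinates and the
  vertical one together.\<close>

lemma stereo_inner:
  "stereo x \<bullet> c = inverse (stereo_inv_factor x) * (x \<bullet> fst c + snd c) - snd c"
proof -
  have "(1 - (norm x)\<^sup>2) / (1 + (norm x)\<^sup>2) = 2 / (1 + (norm x)\<^sup>2) - 1"
    using zero_le_power2[of "norm x"] by (simp add: field_simps add_nonneg_eq_0_iff)
  then show ?thesis
    unfolding stereo_def inner_prod_def stereo_inv_factor_def inverse_divide
    by (simp only: fst_conv snd_conv inner_scaleR_left inner_real_def)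
      (simp add: algebra_simps add_divide_distrib)
qed

lemma norm_stereo [simp]: "norm (stereo x) = 1"
proof -
  have "1 + (norm x)\<^sup>2 \<noteq> 0" using zero_le_power2[of "norm x"] by linarith
  then have "(2 / (1 + (norm x)\<^sup>2))\<^sup>2 * (norm x)\<^sup>2 + ((1 - (norm x)\<^sup>2) / (1 + (norm x)\<^sup>2))\<^sup>2 = 1"
    by (simp add: divide_simps) algebra
  then have "(norm (stereo x))\<^sup>2 = 1"
    by (simp only: stereo_def norm_prod_def fst_conv snd_conv norm_scaleR power_mult_distrib
        real_norm_def power2_abs real_sqrt_pow2_iff)
  then show ?thesis using power2_eq_1_iff[of "norm (stereo x)"] norm_ge_zero[of "stereo x"] by linarith
qed

lemma sgn_stereo [simp]: "sgn (stereo x) = stereo x"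
  by (simp add: sgn_div_norm)

lemma smooth_on_stereo_inner: "smooth_on UNIV (\<lambda>x. stereo x \<bullet> c)"
proof -
  have "smooth_on UNIV (\<lambda>x. inverse (stereo_inv_factor x) * (x \<bullet> fst c + snd c) + - snd c)"
    using stereo_inv_factor_pos
    by (intro smooth_on_mult smooth_on_add smooth_on_inverse smooth_on_const smooth_on_inner
        smooth_on_stereo_inv_factor open_UNIV) (metis less_irrefl)
  then show ?thesis by (simp add: stereo_inner)
qed

lemma partial_deriv_stereo:
  "partial_deriv b (\<lambda>x. stereo x \<bullet> c) = (\<lambda>x. inverse (stereo_inv_factor x) * (b \<bullet> fst c)
      - inverse (stereo_inv_factor x) ^ 2 * (x \<bullet> b) * (x \<bullet> fst c + snd c))"
proof
  fix x :: R4
  note m = has_derivative_stereo_inv_factor[of x]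
  have m0: "stereo_inv_factor x \<noteq> 0" using stereo_inv_factor_pos[of x] by simp
  have "((\<lambda>x. stereo x \<bullet> c) has_derivative
      (\<lambda>v. inverse (stereo_inv_factor x) * (v \<bullet> fst c)
      - inverse (stereo_inv_factor x) ^ 2 * (x \<bullet> v) * (x \<bullet> fst c + snd c))) (at x)"
    unfolding stereo_inner
    by (rule derivative_eq_intros Deriv.has_derivative_inverse m m0 refl)+
       (simp add: fun_eq_iff algebra_simps power2_eq_square)
  then show "partial_deriv b (\<lambda>x. stereo x \<bullet> c) x = inverse (stereo_inv_factor x) * (b \<bullet> fst c)
      - inverse (stereo_inv_factor x) ^ 2 * (x \<bullet> b) * (x \<bullet> fst c + snd c)"
    by (rule partial_deriv_eq)
qed

lemma inner_self_stereo_inv_factor: "x \<bullet> x = 2 * stereo_inv_factor x - 1"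
  by (simp add: stereo_inv_factor_def power2_norm_eq_inner add_divide_distrib)

text \<open>Conformality: with S for \<open>stereo x\<close> and DS for its differential, DS DS^T is
  m^-2 times I - S S^T, the projection onto the tangent space of the sphere at S. The relation
  \<open>l * (x \<bullet> x) = 2 - l\<close> collects the terms into this form.\<close>

lemma stereo_conformal:
  "(\<Sum>b\<in>Basis. partial_deriv b (\<lambda>x. stereo x \<bullet> c) x * partial_deriv b (\<lambda>x. stereo x \<bullet> d) x)
    = inverse (stereo_inv_factor x) ^ 2 * (c \<bullet> d - (stereo x \<bullet> c) * (stereo x \<bullet> d))"
proof -
  define l where "l = inverse (stereo_inv_factor x)"
  define p where "p = x \<bullet> fst c + snd c"
  define q where "q = x \<bullet> fst d + snd d"
  have l: "l * (x \<bullet> x) = 2 - l"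
    using stereo_inv_factor_pos[of x] by (simp add: l_def inner_self_stereo_inv_factor field_simps)
  have "(\<Sum>b\<in>Basis. partial_deriv b (\<lambda>x. stereo x \<bullet> c) x * partial_deriv b (\<lambda>x. stereo x \<bullet> d) x)
      = (\<Sum>b\<in>Basis. l\<^sup>2 * ((fst c \<bullet> b) * (fst d \<bullet> b)) - l ^ 3 * q * ((x \<bullet> b) * (fst c \<bullet> b))
          - l ^ 3 * p * ((x \<bullet> b) * (fst d \<bullet> b)) + l ^ 4 * p * q * ((x \<bullet> b) * (x \<bullet> b)))"
    unfolding partial_deriv_stereo l_def[symmetric] p_def[symmetric] q_def[symmetric]
    by (intro sum.cong refl) (simp add: inner_commute algebra_simps power2_eq_square power3_eq_cube power4_eq_xxxx)
  also have "\<dots> = l\<^sup>2 * (fst c \<bullet> fst d) - l ^ 3 * q * (x \<bullet> fst c) - l ^ 3 * p * (x \<bullet> fst d)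
      + l ^ 4 * p * q * (x \<bullet> x)"
    by (simp add: sum.distrib sum_subtractf sum_distrib_left[symmetric] euclidean_inner[symmetric])
  also have "\<dots> = l\<^sup>2 * (fst c \<bullet> fst d) - l ^ 3 * q * (p - snd c) - l ^ 3 * p * (q - snd d)
      + l ^ 3 * p * q * (l * (x \<bullet> x))"
    by (simp add: p_def q_def algebra_simps power3_eq_cube power4_eq_xxxx)
  also have "\<dots> = l\<^sup>2 * (c \<bullet> d - (l * p - snd c) * (l * q - snd d))"
    unfolding l inner_prod_def by (simp add: algebra_simps power2_eq_square power3_eq_cube)
  finally show ?thesis by (simp add: stereo_inner l_def p_def q_def)
qed

text \<open>Multiplied by m^2, this is the eigenvalue equation of the degree-one spherical
  harmonics: the Laplacian of the sphere acts on a linear coordinate as -4.\<close>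

lemma laplacian_stereo_inner:
  "laplacian (\<lambda>x. stereo x \<bullet> c) x
    = 2 * inverse (stereo_inv_factor x) * euler (\<lambda>x. stereo x \<bullet> c) x
      - 4 * inverse (stereo_inv_factor x) ^ 2 * (stereo x \<bullet> c)"
proof -
  define l where "l = (\<lambda>x. inverse (stereo_inv_factor x))"
  define p where "p = (\<lambda>x::R4. x \<bullet> fst c + snd c)"
  have l: "l x * (x \<bullet> x) = 2 - l x"
    using stereo_inv_factor_pos[of x] by (simp add: l_def inner_self_stereo_inv_factor field_simps)
  note m = has_derivative_stereo_inv_factor[of x]
  have m0: "stereo_inv_factor x \<noteq> 0" using stereo_inv_factor_pos[of x] by simp
  have dl: "(l has_derivative (\<lambda>v. - (l x)\<^sup>2 * (x \<bullet> v))) (at x)"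
    unfolding l_def
    by (rule derivative_eq_intros Deriv.has_derivative_inverse m m0 refl)+
       (simp add: fun_eq_iff algebra_simps power2_eq_square)
  have dp: "(p has_derivative (\<lambda>v. v \<bullet> fst c)) (at x)"
    unfolding p_def by (auto intro!: derivative_eq_intros)
  have pd: "partial_deriv b (\<lambda>x. stereo x \<bullet> c) = (\<lambda>x. l x * (b \<bullet> fst c) - (l x)\<^sup>2 * (x \<bullet> b) * p x)" for b
    by (simp add: partial_deriv_stereo l_def p_def)
  have "partial_deriv b (partial_deriv b (\<lambda>x. stereo x \<bullet> c)) x
      = 2 * l x ^ 3 * p x * ((x \<bullet> b) * (x \<bullet> b)) - (l x)\<^sup>2 * p x - 2 * (l x)\<^sup>2 * ((x \<bullet> b) * (fst c \<bullet> b))"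
    if "b \<in> Basis" for b
  proof -
    have "((\<lambda>x. l x * (b \<bullet> fst c) - (l x)\<^sup>2 * (x \<bullet> b) * p x) has_derivative
      (\<lambda>v. - (l x)\<^sup>2 * (x \<bullet> v) * (b \<bullet> fst c) - (2 * l x * (- (l x)\<^sup>2 * (x \<bullet> v)) * (x \<bullet> b) * p x
         + (l x)\<^sup>2 * (v \<bullet> b) * p x + (l x)\<^sup>2 * (x \<bullet> b) * (v \<bullet> fst c)))) (at x)"
      by (rule derivative_eq_intros dl dp refl)+ (simp add: fun_eq_iff algebra_simps)
    from partial_deriv_eq[OF this, of b] that show ?thesis
      unfolding pd by (simp add: inner_commute algebra_simps power2_eq_square power3_eq_cube)
  qed
  then have "laplacian (\<lambda>x. stereo x \<bullet> c) x
      = 2 * l x ^ 3 * p x * (x \<bullet> x) - 4 * (l x)\<^sup>2 * p x - 2 * (l x)\<^sup>2 * (x \<bullet> fst c)"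
    by (simp add: laplacian_def sum_subtractf sum.distrib sum_distrib_left[symmetric] euclidean_inner[symmetric])
  also have "\<dots> = 2 * (l x)\<^sup>2 * p x * (l x * (x \<bullet> x)) - 4 * (l x)\<^sup>2 * p x - 2 * (l x)\<^sup>2 * (x \<bullet> fst c)"
    by (simp add: power2_eq_square power3_eq_cube algebra_simps)
  finally have lap: "laplacian (\<lambda>x. stereo x \<bullet> c) x
      = 2 * (l x)\<^sup>2 * p x * (2 - l x) - 4 * (l x)\<^sup>2 * p x - 2 * (l x)\<^sup>2 * (x \<bullet> fst c)"
    unfolding l .
  have "euler (\<lambda>x. stereo x \<bullet> c) x
      = (\<Sum>b\<in>Basis. l x * ((x \<bullet> b) * (fst c \<bullet> b)) - (l x)\<^sup>2 * p x * ((x \<bullet> b) * (x \<bullet> b)))"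
    unfolding euler_def pd by (intro sum.cong refl) (simp add: inner_commute algebra_simps)
  also have "\<dots> = l x * (x \<bullet> fst c) - l x * p x * (l x * (x \<bullet> x))"
    by (simp add: sum_subtractf sum_distrib_left[symmetric] euclidean_inner[symmetric] power2_eq_square algebra_simps)
  finally have eu: "euler (\<lambda>x. stereo x \<bullet> c) x = l x * (x \<bullet> fst c) - l x * p x * (2 - l x)"
    unfolding l .
  have px: "x \<bullet> fst c = p x - snd c" by (simp add: p_def)
  have S: "stereo x \<bullet> c = l x * p x - snd c" by (simp add: stereo_inner l_def p_def)
  show ?thesis
    unfolding lap eu S l_def[symmetric] fun_cong[OF l_def[symmetric]] px
    by (simp add: algebra_simps power2_eq_square)
qed

section \<open>Functions on the sphere extended constantly along rays\<close>

lemma partial_deriv_sgn: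
  fixes x :: "'a::euclidean_space"
  assumes "norm x = 1"
  shows "partial_deriv b (\<lambda>y. sgn y \<bullet> c) x = b \<bullet> c - (x \<bullet> b) * (x \<bullet> c)"
proof -
  have x0: "x \<noteq> 0" using assms by auto
  have "((\<lambda>y. inverse (norm y) * (y \<bullet> c)) has_derivative
      (\<lambda>v. v \<bullet> c - (x \<bullet> v) * (x \<bullet> c))) (at x)"
    using x0 assms
    by (auto intro!: derivative_eq_intros has_derivative_norm simp: fun_eq_iff sgn_div_norm inner_commute)
  then have "((\<lambda>y. sgn y \<bullet> c) has_derivative (\<lambda>v. v \<bullet> c - (x \<bullet> v) * (x \<bullet> c))) (at x)"
    by (simp add: sgn_div_norm)
  then show ?thesis by (rule partial_deriv_eq)
qed

context
  fixes \<psi> F :: "'a::euclidean_space \<Rightarrow> real"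
  assumes psi: "sph_smooth \<psi>" and F_def: "F = (\<lambda>y. \<psi> (sgn y))"
begin

lemma smooth_ray_constant: "smooth_on (- {0}) F"
  using psi by (simp add: sph_smooth_def F_def)

lemma euler_ray_constant:
  assumes "y \<noteq> 0" shows "euler F y = 0"
proof -
  have d: "F differentiable at y"
    using smooth_on_differentiable[OF smooth_ray_constant] assms by simp
  have "((\<lambda>t. F (y + t *\<^sub>R y)) has_real_derivative partial_deriv y F y) (at 0)"
    using partial_deriv_along_line[of F y 0 y] d by simp
  moreover have "((\<lambda>t. F (y + t *\<^sub>R y)) has_real_derivative 0) (at 0)"
  proof (rule has_field_derivative_transform_within_open[of "\<lambda>t. F y"])
    show "open {- 1<..<1::real}" "0 \<in> {- 1<..<1::real}" by auto
    fix t :: real assume "t \<in> {- 1<..<1}"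
    then have "0 < 1 + t" by simp
    then have "sgn ((1 + t) *\<^sub>R y) = sgn y" by (simp add: sgn_scaleR)
    then show "F y = F (y + t *\<^sub>R y)" by (simp add: F_def algebra_simps)
  qed auto
  ultimately have "partial_deriv y F y = 0" by (rule DERIV_unique)
  then show ?thesis
    using partial_deriv_eq[OF has_derivative_partial_deriv[OF d], of y] by (simp add: euler_def)
qed

text \<open>Differentiate \<open>euler F = 0\<close> and contract with y; the first-order term that
  appears is \<open>euler F\<close> again. The function vanishes on an open set, so its derivatives
  do too.\<close>

lemma hessian_ray_constant:
  assumes "y \<noteq> 0"
  shows "(\<Sum>c\<in>Basis. \<Sum>d\<in>Basis. partial_deriv d (partial_deriv c F) y * ((y \<bullet> c) * (y \<bullet> d))) = 0"
proof -
  have "partial_deriv d F y + (\<Sum>c\<in>Basis. (y \<bullet> c) * partial_deriv d (partial_deriv c F) y) = 0"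
    if "d \<in> Basis" for d
    using partial_deriv_euler[OF _ _ smooth_ray_constant that, of y] assms
      partial_deriv_cong_open[of "- {0}" y "euler F" "\<lambda>_. 0" d] euler_ray_constant
    by (simp add: open_Compl)
  then have "0 = (\<Sum>d\<in>Basis. (y \<bullet> d) * (partial_deriv d F y
      + (\<Sum>c\<in>Basis. (y \<bullet> c) * partial_deriv d (partial_deriv c F) y)))"
    by simp
  also have "\<dots> = euler F y
      + (\<Sum>d\<in>Basis. \<Sum>c\<in>Basis. partial_deriv d (partial_deriv c F) y * ((y \<bullet> c) * (y \<bullet> d)))"
    by (simp add: euler_def sum.distrib distrib_left sum_distrib_left mult_ac)
  finally show ?thesis
    using euler_ray_constant[OF assms] by (subst sum.swap) simp
qed

text \<open>The divergence differentiates the gradient composed with \<open>sgn\<close>, and the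
  differential of \<open>sgn\<close> at a unit vector x is the projection I - x x^T. Hence the trace
  is that of the Hessian minus Hess F(x, x), which is 0.\<close>

lemma sph_laplacian_eq_laplacian:
  assumes x: "norm x = 1" shows "sph_laplacian \<psi> x = laplacian F x"
proof -
  have x0: "x \<noteq> 0" and sx: "sgn x = x" using x by (auto simp: sgn_div_norm)
  have sm: "smooth_on (- {0}) (\<lambda>y. partial_deriv b F (sgn y))" if "b \<in> Basis" for b
    by (rule smooth_on_compose[OF _ _ smooth_on_partial_deriv[OF smooth_ray_constant that] smooth_on_sgn])
       (auto simp: sgn_zero_iff)
  let ?X = "\<lambda>y. sph_grad \<psi> (sgn y)"
  have X: "?X y \<bullet> b = partial_deriv b F (sgn y)" if "b \<in> Basis" for y b
    using that by (simp add: sph_grad_def partial_deriv_def F_def inner_sum_left sum_inner_Basis)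
  have "?X differentiable at x"
    by (rule differentiable_componentwise) (use smooth_on_differentiable[OF sm] x0 X in simp)
  then have dX: "(?X has_derivative frechet_derivative ?X (at x)) (at x)"
    by (rule frechet_derivative_works[THEN iffD1])
  have "frechet_derivative ?X (at x) b \<bullet> b
      = (\<Sum>c\<in>Basis. partial_deriv c (partial_deriv b F) x * (b \<bullet> c - (x \<bullet> b) * (x \<bullet> c)))"
    if b: "b \<in> Basis" for b
  proof -
    have "frechet_derivative ?X (at x) b \<bullet> b = partial_deriv b (\<lambda>y. partial_deriv b F (sgn y)) x"
      using partial_deriv_eq[OF has_derivative_inner_left[OF dX], of b b] by (simp add: X b)
    also have "\<dots> = (\<Sum>c\<in>Basis. partial_deriv c (partial_deriv b F) (sgn x) * partial_deriv b (\<lambda>y. sgn y \<bullet> c) x)"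
      using x0 sx smooth_on_differentiable[OF smooth_on_partial_deriv[OF smooth_ray_constant b]]
        smooth_on_differentiable[OF smooth_on_sgn]
      by (intro partial_deriv_compose) auto
    finally show ?thesis by (simp add: partial_deriv_sgn[OF x] sx)
  qed
  then have "sph_laplacian \<psi> x
      = (\<Sum>b\<in>Basis. \<Sum>c\<in>Basis. partial_deriv c (partial_deriv b F) x * (b \<bullet> c - (x \<bullet> b) * (x \<bullet> c)))"
    by (simp add: sph_laplacian_def sph_div_def)
  also have "\<dots> = (\<Sum>b\<in>Basis. \<Sum>c\<in>Basis. partial_deriv c (partial_deriv b F) x * (c \<bullet> b))
      - (\<Sum>b\<in>Basis. \<Sum>c\<in>Basis. partial_deriv c (partial_deriv b F) x * ((x \<bullet> b) * (x \<bullet> c)))"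
    by (simp add: right_diff_distrib sum_subtractf inner_commute)
  also have "\<dots> = laplacian F x"
    by (simp add: hessian_ray_constant[OF x0] sum_inner_Basis laplacian_def)
  finally show ?thesis .
qed

lemma sph_smooth_sph_laplacian: "sph_smooth (sph_laplacian \<psi>)"
  unfolding sph_smooth_def
proof (rule smooth_on_cong)
  show "smooth_on (- {0}) (\<lambda>y. laplacian F (sgn y))"
    by (rule smooth_on_compose[OF _ _ smooth_on_laplacian[OF _ smooth_ray_constant] smooth_on_sgn])
       (auto simp: sgn_zero_iff)
  show "laplacian F (sgn y) = sph_laplacian \<psi> (sgn y)" if "y \<in> - {0}" for y
    using that by (intro sph_laplacian_eq_laplacian[symmetric]) (simp add: norm_sgn)
qed auto

end

lemma smooth_on_compose_stereo:
  assumes "sph_smooth \<psi>" shows "smooth_on UNIV (\<lambda>x. \<psi> (stereo x))"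
proof -
  have "smooth_on UNIV (\<lambda>x. \<psi> (sgn (stereo x)))"
    by (rule smooth_on_compose[OF _ _ assms[unfolded sph_smooth_def]])
       (auto simp: smooth_on_stereo_inner simp del: sgn_stereo dest: arg_cong[of _ _ norm])
  then show ?thesis by simp
qed

text \<open>Chain rule for F composed with \<open>stereo\<close>. Conformality turns the
  second-order part into m^-2 times the Laplacian of F, without its normal part Hess F(S, S) = 0.
  The coordinate Laplacians contribute \<open>2 * l * euler f\<close>, and their zeroth-order terms
  add up to a multiple of \<open>euler F\<close>, again 0 at points of the sphere.\<close>

lemma sph_laplacian_stereo:
  fixes \<psi> :: "R5 \<Rightarrow> real"
  assumes psi: "sph_smooth \<psi>"
  shows "sph_laplacian \<psi> (stereo x) = stereo_laplacian (\<lambda>x. \<psi> (stereo x)) x"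
proof -
  define F where "F = (\<lambda>y. \<psi> (sgn y))"
  define f where "f = (\<lambda>x. \<psi> (stereo x))"
  define l where "l = inverse (stereo_inv_factor x)"
  let ?S = "\<lambda>c x. stereo x \<bullet> c"
  have fF: "f = (\<lambda>x. F (stereo x))" by (simp add: f_def F_def)
  have F: "smooth_on (- {0}) F" using psi by (simp add: sph_smooth_def F_def)
  have S0: "stereo x \<in> - {0}" for x by (metis ComplI norm_stereo norm_zero singletonD zero_neq_one)
  note S = smooth_on_stereo_inner
  have dS: "?S c differentiable at x" "partial_deriv b (?S c) differentiable at x"
    if "b \<in> Basis" for b c x
    using smooth_on_differentiable[OF S] smooth_on_differentiable[OF smooth_on_partial_deriv[OF S that]]
    by simp_all
  have dF: "F differentiable at (stereo x)" for x
    using smooth_on_differentiable[OF F S0] .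
  have dF': "partial_deriv c F differentiable at (stereo x)" if "c \<in> Basis" for c x
    using smooth_on_differentiable[OF smooth_on_partial_deriv[OF F that] S0] .
  have pf: "partial_deriv b f = (\<lambda>x. \<Sum>c\<in>Basis. partial_deriv c F (stereo x) * partial_deriv b (?S c) x)"
    if "b \<in> Basis" for b
    unfolding fF using dF dS[OF that] by (intro ext partial_deriv_compose) auto
  have dFS: "(\<lambda>x. partial_deriv c F (stereo x)) differentiable at x" if "c \<in> Basis" for c x
    using differentiable_chain_at[OF differentiable_componentwise[OF dS(1)] dF'[OF that]] SOME_Basis
    by (auto simp: o_def)
  have "partial_deriv b (partial_deriv b f) x
      = (\<Sum>c\<in>Basis. (\<Sum>d\<in>Basis. partial_deriv d (partial_deriv c F) (stereo x)
            * (partial_deriv b (?S c) x * partial_deriv b (?S d) x))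
          + partial_deriv c F (stereo x) * partial_deriv b (partial_deriv b (?S c)) x)"
    if b: "b \<in> Basis" for b
  proof -
    have "partial_deriv b (partial_deriv b f) x
        = (\<Sum>c\<in>Basis. partial_deriv b (\<lambda>x. partial_deriv c F (stereo x) * partial_deriv b (?S c) x) x)"
      unfolding pf[OF b] using dFS dS[OF b] by (intro partial_deriv_sum) auto
    also have "\<dots> = (\<Sum>c\<in>Basis. partial_deriv b (\<lambda>x. partial_deriv c F (stereo x)) x * partial_deriv b (?S c) x
        + partial_deriv c F (stereo x) * partial_deriv b (partial_deriv b (?S c)) x)"
      using dFS dS[OF b] by (intro sum.cong refl partial_deriv_mult) auto
    also have "\<dots> = (\<Sum>c\<in>Basis. (\<Sum>d\<in>Basis. partial_deriv d (partial_deriv c F) (stereo x) * partial_deriv b (?S d) x)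
           * partial_deriv b (?S c) x
        + partial_deriv c F (stereo x) * partial_deriv b (partial_deriv b (?S c)) x)"
      using dF' dS[OF b]
      by (intro sum.cong refl arg_cong2[where f = "(+)"] arg_cong2[where f = "(*)"] partial_deriv_compose) auto
    finally show ?thesis by (simp add: sum_distrib_left sum_distrib_right mult_ac)
  qed
  then have "laplacian f x
      = (\<Sum>b\<in>Basis. \<Sum>c\<in>Basis. \<Sum>d\<in>Basis. partial_deriv d (partial_deriv c F) (stereo x)
            * (partial_deriv b (?S c) x * partial_deriv b (?S d) x))
        + (\<Sum>b\<in>Basis. \<Sum>c\<in>Basis. partial_deriv c F (stereo x) * partial_deriv b (partial_deriv b (?S c)) x)"
    by (simp add: laplacian_def sum.distrib)
  also have "(\<Sum>b\<in>Basis. \<Sum>c\<in>Basis. \<Sum>d\<in>Basis. partial_deriv d (partial_deriv c F) (stereo x)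
            * (partial_deriv b (?S c) x * partial_deriv b (?S d) x))
      = (\<Sum>c\<in>Basis. \<Sum>d\<in>Basis. partial_deriv d (partial_deriv c F) (stereo x)
            * (\<Sum>b\<in>Basis. partial_deriv b (?S c) x * partial_deriv b (?S d) x))"
    by (subst sum.swap, intro sum.cong refl, subst sum.swap) (simp add: sum_distrib_left)
  also have "\<dots> = (\<Sum>c\<in>Basis. \<Sum>d\<in>Basis. l\<^sup>2 * (partial_deriv d (partial_deriv c F) (stereo x) * (d \<bullet> c))
      - l\<^sup>2 * (partial_deriv d (partial_deriv c F) (stereo x) * ((stereo x \<bullet> c) * (stereo x \<bullet> d))))"
    unfolding stereo_conformal l_def[symmetric]
    by (intro sum.cong refl) (simp add: inner_commute algebra_simps)
  also have "\<dots> = l\<^sup>2 * (laplacian F (stereo x) - 0)"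
    using S0[of x]
    by (simp add: sum_subtractf sum_distrib_left[symmetric] hessian_ray_constant[OF psi F_def] sum_inner_Basis
        laplacian_def)
  also have "laplacian F (stereo x) = sph_laplacian \<psi> (stereo x)"
    using sph_laplacian_eq_laplacian[OF psi F_def, of "stereo x"] by simp
  also have "(\<Sum>b\<in>Basis. \<Sum>c\<in>Basis. partial_deriv c F (stereo x) * partial_deriv b (partial_deriv b (?S c)) x)
      = (\<Sum>c\<in>Basis. partial_deriv c F (stereo x) * laplacian (?S c) x)"
    by (subst sum.swap) (simp add: laplacian_def sum_distrib_left)
  also have "\<dots> = 2 * l * (\<Sum>c\<in>Basis. partial_deriv c F (stereo x) * euler (?S c) x)
      - 4 * l\<^sup>2 * euler F (stereo x)"
    unfolding laplacian_stereo_inner l_def[symmetric] euler_def[of F]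
    by (simp add: right_diff_distrib sum_subtractf sum_distrib_left mult_ac)
  also have "(\<Sum>c\<in>Basis. partial_deriv c F (stereo x) * euler (?S c) x) = euler f x"
    unfolding euler_def by (simp add: pf sum_distrib_left mult_ac) (rule sum.swap)
  also have "euler F (stereo x) = 0"
    using euler_ray_constant[OF psi F_def] S0[of x] by simp
  finally have "laplacian f x = l\<^sup>2 * sph_laplacian \<psi> (stereo x) + 2 * l * euler f x"
    by simp
  moreover have "stereo_inv_factor x * l = 1"
    using stereo_inv_factor_pos[of x] by (simp add: l_def)
  ultimately show ?thesis
    unfolding stereo_laplacian_def f_def[symmetric] by algebra
qed

lemma paneitz_stereo:
  fixes \<psi> :: "R5 \<Rightarrow> real"
  assumes psi: "sph_smooth \<psi>"
  shows "paneitz \<psi> (stereo x) = stereo_inv_factor x ^ 4 * laplacian (laplacian (\<lambda>x. \<psi> (stereo x))) x"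
proof -
  define f where "f = (\<lambda>x. \<psi> (stereo x))"
  define h where "h = (\<lambda>\<eta>. (- 1) * sph_laplacian \<psi> \<eta> + 2 * \<psi> \<eta>)"
  have f: "smooth_on UNIV f"
    unfolding f_def by (rule smooth_on_compose_stereo[OF psi])
  have chi: "sph_smooth h"
    using sph_smooth_sph_laplacian[OF psi refl] psi unfolding h_def sph_smooth_def
    by (intro smooth_on_add smooth_on_mult smooth_on_const) auto
  have "paneitz \<psi> (stereo x) = - stereo_laplacian (\<lambda>x. h (stereo x)) x"
    unfolding sph_laplacian_stereo[OF chi, symmetric] by (simp add: paneitz_def h_def)
  also have "(\<lambda>x. h (stereo x)) = (\<lambda>x. (- 1) * stereo_laplacian f x + 2 * f x)"
    by (simp add: h_def sph_laplacian_stereo[OF psi] f_def)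
  also have "stereo_laplacian \<dots> x = (- 1) * stereo_laplacian (stereo_laplacian f) x + 2 * stereo_laplacian f x"
    using f smooth_on_stereo_laplacian[OF f]
    by (subst stereo_laplacian_add, (intro smooth_on_mult smooth_on_const; simp)+)
       (simp only: stereo_laplacian_cmult)
  finally show ?thesis
    using stereo_laplacian_twice[OF f, of x] by (simp add: f_def)
qed

subsection \<open>Lebesgue measure: change of variables, cones, isometries\<close>

lemma det_4:
  "det (A::'a::comm_ring_1^4^4) =
    A$1$1 * (A$2$2 * (A$3$3 * A$4$4 - A$3$4 * A$4$3) - A$2$3 * (A$3$2 * A$4$4 - A$3$4 * A$4$2)
      + A$2$4 * (A$3$2 * A$4$3 - A$3$3 * A$4$2))
  - A$1$2 * (A$2$1 * (A$3$3 * A$4$4 - A$3$4 * A$4$3) - A$2$3 * (A$3$1 * A$4$4 - A$3$4 * A$4$1)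
      + A$2$4 * (A$3$1 * A$4$3 - A$3$3 * A$4$1))
  + A$1$3 * (A$2$1 * (A$3$2 * A$4$4 - A$3$4 * A$4$2) - A$2$2 * (A$3$1 * A$4$4 - A$3$4 * A$4$1)
      + A$2$4 * (A$3$1 * A$4$2 - A$3$2 * A$4$1))
  - A$1$4 * (A$2$1 * (A$3$2 * A$4$3 - A$3$3 * A$4$2) - A$2$2 * (A$3$1 * A$4$3 - A$3$3 * A$4$1)
      + A$2$3 * (A$3$1 * A$4$2 - A$3$2 * A$4$1))"
proof -
  have f1: "finite {2::4, 3, 4}" "1 \<notin> {2::4, 3, 4}"
    by auto
  have f2: "finite {3::4, 4}" "2 \<notin> {3::4, 4}"
    by auto
  have f3: "finite {4::4}" "3 \<notin> {4::4}"
    by auto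
  show ?thesis
    unfolding det_def UNIV_4
    unfolding sum_over_permutations_insert[OF f1]
    unfolding sum_over_permutations_insert[OF f2]
    unfolding sum_over_permutations_insert[OF f3]
    unfolding permutes_sing
    by (simp add: sign_swap_id permutation_swap_id permutation_compose sign_compose sign_id swap_id_eq algebra_simps)
qed

text \<open>The matrix determinant lemma for a I + y x^T. Maps of the form x times a function of its
  norm have differentials of this shape.\<close>

lemma det_rank_one_4:
  fixes x y :: "real ^ 4"
  shows "det (matrix (\<lambda>v. a *\<^sub>R v + (x \<bullet> v) *\<^sub>R y)) = a ^ 3 * (a + x \<bullet> y)"
proof -
  have "matrix (\<lambda>v. a *\<^sub>R v + (x \<bullet> v) *\<^sub>R y) $ i $ j = (if i = j then a else 0) + x $ j * y $ i" for i j
    by (simp add: matrix_def inner_axis) (simp add: axis_def)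
  then show ?thesis
    by (simp add: det_4 inner_vec_def sum_4) (simp add: algebra_simps power3_eq_cube)
qed

text \<open>The push-forward under \<open>g\<close> of the density \<open>d\<close> on
  \<open>S\<close> gives every box its volume, so it is \<open>lborel\<close>; integrals then follow
  from uniqueness of the measure. Covering the target only up to a null set is what hemisphere
  charts provide.\<close>

lemma nn_integral_change_of_variables:
  fixes g :: "real ^ 'n::{finite,wellorder} \<Rightarrow> real ^ 'n::_" and h :: "real ^ 'n::_ \<Rightarrow> ennreal"
  assumes S [measurable]: "S \<in> sets borel" and g [measurable]: "g \<in> borel_measurable borel"
    and d [measurable]: "d \<in> borel_measurable borel" and h [measurable]: "h \<in> borel_measurable borel"
    and der: "\<And>x. x \<in> S \<Longrightarrow> (g has_derivative g' x) (at x)"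
    and det: "\<And>x. x \<in> S \<Longrightarrow> \<bar>det (matrix (g' x))\<bar> = d x"
    and inj: "inj_on g S" and onto: "negligible (- g ` S)"
  shows "(\<integral>\<^sup>+ x. h x \<partial>lborel) = (\<integral>\<^sup>+ x. h (g x) * (ennreal (d x) * indicator S x) \<partial>lborel)"
proof -
  let ?M = "density lborel (\<lambda>x. ennreal (d x) * indicator S x)"
  have "lborel = distr ?M borel g"
  proof (rule lborel_eqI)
    fix l u :: "real ^ 'n::_"
    assume le: "\<And>b. b \<in> Basis \<Longrightarrow> l \<bullet> b \<le> u \<bullet> b"
    have [measurable]: "g -` box l u \<in> sets borel"
      using measurable_sets[OF g, of "box l u"] by simp
    define T where "T = S \<inter> g -` box l u"
    have T [measurable]: "T \<in> sets borel"
      unfolding T_def by measurable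
    \<comment> \<open>The image is the box less the null set that \<open>g\<close> misses, so it has
      the volume of the box and the area formula applies with that value.\<close>
    have img: "g ` T = box l u - (- g ` S)" by (auto simp: T_def)
    have "box l u - N \<in> lmeasurable" "measure lebesgue (box l u - N) = measure lebesgue (box l u)"
      if "negligible N" for N :: "(real ^ 'n::_) set"
      using that negligible_imp_measurable[OF that]
      by (auto simp: fmeasurable.Diff measure_Diff_null_set negligible_iff_null_sets)
    from this[OF onto] have meas:
      "g ` T \<in> lmeasurable" "measure lebesgue (g ` T) = measure lebesgue (box l u)"
      unfolding img .
    have "((\<lambda>x. \<bar>det (matrix (g' x))\<bar>) has_integral measure lebesgue (box l u)) T"
      using has_measure_differentiable_image[of T g g' "measure lebesgue (box l u)"] meas inj
      by (auto simp: T_def intro: inj_on_subset has_derivative_at_withinI[OF der])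
    then have "(d has_integral measure lebesgue (box l u)) T"
      by (rule has_integral_eq[rotated]) (auto simp: det T_def)
    then have "(\<integral>\<^sup>+ x. ennreal (d x) * indicator T x \<partial>lborel) = ennreal (measure lebesgue (box l u))"
      using det by (intro nn_integral_has_integral_lebesgue') (force simp: T_def)+
    moreover have "emeasure (distr ?M borel g) (box l u) = (\<integral>\<^sup>+ x. ennreal (d x) * indicator T x \<partial>lborel)"
      by (subst emeasure_distr, simp, simp, subst emeasure_density)
         (auto simp: T_def indicator_def intro!: nn_integral_cong)
    ultimately show "emeasure (distr ?M borel g) (box l u) = (\<Prod>b\<in>Basis. (u - l) \<bullet> b)"
      using le by (simp add: measure_lborel_box_eq)
  qed simp
  then have "(\<integral>\<^sup>+ x. h x \<partial>lborel) = (\<integral>\<^sup>+ x. h x \<partial>distr ?M borel g)"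
    by simp
  also have "\<dots> = (\<integral>\<^sup>+ x. h (g x) * (ennreal (d x) * indicator S x) \<partial>lborel)"
    by (subst nn_integral_distr, simp, simp, subst nn_integral_density) (auto simp: mult_ac)
  finally show ?thesis .
qed

text \<open>The inner integral of the cone formula: t is the height of a slice,
  \<open>\<bar>t\<bar> ^ n\<close> the volume factor from rescaling it, and \<open>c\<close>,
  \<open>d\<close> are the values along the upper and the lower ray.\<close>

lemma nn_integral_symmetric_power:
  fixes c d :: ennreal
  assumes s: "0 \<le> s"
  shows "(\<integral>\<^sup>+ t. (ennreal (\<bar>t\<bar> ^ n) * (if 0 < t then c else d)) * indicator {-s..s} t \<partial>lborel)
    = (c + d) * ennreal (s ^ Suc n / Suc n)"
proof -
  have pos: "(\<integral>\<^sup>+ t. ennreal (\<bar>t\<bar> ^ n) * indicator {0..s} t \<partial>lborel) = ennreal (s ^ Suc n / Suc n)"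
  proof -
    have "(\<integral>\<^sup>+ t. ennreal (t ^ n) * indicator {0..s} t \<partial>lborel) = s ^ Suc n / Suc n - 0 ^ Suc n / Suc n"
      by (rule nn_integral_FTC_Icc) (use s in \<open>auto intro!: derivative_eq_intros simp del: power_Suc\<close>)
    moreover have "(\<integral>\<^sup>+ t. ennreal (\<bar>t\<bar> ^ n) * indicator {0..s} t \<partial>lborel)
        = (\<integral>\<^sup>+ t. ennreal (t ^ n) * indicator {0..s} t \<partial>lborel)"
      by (intro nn_integral_cong) (auto simp: indicator_def)
    ultimately show ?thesis by simp
  qed
  have neg: "(\<integral>\<^sup>+ t. ennreal (\<bar>t\<bar> ^ n) * indicator {-s..0} t \<partial>lborel) = ennreal (s ^ Suc n / Suc n)"
    unfolding pos[symmetric]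
    by (subst nn_integral_real_affine[where c = "-1" and t = 0])
       (auto intro!: nn_integral_cong simp: indicator_def)
  have "(\<integral>\<^sup>+ t. (ennreal (\<bar>t\<bar> ^ n) * (if 0 < t then c else d)) * indicator {-s..s} t \<partial>lborel)
      = (\<integral>\<^sup>+ t. c * (ennreal (\<bar>t\<bar> ^ n) * indicator {0..s} t)
           + d * (ennreal (\<bar>t\<bar> ^ n) * indicator {-s..0} t) \<partial>lborel)"
    using AE_lborel_singleton[of "0::real"] s
    by (intro nn_integral_cong_AE) (auto elim!: eventually_mono simp: indicator_def mult_ac)
  also have "\<dots> = (c + d) * ennreal (s ^ Suc n / Suc n)"
    by (subst nn_integral_add) (auto simp: nn_integral_cmult pos neg distrib_right simp del: power_Suc)
  finally show ?thesis .
qed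

text \<open>Rescaling the slice at height t by |t| replaces (u, t) by the direction (w, 1) or (w,
  -1) with w = u / |t|, on which alone \<open>f (sgn z)\<close> depends. The ball then becomes the
  condition that |t| is at most 1 / sqrt(1 + |w|^2), and the height can be integrated out.\<close>

lemma nn_integral_cone:
  fixes f :: "'a::euclidean_space \<times> real \<Rightarrow> ennreal"
  assumes f [measurable]: "f \<in> borel_measurable borel"
  shows "(\<integral>\<^sup>+ z. f (sgn z) * indicator (cball 0 1 - {0}) z \<partial>lborel)
    = (\<integral>\<^sup>+ w. (f (sgn (w, 1)) + f (sgn (w, - 1)))
          * ennreal ((1 / sqrt (1 + (norm w)\<^sup>2)) ^ Suc DIM('a) / Suc DIM('a)) \<partial>lborel)"
proof -
  let ?n = "DIM('a)"
  have [measurable]: "(sgn :: 'a \<times> real \<Rightarrow> _) \<in> borel_measurable borel"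
    unfolding sgn_div_norm[abs_def] by measurable
  have [measurable]: "f \<in> borel_measurable (borel \<Otimes>\<^sub>M borel)"
    using f by (simp add: borel_prod)
  have [measurable]: "cball 0 1 - {0} \<in> sets (borel :: ('a \<times> real) measure)"
    by (intro sets.Diff borel_closed) auto
  have [measurable]: "(sgn :: 'a \<times> real \<Rightarrow> _) \<in> (borel \<Otimes>\<^sub>M borel) \<rightarrow>\<^sub>M borel"
    by (simp add: borel_prod)
  let ?G = "\<lambda>z. f (sgn z) * indicator (cball 0 1 - {0}) z"
  let ?H = "\<lambda>w t. (ennreal (\<bar>t\<bar> ^ ?n) * (if 0 < t then f (sgn (w, 1)) else f (sgn (w, - 1))))
    * indicator {- (1 / sqrt (1 + (norm w)\<^sup>2)) .. 1 / sqrt (1 + (norm w)\<^sup>2)} t"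
  have H_meas: "(\<lambda>(w, t). ?H w t) \<in> borel_measurable (lborel \<Otimes>\<^sub>M lborel)"
  proof -
    have [measurable]: "(\<lambda>(w::'a, t::real). indicator {- (1 / sqrt (1 + (norm w)\<^sup>2)) .. 1 / sqrt (1 + (norm w)\<^sup>2)} t :: ennreal)
      \<in> borel_measurable (borel \<Otimes>\<^sub>M borel)"
      unfolding indicator_def atLeastAtMost_iff by measurable
    show ?thesis by measurable
  qed
  have "(\<integral>\<^sup>+ z. ?G z \<partial>lborel) = (\<integral>\<^sup>+ z. ?G z \<partial>(lborel \<Otimes>\<^sub>M lborel))"
    by (simp add: lborel_prod)
  also have "\<dots> = (\<integral>\<^sup>+ t. \<integral>\<^sup>+ u. ?G (u, t) \<partial>lborel \<partial>lborel)"
    by (rule lborel_pair.nn_integral_snd[symmetric]) (unfold lborel_prod, measurable)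
  also have "\<dots> = (\<integral>\<^sup>+ t. \<integral>\<^sup>+ w. ?H w t \<partial>lborel \<partial>lborel)"
  \<comment> \<open>The slice at height 0 cannot be rescaled; it is a single height and hence
    negligible.\<close>
  proof (rule nn_integral_cong_AE, rule eventually_mono[OF AE_lborel_singleton[of "0::real"]])
    fix t :: real assume t: "t \<noteq> 0"
    have "(\<integral>\<^sup>+ u. ?G (u, t) \<partial>lborel)
        = (\<integral>\<^sup>+ u. ?G (u, t) \<partial>density (distr lborel borel (\<lambda>x::'a. 0 + \<bar>t\<bar> *\<^sub>R x)) (\<lambda>_. ennreal (\<bar>\<bar>t\<bar>\<bar> ^ ?n)))"
      using t by (subst lborel_affine[of "\<bar>t\<bar>" 0]) auto
    also have "\<dots> = (\<integral>\<^sup>+ w. ennreal (\<bar>t\<bar> ^ ?n) * ?G (\<bar>t\<bar> *\<^sub>R w, t) \<partial>lborel)"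
      by (subst nn_integral_density, simp, simp, subst nn_integral_distr) auto
    also have "\<dots> = (\<integral>\<^sup>+ w. ?H w t \<partial>lborel)"
    proof (rule nn_integral_cong)
      fix w :: 'a
      have pair: "(\<bar>t\<bar> *\<^sub>R w, t) = \<bar>t\<bar> *\<^sub>R (w, if 0 < t then 1 else - 1)" by auto
      have sg: "sgn (\<bar>t\<bar> *\<^sub>R w, t) = (if 0 < t then sgn (w, 1) else sgn (w, - 1))"
        unfolding pair sgn_scaleR using t by auto
      have nrm: "norm (\<bar>t\<bar> *\<^sub>R w, t) = \<bar>t\<bar> * sqrt (1 + (norm w)\<^sup>2)"
        unfolding pair norm_scaleR by (simp add: norm_Pair add.commute)
      have "(\<bar>t\<bar> *\<^sub>R w, t) \<in> cball 0 1 - {0} \<longleftrightarrow> \<bar>t\<bar> \<le> 1 / sqrt (1 + (norm w)\<^sup>2)"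
        unfolding Diff_iff mem_cball dist_0_norm nrm singleton_iff
        using t by (simp add: zero_prod_def pos_le_divide_eq add_pos_nonneg)
      then have ind: "indicator (cball 0 1 - {0}) (\<bar>t\<bar> *\<^sub>R w, t)
          = (indicator {- (1 / sqrt (1 + (norm w)\<^sup>2)) .. 1 / sqrt (1 + (norm w)\<^sup>2)} t :: ennreal)"
        by (auto simp: indicator_def abs_le_iff)
      show "ennreal (\<bar>t\<bar> ^ ?n) * ?G (\<bar>t\<bar> *\<^sub>R w, t) = ?H w t"
        unfolding sg ind by (simp add: mult_ac)
    qed
    finally show "(\<integral>\<^sup>+ u. ?G (u, t) \<partial>lborel) = (\<integral>\<^sup>+ w. ?H w t \<partial>lborel)" .
  qed
  also have "\<dots> = (\<integral>\<^sup>+ w. \<integral>\<^sup>+ t. ?H w t \<partial>lborel \<partial>lborel)"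
    by (rule lborel_pair.Fubini') (use H_meas in simp)
  also have "\<dots> = (\<integral>\<^sup>+ w. (f (sgn (w, 1)) + f (sgn (w, - 1)))
          * ennreal ((1 / sqrt (1 + (norm w)\<^sup>2)) ^ Suc ?n / Suc ?n) \<partial>lborel)"
    by (intro nn_integral_cong nn_integral_symmetric_power) simp
  finally show ?thesis .
qed

text \<open>Library results on orthogonal maps are stated for \<open>real ^ 'n\<close>; they are transported along a
  bijection of orthonormal bases.\<close>

lemma basis_isometry:
  assumes "CARD('n::finite) = DIM('a::euclidean_space)"
  obtains j :: "real ^ 'n::finite \<Rightarrow> 'a::euclidean_space" and k where "linear j" "linear k" "\<And>v. k (j v) = v" "\<And>a. j (k a) = a"
    "\<And>v. norm (j v) = norm v" "distr lborel borel j = lborel"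
proof -
  obtain \<beta> :: "'n \<Rightarrow> 'a" where \<beta>: "bij_betw \<beta> UNIV Basis"
    using assms finite_same_card_bij[of "UNIV::'n set" "Basis::'a set"] by auto
  have B: "\<beta> i \<in> Basis" for i using \<beta> by (auto simp: bij_betw_def)
  have inj: "\<beta> i = \<beta> i' \<longleftrightarrow> i = i'" for i i' using \<beta> by (auto simp: bij_betw_def inj_def)
  define j where "j v = (\<Sum>i\<in>UNIV. (v $ i) *\<^sub>R \<beta> i)" for v :: "real ^ 'n"
  define k where "k a = (\<chi> i. a \<bullet> \<beta> i)" for a
  have jb: "j v \<bullet> \<beta> i = v $ i" for v i
    by (simp add: j_def inner_sum_left inner_Basis B inj if_distrib[of "\<lambda>t. _ * t"] cong: if_cong)
  have kj: "k (j v) = v" for v by (simp add: k_def jb)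
  have jk: "j (k a) = a" for a
    unfolding j_def k_def
    using sum.reindex_bij_betw[OF \<beta>, of "\<lambda>b. (a \<bullet> b) *\<^sub>R b"] by (simp add: euclidean_representation)
  have lin: "linear j" "linear k"
    by (auto intro!: linearI simp: j_def k_def vec_eq_iff inner_add_left algebra_simps sum.distrib scaleR_sum_right)
  have nrm: "norm (j v) = norm v" for v
  proof -
    have "j v \<bullet> j v = v \<bullet> v"
      by (subst j_def) (simp add: inner_sum_right jb inner_vec_def)
    then show ?thesis by (simp add: norm_eq_sqrt_inner)
  qed
  have [measurable]: "j \<in> borel_measurable borel"
    using linear_continuous_on[of j UNIV] lin
    by (intro borel_measurable_continuous_onI) (simp add: linear_conv_bounded_linear)
  have "lborel = distr lborel borel j"
  proof (rule lborel_eqI)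
    fix l u :: 'a
    assume le: "\<And>b. b \<in> Basis \<Longrightarrow> l \<bullet> b \<le> u \<bullet> b"
    have "Basis = range \<beta>" using \<beta> by (simp add: bij_betw_def)
    have "j v \<in> box l u \<longleftrightarrow> v \<in> box (k l) (k u)" for v
      unfolding mem_box_cart unfolding mem_box \<open>Basis = range \<beta>\<close> by (simp add: jb k_def)
    then have box: "j -` box l u = box (k l) (k u)" by auto
    have "emeasure (distr lborel borel j) (box l u) = emeasure lborel (box (k l) (k u))"
      by (subst emeasure_distr) (simp_all add: box)
    also have "\<dots> = ennreal (\<Prod>b\<in>Basis. (k u - k l) \<bullet> b)"
      using le B by (subst emeasure_lborel_box) (auto simp: k_def Basis_vec_def inner_axis)
    also have "(\<Prod>b\<in>Basis. (k u - k l) \<bullet> b) = (\<Prod>i\<in>UNIV. (k u - k l) $ i)"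
      by (subst prod.reindex_bij_betw[of "\<lambda>i::'n. axis i 1" UNIV Basis, symmetric])
         (auto simp: bij_betw_def inj_def axis_eq_axis Basis_vec_def inner_axis)
    also have "\<dots> = (\<Prod>b\<in>Basis. (u - l) \<bullet> b)"
      by (subst prod.reindex_bij_betw[OF \<beta>, symmetric]) (simp add: k_def inner_diff_left)
    finally show "emeasure (distr lborel borel j) (box l u) = ennreal (\<Prod>b\<in>Basis. (u - l) \<bullet> b)" .
  qed simp
  with that lin kj jk nrm show thesis by metis
qed

lemma distr_lborel_orthogonal:
  fixes f :: "real ^ 'n::{finite,wellorder} \<Rightarrow> real ^ 'n::_"
  assumes f: "orthogonal_transformation f"
  shows "distr lborel borel f = lborel"
proof (rule lborel_eqI[symmetric])
  fix l u :: "real ^ 'n::_"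
  assume le: "\<And>b. b \<in> Basis \<Longrightarrow> l \<bullet> b \<le> u \<bullet> b"
  have lin: "linear f" using f by (rule orthogonal_transformation_linear)
  have [measurable]: "f \<in> borel_measurable borel"
    using linear_continuous_on[of f UNIV] lin
    by (intro borel_measurable_continuous_onI) (simp add: linear_conv_bounded_linear)
  have "emeasure (distr lborel borel f) (box l u) = emeasure lborel (f -` box l u)"
    by (subst emeasure_distr) simp_all
  also have "f -` box l u = inv f ` box l u"
    using f by (intro bij_vimage_eq_inv_image orthogonal_transformation_bij)
  also have "emeasure lborel (inv f ` box l u) = emeasure lebesgue (inv f ` box l u)"
  proof -
    have "f -` box l u \<in> sets borel" using measurable_sets[of f borel borel "box l u"] by simp
    then show ?thesis
      using f by (simp add: bij_vimage_eq_inv_image orthogonal_transformation_bij)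
  qed
  also have "\<dots> = emeasure lebesgue (box l u)"
    using measure_orthogonal_image[OF orthogonal_transformation_inv[OF f], of "box l u"]
      measurable_orthogonal_image[OF orthogonal_transformation_inv[OF f], of "box l u"]
    by (simp add: emeasure_eq_measure2 fmeasurableD2)
  also have "\<dots> = ennreal (\<Prod>b\<in>Basis. (u - l) \<bullet> b)"
    using le by simp
  finally show "emeasure (distr lborel borel f) (box l u) = ennreal (\<Prod>b\<in>Basis. (u - l) \<bullet> b)" .
qed simp

text \<open>A linear isometry that preserves \<open>lborel\<close> maps the unit ball to itself and
  commutes with \<open>sgn\<close>, so the cone formula makes it preserve surface integrals.\<close>

lemma isometry_between_unit_vectors:
  fixes p q :: "'a::euclidean_space"
  assumes dim: "CARD('n::{finite,wellorder}) = DIM('a)" and pq: "norm p = norm q"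
  obtains T :: "'a \<Rightarrow> 'a" where "linear T" "\<And>a. norm (T a) = norm a" "T p = q" "distr lborel borel T = lborel"
proof -
  obtain j :: "real ^ 'n::_ \<Rightarrow> 'a" and k where jk: "linear j" "linear k" "\<And>v. k (j v) = v" "\<And>a. j (k a) = a"
    "\<And>v. norm (j v) = norm v" "distr lborel borel j = lborel"
    using basis_isometry[OF dim] by blast
  have nk: "norm (k a) = norm a" for a using jk(4,5) by metis
  obtain f where f: "orthogonal_transformation f" "f (k p) = k q"
    using orthogonal_transformation_exists[of "k p" "k q"] pq by (auto simp: nk)
  have [measurable]: "j \<in> borel_measurable borel" "k \<in> borel_measurable borel" "f \<in> borel_measurable borel"
    using linear_continuous_on[of j UNIV] linear_continuous_on[of k UNIV] linear_continuous_on[of f UNIV]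
      jk(1,2) orthogonal_transformation_linear[OF f(1)]
    by (auto intro!: borel_measurable_continuous_onI simp: linear_conv_bounded_linear)
  define T where "T = j \<circ> f \<circ> k"
  have "distr lborel borel T = distr (distr lborel borel j) borel T"
    by (simp add: jk(6))
  also have "\<dots> = distr lborel borel (T \<circ> j)"
    by (subst distr_distr) (simp_all add: T_def)
  also have "T \<circ> j = j \<circ> f" by (simp add: T_def fun_eq_iff jk(3))
  also have "distr lborel borel (j \<circ> f) = distr (distr lborel borel f) borel j"
    by (subst distr_distr) simp_all
  also have "\<dots> = lborel" by (simp add: distr_lborel_orthogonal[OF f(1)] jk(6))
  finally have "distr lborel borel T = lborel" .
  moreover have "linear T"
    unfolding T_def by (intro linear_compose jk orthogonal_transformation_linear f)
  moreover have "norm (T a) = norm a" for a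
    by (simp add: T_def jk(5) orthogonal_transformation_norm[OF f(1)] nk)
  moreover have "T p = q" by (simp add: T_def f(2) jk(4))
  ultimately show thesis using that by blast
qed

text \<open>Layer-cake integration: write the radial function as the integral of minus its
  derivative over the heights t above |y|^2, exchange the integrals, and insert the volume (pi^2 /
  2) t^2 of the ball of radius sqrt t. In dimension 4 convergence means q > 2.\<close>

lemma nn_integral_power_decay_R4:
  fixes q :: real
  assumes q: "2 < q"
  shows "(\<integral>\<^sup>+ y. ennreal ((1 + (norm (y::R4))\<^sup>2) powr (- q)) \<partial>lborel) = ennreal (pi\<^sup>2 / ((q - 1) * (q - 2)))"
proof -
  let ?k = "\<lambda>t::real. q * (1 + t) powr (- q - 1)"
  have layer: "ennreal ((1 + s) powr (- q)) = (\<integral>\<^sup>+ t. ennreal (?k t) * indicator {s..} t \<partial>lborel)"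
    if s: "0 \<le> s" for s
  proof -
    have "(\<integral>\<^sup>+ t. ennreal (?k t) * indicator {s..} t \<partial>lborel) = ennreal (0 - (- ((1 + s) powr (- q))))"
    proof (rule nn_integral_FTC_atLeast)
      show "((\<lambda>t. - ((1 + t) powr (- q))) has_real_derivative ?k t) (at t)" if "s \<le> t" for t
        using that s by (auto intro!: derivative_eq_intros)
      show "((\<lambda>t. - ((1 + t) powr (- q))) \<longlongrightarrow> 0) at_top"
        using q by real_asymp
    qed (use q in auto)
    then show ?thesis by simp
  qed
  have vol: "emeasure lborel {y::real^4. (norm y)\<^sup>2 \<le> t} = ennreal (pi\<^sup>2 / 2 * t\<^sup>2) * indicator {0..} t" for t
  proof (cases "0 \<le> t")
    case True
    then have "{y::real^4. (norm y)\<^sup>2 \<le> t} = cball 0 (sqrt t)"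
      by (auto simp: real_le_rsqrt real_sqrt_le_iff power2_le_iff_abs_le real_le_lsqrt sqrt_le_D)
         (metis norm_ge_zero power_mono real_sqrt_pow2)
    moreover have "unit_ball_vol (real 4) = pi\<^sup>2 / 2"
      using unit_ball_vol_even[of 2] by (simp add: fact_numeral)
    moreover have "sqrt t ^ 4 = t\<^sup>2"
      using True power_mult[of "sqrt t" 2 2] by simp
    ultimately show ?thesis
      using True emeasure_cball[of "sqrt t" "0::real^4"] by simp
  next
    case False
    then have "{y::real^4. (norm y)\<^sup>2 \<le> t} = {}"
      by (auto simp: not_le) (meson le_less_trans not_less zero_le_power2)
    with False show ?thesis by simp
  qed
  have "(\<integral>\<^sup>+ y. ennreal ((1 + (norm (y::R4))\<^sup>2) powr (- q)) \<partial>lborel)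
      = (\<integral>\<^sup>+ y. \<integral>\<^sup>+ t. ennreal (?k t) * indicator {(norm (y::R4))\<^sup>2..} t \<partial>lborel \<partial>lborel)"
    by (simp add: layer)
  also have "\<dots> = (\<integral>\<^sup>+ t. \<integral>\<^sup>+ y. ennreal (?k t) * indicator {(norm (y::R4))\<^sup>2..} t \<partial>lborel \<partial>lborel)"
  proof (rule lborel_pair.Fubini'[symmetric])
    show "(\<lambda>(y::real^4, t). ennreal (?k t) * indicator {(norm y)\<^sup>2..} t) \<in> borel_measurable (lborel \<Otimes>\<^sub>M lborel)"
      unfolding indicator_def atLeast_iff by measurable
  qed
  also have "\<dots> = (\<integral>\<^sup>+ t. ennreal (?k t) * emeasure lborel {y::real^4. (norm y)\<^sup>2 \<le> t} \<partial>lborel)"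
  proof (rule nn_integral_cong)
    fix t
    have "(\<integral>\<^sup>+ y. ennreal (?k t) * indicator {(norm (y::R4))\<^sup>2..} t \<partial>lborel)
        = (\<integral>\<^sup>+ y. ennreal (?k t) * indicator {y::real^4. (norm y)\<^sup>2 \<le> t} y \<partial>lborel)"
      by (intro nn_integral_cong) (auto simp: indicator_def)
    also have "\<dots> = ennreal (?k t) * emeasure lborel {y::real^4. (norm y)\<^sup>2 \<le> t}"
      by (subst nn_integral_cmult_indicator) auto
    finally show "(\<integral>\<^sup>+ y. ennreal (?k t) * indicator {(norm (y::R4))\<^sup>2..} t \<partial>lborel)
        = ennreal (?k t) * emeasure lborel {y::real^4. (norm y)\<^sup>2 \<le> t}" .
  qed
  also have "\<dots> = (\<integral>\<^sup>+ t. ennreal (?k t * (pi\<^sup>2 / 2 * t\<^sup>2)) * indicator {0..} t \<partial>lborel)"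
    unfolding vol using q by (intro nn_integral_cong) (auto simp: indicator_def ennreal_mult[symmetric])
  also have "\<dots> = ennreal (0 - q * pi\<^sup>2 / 2 * ((1 + 0) powr (2 - q) / (2 - q) - 2 * (1 + 0) powr (1 - q) / (1 - q)
      - (1 + 0) powr (- q) / q))"
  proof (rule nn_integral_FTC_atLeast)
    show "((\<lambda>t. q * pi\<^sup>2 / 2 * ((1 + t) powr (2 - q) / (2 - q) - 2 * (1 + t) powr (1 - q) / (1 - q)
        - (1 + t) powr (- q) / q)) has_real_derivative ?k t * (pi\<^sup>2 / 2 * t\<^sup>2)) (at t)" if "0 \<le> t" for t
    proof -
      \<comment> \<open>The antiderivative comes from t^2 = (1 + t)^2 - 2 (1 + t) + 1, which makes
        the integrand a sum of three powers of 1 + t.\<close>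
      have e: "(1 + t) powr (1 - q) = (1 + t)\<^sup>2 * (1 + t) powr (- q - 1)"
        "(1 + t) powr (- q) = (1 + t) * (1 + t) powr (- q - 1)"
        using that powr_add[of "1 + t" 2 "- q - 1"] powr_add[of "1 + t" 1 "- q - 1"] by simp_all
      have D: "((\<lambda>t. (1 + t) powr r) has_real_derivative r * (1 + t) powr (r - 1)) (at t)" for r
        using that by (auto intro!: derivative_eq_intros)
      have "((\<lambda>t. q * pi\<^sup>2 / 2 * ((1 + t) powr (2 - q) / (2 - q) - 2 * (1 + t) powr (1 - q) / (1 - q)
        - (1 + t) powr (- q) / q)) has_real_derivative
          q * pi\<^sup>2 / 2 * ((1 + t) powr (1 - q) - 2 * (1 + t) powr (- q) + (1 + t) powr (- q - 1))) (at t)"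
        using q by (intro DERIV_cong[OF DERIV_cmult[OF DERIV_diff[OF DERIV_diff[OF
            DERIV_cdivide[OF D] DERIV_cdivide[OF DERIV_cmult[OF D]]] DERIV_cdivide[OF D]]]])
          simp
      also have "q * pi\<^sup>2 / 2 * ((1 + t) powr (1 - q) - 2 * (1 + t) powr (- q) + (1 + t) powr (- q - 1))
          = ?k t * (pi\<^sup>2 / 2 * t\<^sup>2)"
        unfolding e by (simp add: power2_eq_square algebra_simps)
      finally show ?thesis .
    qed
    show "((\<lambda>t. q * pi\<^sup>2 / 2 * ((1 + t) powr (2 - q) / (2 - q) - 2 * (1 + t) powr (1 - q) / (1 - q)
        - (1 + t) powr (- q) / q)) \<longlongrightarrow> 0) at_top"
      using q by real_asymp
  qed (use q in auto)
  also have "0 - q * pi\<^sup>2 / 2 * ((1 + 0) powr (2 - q) / (2 - q) - 2 * (1 + 0) powr (1 - q) / (1 - q)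
      - (1 + 0) powr (- q) / q) = pi\<^sup>2 / ((q - 1) * (q - 2))"
    using q by (simp add: divide_simps) (simp add: algebra_simps)
  finally show ?thesis .
qed

subsection \<open>The surface measure in stereographic coordinates\<close>

text \<open>This is m^-4, the fourth power of the conformal factor 1 / m.\<close>

definition stereo_jac :: "R4 \<Rightarrow> real" where
  "stereo_jac x = 16 / (1 + (norm x)\<^sup>2) ^ 4"

lemma one_plus_norm_square_pos: "0 < 1 + (norm x)\<^sup>2"
  by (simp add: add_pos_nonneg)

lemma stereo_jac_pos: "0 < stereo_jac x"
  using one_plus_norm_square_pos[of x] by (simp add: stereo_jac_def)

lemma stereo_jac_measurable [measurable]: "stereo_jac \<in> borel_measurable borel"
  unfolding stereo_jac_def[abs_def] by measurable

lemma stereo_measurable [measurable]: "stereo \<in> borel_measurable borel"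
  unfolding stereo_def[abs_def] borel_prod[symmetric] by measurable

text \<open>The sign \<open>s\<close> selects a hemisphere. Central projection of \<open>stereo x\<close> to the tangent
  hyperplane at the corresponding pole is \<open>x \<mapsto> 2 s x / (1 - |x|\<^sup>2)\<close>.\<close>

lemma nn_integral_gnomonic:
  fixes h :: "R4 \<Rightarrow> ennreal" and s :: real
  assumes h [measurable]: "h \<in> borel_measurable borel" and s: "s = 1 \<or> s = - 1"
  shows "(\<integral>\<^sup>+ w. h w \<partial>lborel) = (\<integral>\<^sup>+ x. h ((2 * s / (1 - x \<bullet> x)) *\<^sub>R x)
    * (ennreal (16 * (1 + x \<bullet> x) / \<bar>1 - x \<bullet> x\<bar> ^ 5) * indicator {x. 0 < s * (1 - x \<bullet> x)} x) \<partial>lborel)"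
proof (rule nn_integral_change_of_variables[where
    g' = "\<lambda>x v. (2 * s / (1 - x \<bullet> x)) *\<^sub>R v + (((4 * s / (1 - x \<bullet> x)\<^sup>2) *\<^sub>R x) \<bullet> v) *\<^sub>R x"])
  let ?g = "\<lambda>x::R4. (2 * s / (1 - x \<bullet> x)) *\<^sub>R x" and ?S = "{x::R4. 0 < s * (1 - x \<bullet> x)}"
  have ss: "s * s = 1" using s by auto
  show "{x::R4. 0 < s * (1 - x \<bullet> x)} \<in> sets borel" by measurable
  show "?g \<in> borel_measurable borel" by measurable
  show "(\<lambda>x::R4. 16 * (1 + x \<bullet> x) / \<bar>1 - x \<bullet> x\<bar> ^ 5) \<in> borel_measurable borel" by measurable
  have nz: "1 - x \<bullet> x \<noteq> 0" if "x \<in> ?S" for x using that by auto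
  show "(?g has_derivative (\<lambda>v. (2 * s / (1 - x \<bullet> x)) *\<^sub>R v
      + (((4 * s / (1 - x \<bullet> x)\<^sup>2) *\<^sub>R x) \<bullet> v) *\<^sub>R x)) (at x)" if "x \<in> ?S" for x
    using nz[OF that]
    by (auto intro!: derivative_eq_intros simp: fun_eq_iff inner_commute divide_simps power2_eq_square
        algebra_simps)
  show "\<bar>det (matrix (\<lambda>v. (2 * s / (1 - x \<bullet> x)) *\<^sub>R v + (((4 * s / (1 - x \<bullet> x)\<^sup>2) *\<^sub>R x) \<bullet> v) *\<^sub>R x))\<bar>
      = 16 * (1 + x \<bullet> x) / \<bar>1 - x \<bullet> x\<bar> ^ 5" if "x \<in> ?S" for x
  proof -
    \<comment> \<open>Apply \<open>det_rank_one_4\<close> with a = 2 s / (1 - r) and rank-one trace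
      4 s r / (1 - r)^2; their sum is 2 s (1 + r) / (1 - r)^2, and the four factors s multiply to
      1.\<close>
    define r where "r = x \<bullet> x"
    have r: "1 - r \<noteq> 0" "0 \<le> r" using nz[OF that] by (simp_all add: r_def)
    have "(2 * s / (1 - r)) ^ 3 * (2 * s / (1 - r) + (4 * s / (1 - r)\<^sup>2) * r)
        = (s * s) * (s * s) * 16 * (1 + r) / (1 - r) ^ 5"
      using r by (simp add: divide_simps) algebra
    then have "\<bar>(2 * s / (1 - r)) ^ 3 * (2 * s / (1 - r) + (4 * s / (1 - r)\<^sup>2) * r)\<bar>
        = 16 * (1 + r) / \<bar>1 - r\<bar> ^ 5"
      using r by (simp add: ss abs_mult power_abs)
    then show ?thesis
      by (subst det_rank_one_4) (simp only: inner_scaleR_left r_def)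
  qed
  let ?q = "\<lambda>w::R4. sqrt (1 + w \<bullet> w)"
  \<comment> \<open>With q = sqrt(1 + |w|^2), the inverse stereographic image of (w, s) / q is (w /
    q) / (1 + s / q) = w / (q + s); this is where the inverse map comes from.\<close>
  have left_inv: "(1 / (?q (?g x) + s)) *\<^sub>R ?g x = x" if "x \<in> ?S" for x
  proof -
    have x: "0 < s * (1 - x \<bullet> x)" using that by simp
    have nz': "1 - x \<bullet> x \<noteq> 0" using x by auto
    have "1 + ?g x \<bullet> ?g x = (s * s) * ((1 + x \<bullet> x) / (1 - x \<bullet> x))\<^sup>2"
      using nz' ss by (simp add: divide_simps power2_eq_square) algebra
    also have "\<dots> = ((1 + x \<bullet> x) / (s * (1 - x \<bullet> x)))\<^sup>2"
      using ss nz' by (simp add: power_divide power_mult_distrib power2_eq_square)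
    finally have qg: "?q (?g x) = (1 + x \<bullet> x) / (s * (1 - x \<bullet> x))"
      using x by (simp add: add_nonneg_nonneg)
    have "?q (?g x) + s = 2 * s / (1 - x \<bullet> x)"
      unfolding qg using nz' s by (auto simp: divide_simps)
    then show ?thesis using nz' s by auto
  qed
  then show "inj_on ?g ?S" by (rule inj_on_inverseI)
  \<comment> \<open>For s = -1 the point w = 0 is the direction of the south pole, where q + s
    vanishes and no preimage exists.\<close>
  have "w \<in> ?g ` ?S" if "w \<noteq> 0" for w
  proof -
    have q1: "?q w > 1" using that by simp
    moreover have "- 1 \<le> s" using s by auto
    ultimately have qs: "?q w + s > 0" by linarith
    define x where "x = (1 / (?q w + s)) *\<^sub>R w"
    have "w \<bullet> w = (?q w - s) * (?q w + s)"
      using ss by (simp add: algebra_simps)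
    then have "x \<bullet> x = (?q w - s) / (?q w + s)"
      using qs by (simp add: x_def divide_simps) 
    then have "1 - x \<bullet> x = 2 * s / (?q w + s)"
      using qs by (simp add: divide_simps left_diff_distrib)
    then have "0 < s * (1 - x \<bullet> x)" "2 * s / (1 - x \<bullet> x) = ?q w + s"
      using qs ss s by auto
    then have "x \<in> ?S" "?g x = w" using qs by (simp_all add: x_def)
    then show ?thesis by blast
  qed
  then have "- ?g ` ?S \<subseteq> {0}" by blast
  then show "negligible (- ?g ` ?S)" using negligible_subset negligible_sing by blast
qed fact

lemma sgn_gnomonic:
  fixes x :: R4
  assumes s: "s = 1 \<or> s = - 1" and x: "0 < s * (1 - x \<bullet> x)"
  shows "sgn ((2 * s / (1 - x \<bullet> x)) *\<^sub>R x, s) = stereo x"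
    and "1 / sqrt (1 + (norm ((2 * s / (1 - x \<bullet> x)) *\<^sub>R x))\<^sup>2) = \<bar>1 - x \<bullet> x\<bar> / (1 + x \<bullet> x)"
proof -
  have nz: "1 - x \<bullet> x \<noteq> 0" using x by auto
  have p: "0 < 1 + x \<bullet> x" by (simp add: add_pos_nonneg)
  \<comment> \<open>The reciprocal of the absolute height of \<open>stereo x\<close>: stretching by
    it moves the point to the hyperplane of height s.\<close>
  define t where "t = (1 + x \<bullet> x) / (s * (1 - x \<bullet> x))"
  have t: "0 < t" unfolding t_def using x p by simp
  have e: "t * (2 / (1 + x \<bullet> x)) = 2 * s / (1 - x \<bullet> x)" "t * ((1 - x \<bullet> x) / (1 + x \<bullet> x)) = s"
    using nz p s by (auto simp: t_def divide_simps)
  have "((2 * s / (1 - x \<bullet> x)) *\<^sub>R x, s) = t *\<^sub>R stereo x"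
    unfolding stereo_def power2_norm_eq_inner scaleR_Pair scaleR_scaleR real_scaleR_def e ..
  then show "sgn ((2 * s / (1 - x \<bullet> x)) *\<^sub>R x, s) = stereo x"
    using t by (simp add: sgn_scaleR)
  have "1 + (2 * s / (1 - r)) * ((2 * s / (1 - r)) * r) = ((1 + r) / (1 - r))\<^sup>2" if "1 - r \<noteq> 0" for r
    using that s by (auto simp: divide_simps power2_eq_square) (simp_all add: algebra_simps)
  from this[OF nz] have "1 + (norm ((2 * s / (1 - x \<bullet> x)) *\<^sub>R x))\<^sup>2 = ((1 + x \<bullet> x) / (1 - x \<bullet> x))\<^sup>2"
    unfolding power2_norm_eq_inner inner_scaleR_left inner_scaleR_right .
  then show "1 / sqrt (1 + (norm ((2 * s / (1 - x \<bullet> x)) *\<^sub>R x))\<^sup>2) = \<bar>1 - x \<bullet> x\<bar> / (1 + x \<bullet> x)"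
    using p by simp
qed

text \<open>The factor |1 - |x|^2|^5 in the cone weight cancels the one in the denominator of the
  gnomonic Jacobian. What is left, 16 / (1 + |x|^2)^4, is the same on both hemispheres and regular
  across the equator.\<close>

lemma nn_integral_gnomonic_stereo:
  fixes f :: "R5 \<Rightarrow> ennreal"
  assumes f [measurable]: "f \<in> borel_measurable borel" and s: "s = 1 \<or> s = - 1"
  shows "(\<integral>\<^sup>+ w. f (sgn (w, s)) * ennreal ((1 / sqrt (1 + (norm (w::R4))\<^sup>2)) ^ 5) \<partial>lborel)
    = (\<integral>\<^sup>+ x. f (stereo x) * (ennreal (stereo_jac x) * indicator {x. 0 < s * (1 - x \<bullet> x)} x) \<partial>lborel)"
proof -
  show ?thesis
  proof (subst nn_integral_gnomonic[OF _ s], measurable, rule nn_integral_cong)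
    fix x :: R4
    show "f (sgn ((2 * s / (1 - x \<bullet> x)) *\<^sub>R x, s))
        * ennreal ((1 / sqrt (1 + (norm ((2 * s / (1 - x \<bullet> x)) *\<^sub>R x))\<^sup>2)) ^ 5)
        * (ennreal (16 * (1 + x \<bullet> x) / \<bar>1 - x \<bullet> x\<bar> ^ 5) * indicator {x. 0 < s * (1 - x \<bullet> x)} x)
      = f (stereo x) * (ennreal (stereo_jac x) * indicator {x. 0 < s * (1 - x \<bullet> x)} x)"
    proof (cases "0 < s * (1 - x \<bullet> x)")
      case True
      define r where "r = x \<bullet> x"
      have r: "1 - r \<noteq> 0" "0 < 1 + r" using True by (auto simp: r_def add_pos_nonneg)
      have "(\<bar>1 - r\<bar> / (1 + r)) ^ 5 * (16 * (1 + r) / \<bar>1 - r\<bar> ^ 5) = 16 / (1 + r) ^ 4"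
        using r by (simp add: power_divide divide_simps) (simp add: eval_nat_numeral)
      then have "ennreal ((\<bar>1 - r\<bar> / (1 + r)) ^ 5) * ennreal (16 * (1 + r) / \<bar>1 - r\<bar> ^ 5) = ennreal (16 / (1 + r) ^ 4)"
        using r by (subst ennreal_mult[symmetric]) auto
      with True show ?thesis
        unfolding sgn_gnomonic[OF s True]
        by (simp add: stereo_jac_def power2_norm_eq_inner r_def mult.assoc)
    qed simp
  qed
qed

text \<open>The measure before completion. Borel computations are made here and lifted to
  \<open>sphere_measure\<close> afterwards.\<close>

definition surface_measure :: "R5 measure" where
  "surface_measure = scale_measure (of_nat DIM(R5))
     (distr (restrict_space lborel (cball 0 1 - {0})) (restrict_space borel (sphere 0 1)) sgn)"

lemma sphere_measure_eq: "(sphere_measure :: R5 measure) = completion surface_measure"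
  by (simp add: sphere_measure_def surface_measure_def)

lemma nn_integral_surface_measure_cone:
  fixes f :: "R5 \<Rightarrow> ennreal"
  assumes f [measurable]: "f \<in> borel_measurable borel"
  shows "(\<integral>\<^sup>+ \<xi>. f \<xi> \<partial>surface_measure) = 5 * (\<integral>\<^sup>+ z. f (sgn z) * indicator (cball 0 1 - {0}) z \<partial>lborel)"
proof -
  have sgn: "(sgn :: R5 \<Rightarrow> R5) \<in> restrict_space lborel (cball 0 1 - {0}) \<rightarrow>\<^sub>M restrict_space borel (sphere 0 1)"
  proof (rule measurable_restrict_space3)
    show "(sgn :: R5 \<Rightarrow> R5) \<in> lborel \<rightarrow>\<^sub>M borel" by measurable
  qed (auto simp: norm_sgn)
  have f': "f \<in> borel_measurable (restrict_space borel (sphere 0 1))"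
    by (rule measurable_restrict_space1) fact
  have S: "cball 0 1 - {0} \<in> sets (borel :: R5 measure)"
    by (intro sets.Diff borel_closed) auto
  show ?thesis
    unfolding surface_measure_def
    by (subst nn_integral_scale_measure, simp add: f', subst nn_integral_distr[OF sgn], simp add: f',
        subst nn_integral_restrict_space) (use S in simp_all)
qed

lemma nn_integral_surface_measure:
  fixes f :: "R5 \<Rightarrow> ennreal"
  assumes f [measurable]: "f \<in> borel_measurable borel"
  shows "(\<integral>\<^sup>+ \<xi>. f \<xi> \<partial>surface_measure) = (\<integral>\<^sup>+ x. ennreal (stereo_jac x) * f (stereo x) \<partial>lborel)"
proof -
  let ?\<rho> = "\<lambda>w::R4. (1 / sqrt (1 + (norm w)\<^sup>2)) ^ 5"
  let ?D = "\<lambda>s. {x::R4. 0 < s * (1 - x \<bullet> x)}"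
  have "(\<integral>\<^sup>+ \<xi>. f \<xi> \<partial>surface_measure)
      = 5 * (\<integral>\<^sup>+ w. (f (sgn (w, 1)) + f (sgn (w, - 1))) * ennreal (?\<rho> w / 5) \<partial>lborel)"
    unfolding nn_integral_surface_measure_cone[OF f] nn_integral_cone[OF f] by simp
  also have "\<dots> = (\<integral>\<^sup>+ w. f (sgn (w, 1)) * ennreal (?\<rho> w) + f (sgn (w, - 1)) * ennreal (?\<rho> w) \<partial>lborel)"
  proof (subst nn_integral_cmult[symmetric], measurable, rule nn_integral_cong)
    fix w :: R4
    have "5 * ennreal (?\<rho> w / 5) = ennreal (?\<rho> w)"
      using ennreal_mult[of 5 "?\<rho> w / 5"] by simp
    then show "5 * ((f (sgn (w, 1)) + f (sgn (w, - 1))) * ennreal (?\<rho> w / 5))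
        = f (sgn (w, 1)) * ennreal (?\<rho> w) + f (sgn (w, - 1)) * ennreal (?\<rho> w)"
      unfolding mult.left_commute[of 5] by (simp add: distrib_right)
  qed
  also have "\<dots> = (\<integral>\<^sup>+ x. f (stereo x) * (ennreal (stereo_jac x) * indicator (?D 1) x) \<partial>lborel)
      + (\<integral>\<^sup>+ x. f (stereo x) * (ennreal (stereo_jac x) * indicator (?D (- 1)) x) \<partial>lborel)"
    by (subst nn_integral_add) (simp_all add: nn_integral_gnomonic_stereo)
  also have "\<dots> = (\<integral>\<^sup>+ x. f (stereo x) * (ennreal (stereo_jac x) * indicator (?D 1) x)
      + f (stereo x) * (ennreal (stereo_jac x) * indicator (?D (- 1)) x) \<partial>lborel)"
    by (subst nn_integral_add) simp_all
  also have "\<dots> = (\<integral>\<^sup>+ x. ennreal (stereo_jac x) * f (stereo x) \<partial>lborel)"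
  proof (rule nn_integral_cong_AE)
    \<comment> \<open>The unit sphere of R^4 is the chart image of the equator, which neither open
      hemisphere contains.\<close>
    have "AE x::R4 in lborel. x \<notin> sphere 0 1"
      using negligible_sphere[of "0::R4" 1] null_sets_completion_iff[of "sphere (0::R4) 1" lborel]
      by (intro AE_not_in) (simp add: negligible_iff_null_sets borel_closed)
    then show "AE x in lborel. f (stereo x) * (ennreal (stereo_jac x) * indicator (?D 1) x)
        + f (stereo x) * (ennreal (stereo_jac x) * indicator (?D (- 1)) x)
      = ennreal (stereo_jac x) * f (stereo x)"
    proof eventually_elim
      case (elim x)
      then have "x \<bullet> x \<noteq> 1" by (simp add: norm_eq_sqrt_inner)
      then show ?case by (cases "x \<bullet> x < 1") (auto simp: indicator_def mult.commute)
    qed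
  qed
  finally show ?thesis .
qed

section \<open>Passing between the sphere and its chart\<close>

lemma surface_measure_eq:
  "surface_measure = distr (density lborel (\<lambda>x. ennreal (stereo_jac x))) (restrict_space borel (sphere 0 1)) stereo"
proof (rule measure_eqI)
  have st: "stereo \<in> density lborel (\<lambda>x. ennreal (stereo_jac x)) \<rightarrow>\<^sub>M restrict_space borel (sphere 0 1)"
    by (rule measurable_restrict_space2) auto
  show "sets surface_measure
      = sets (distr (density lborel (\<lambda>x. ennreal (stereo_jac x))) (restrict_space borel (sphere 0 1)) stereo)"
    by (simp add: surface_measure_def)
  fix A assume A: "A \<in> sets surface_measure"
  then have A': "A \<in> sets (restrict_space borel (sphere 0 1))" by (simp add: surface_measure_def)
  then have [measurable]: "A \<in> sets borel" by (simp add: sets_restrict_space_iff)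
  have "emeasure surface_measure A = (\<integral>\<^sup>+ \<xi>. indicator A \<xi> \<partial>surface_measure)"
    using A by simp
  also have "\<dots> = (\<integral>\<^sup>+ x. ennreal (stereo_jac x) * indicator (stereo -` A) x \<partial>lborel)"
    by (subst nn_integral_surface_measure) (auto simp: indicator_def intro!: nn_integral_cong)
  also have "\<dots> = emeasure (distr (density lborel (\<lambda>x. ennreal (stereo_jac x))) (restrict_space borel (sphere 0 1)) stereo) A"
    using measurable_sets[OF stereo_measurable \<open>A \<in> sets borel\<close>]
    by (subst emeasure_distr[OF st A']) (simp add: emeasure_density)
  finally show "emeasure surface_measure A = \<dots>" .
qed

lemma space_surface_measure: "space surface_measure = sphere 0 1"
  by (simp add: surface_measure_eq space_restrict_space)

lemma stereo_left_inverse: "(1 / (1 + snd (stereo x))) *\<^sub>R fst (stereo x) = x"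
proof -
  have *: "1 / (1 + (1 - r) / (1 + r)) * (2 / (1 + r)) = 1" if "0 < 1 + r" for r :: real
    using that by (simp add: divide_simps)
  show ?thesis
    unfolding stereo_def fst_conv snd_conv scaleR_scaleR *[OF one_plus_norm_square_pos] scaleR_one ..
qed

lemma inj_stereo: "inj stereo"
  by (rule injI) (metis stereo_left_inverse)

lemma stereo_right_inverse:
  assumes "norm \<xi> = 1" "\<xi> \<noteq> south_pole"
  shows "stereo ((1 / (1 + snd \<xi>)) *\<^sub>R fst \<xi>) = \<xi>"
proof -
  obtain u t where xi: "\<xi> = (u, t)" by (cases \<xi>)
  have ut: "u \<bullet> u + t\<^sup>2 = 1"
    using assms(1) by (simp add: xi norm_Pair power2_norm_eq_inner)
  have t: "1 + t \<noteq> 0"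
  proof
    assume "1 + t = 0"
    then have "t = - 1" by simp
    with ut have "u = 0" by simp
    with \<open>t = - 1\<close> show False using assms(2) by (simp add: xi south_pole_def)
  qed
  have uu: "u \<bullet> u = (1 - t) * (1 + t)" using ut by (simp add: power2_eq_square algebra_simps)
  have n: "(norm ((1 / (1 + t)) *\<^sub>R u))\<^sup>2 = (1 - t) / (1 + t)"
    unfolding power2_norm_eq_inner using t by (simp add: uu)
  have "1 + (1 - t) / (1 + t) = 2 / (1 + t)" "1 - (1 - t) / (1 + t) = 2 * t / (1 + t)"
    using t by (simp_all add: divide_simps)
  then show ?thesis
    unfolding xi stereo_def fst_conv snd_conv n using t by simp
qed

text \<open>Null sets of the chart become null sets of the sphere, and the chart misses a null set.
  Quantifying over all x with \<open>\<xi> = stereo x\<close> keeps the inverse chart out of the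
  statement.\<close>

lemma surface_measure_AE:
  assumes "AE x in lborel. P x"
  shows "AE \<xi> in surface_measure. \<forall>x. \<xi> = stereo x \<longrightarrow> P x" "AE \<xi> in surface_measure. \<xi> \<in> range stereo"
proof -
  let ?inv = "\<lambda>\<xi>::R5. (1 / (1 + snd \<xi>)) *\<^sub>R fst \<xi>"
  obtain N where N: "N \<in> null_sets lborel" "{x. \<not> P x} \<subseteq> N"
    using assms by (auto elim!: AE_E simp: null_sets_def)
  have [measurable]: "?inv \<in> borel_measurable borel"
    by (simp add: borel_prod[symmetric])
  have [measurable]: "N \<in> sets borel" using N by (simp add: null_sets_def)
  \<comment> \<open>The exceptional set is described by preimage under the inverse chart, which
    makes it Borel. At the south pole that formula divides by 0, so the pole is added
    explicitly.\<close>
  define A where "A = (?inv -` N \<union> {south_pole}) \<inter> sphere 0 1"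
  have "?inv -` N \<in> sets borel" using measurable_sets[of ?inv borel borel N] by simp
  then have A [measurable]: "A \<in> sets borel" by (simp add: A_def borel_closed)
  have st: "stereo \<in> density lborel (\<lambda>x. ennreal (stereo_jac x)) \<rightarrow>\<^sub>M restrict_space borel (sphere 0 1)"
    by (rule measurable_restrict_space2) auto
  have A': "A \<in> sets (restrict_space borel (sphere 0 1))"
    using A by (simp add: sets_restrict_space_iff) (simp add: A_def)
  have "emeasure surface_measure A = (\<integral>\<^sup>+ \<xi>. indicator A \<xi> \<partial>surface_measure)"
    using A' by (simp add: surface_measure_def)
  also have "\<dots> = (\<integral>\<^sup>+ x. 0 \<partial>(lborel :: R4 measure))"
  proof (subst nn_integral_surface_measure, simp, rule nn_integral_cong_AE)
    show "AE x in lborel. ennreal (stereo_jac x) * indicator A (stereo x) = 0"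
      using AE_not_in[OF N(1)]
    proof eventually_elim
      case (elim x)
      have "1 + (norm x)\<^sup>2 > 0" by (simp add: add_pos_nonneg)
      then have "stereo x \<noteq> south_pole"
        by (auto simp: stereo_def south_pole_def divide_simps)
      with elim have "stereo x \<notin> A" by (simp add: A_def stereo_left_inverse)
      then show ?case by simp
    qed
  qed
  finally have "A \<in> null_sets surface_measure"
    using A' by (simp add: null_sets_def surface_measure_def)
  note A_null = this
  have AE: "AE \<xi> in surface_measure. \<xi> \<in> sphere 0 1 - A"
    using AE_not_in[OF A_null] AE_space
    by eventually_elim (simp add: space_surface_measure)
  show "AE \<xi> in surface_measure. \<xi> \<in> range stereo"
    using AE
  proof eventually_elim
    case (elim \<xi>)
    then have "stereo (?inv \<xi>) = \<xi>" by (intro stereo_right_inverse) (auto simp: A_def)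
    then show ?case by (metis rangeI)
  qed
  show "AE \<xi> in surface_measure. \<forall>x. \<xi> = stereo x \<longrightarrow> P x"
    using AE by eventually_elim (use N(2) in \<open>auto simp: A_def stereo_left_inverse\<close>)
qed

lemma borel_measurable_completion_AE:
  fixes g g' :: "'a \<Rightarrow> real"
  assumes g' [measurable]: "g' \<in> borel_measurable M" and ae: "AE x in M. g x = g' x"
  shows "g \<in> borel_measurable (completion M)"
proof (rule measurableI)
  fix B :: "real set" assume "B \<in> sets borel"
  then have *: "g' -` B \<inter> space M \<in> sets (completion M)"
    using measurable_sets[OF g'] by auto
  show "g -` B \<inter> space (completion M) \<in> sets (completion M)"
  proof (rule completion.in_sets_AE[OF _ *])
    show "AE x in completion M. (x \<in> g' -` B \<inter> space M) = (x \<in> g -` B \<inter> space (completion M))"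
      using AE_completion[OF ae] by eventually_elim auto
  qed auto
qed auto

text \<open>Only the pull-back of \<open>g\<close> is known to be Lebesgue measurable. A Borel
  version of it, carried back by the inverse chart, is a Borel function on the sphere that agrees
  with \<open>g\<close> almost everywhere; the push-forward formula applies to that function and
  completion returns to \<open>g\<close>.\<close>

lemma
  fixes g :: "R5 \<Rightarrow> real"
  assumes g: "(\<lambda>x. g (stereo x)) \<in> borel_measurable lebesgue"
  shows borel_measurable_sphere_stereo: "g \<in> borel_measurable sphere_measure" (is ?meas)
    and integrable_sphere_stereo:
      "integrable sphere_measure g \<longleftrightarrow> integrable lebesgue (\<lambda>x. stereo_jac x * g (stereo x))" (is ?int)
    and integral_sphere_stereo:
      "(LINT \<xi>|sphere_measure. g \<xi>) = (LINT x|lebesgue. stereo_jac x * g (stereo x))" (is ?eq)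
proof -
  let ?inv = "\<lambda>\<xi>::R5. (1 / (1 + snd \<xi>)) *\<^sub>R fst \<xi>"
  obtain h where h [measurable]: "h \<in> borel_measurable lborel" and ae: "AE x in lborel. g (stereo x) = h x"
    using completion_ex_borel_measurable_real[OF g] by blast
  have st: "stereo \<in> density lborel (\<lambda>x. ennreal (stereo_jac x)) \<rightarrow>\<^sub>M restrict_space borel (sphere 0 1)"
    by (rule measurable_restrict_space2) auto
  have [measurable]: "?inv \<in> borel_measurable borel"
    by (simp add: borel_prod[symmetric])
  define g' where "g' \<xi> = h (?inv \<xi>)" for \<xi>
  have "g' \<in> borel_measurable borel" unfolding g'_def using h by measurable
  then have g': "g' \<in> borel_measurable (restrict_space borel (sphere 0 1))"
    by (rule measurable_restrict_space1)
  then have g'_surf: "g' \<in> borel_measurable surface_measure" by (simp add: surface_measure_def)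
  have g'_st: "g' (stereo x) = h x" for x by (simp add: g'_def stereo_left_inverse)
  have AE: "AE \<xi> in surface_measure. g \<xi> = g' \<xi>"
    using surface_measure_AE[OF ae] by eventually_elim (auto simp: g'_st)
  show m: ?meas
    unfolding sphere_measure_eq by (rule borel_measurable_completion_AE[OF g'_surf AE])
  have AEc: "AE \<xi> in sphere_measure. g \<xi> = g' \<xi>"
    unfolding sphere_measure_eq using AE by (rule AE_completion)
  have m': "g' \<in> borel_measurable sphere_measure"
    unfolding sphere_measure_eq using g'_surf by (rule measurable_completion)
  have jm: "(\<lambda>x. stereo_jac x * h x) \<in> borel_measurable lborel" using h by simp
  have AEl: "AE x in lebesgue. stereo_jac x * g (stereo x) = stereo_jac x * h x"
    using AE_completion[OF ae] by eventually_elim simp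
  have gm: "(\<lambda>x. stereo_jac x * g (stereo x)) \<in> borel_measurable lebesgue"
    using g by (intro borel_measurable_times measurable_completion[of stereo_jac lborel]) auto
  have nn: "AE x in lborel. 0 \<le> stereo_jac x" using stereo_jac_pos by (simp add: less_imp_le)
  have "integrable sphere_measure g \<longleftrightarrow> integrable surface_measure g'"
    unfolding integrable_cong_AE[OF m m' AEc] unfolding sphere_measure_eq integrable_completion[OF g'_surf] ..
  also have "\<dots> \<longleftrightarrow> integrable lborel (\<lambda>x. stereo_jac x * h x)"
    unfolding surface_measure_eq integrable_distr_eq[OF st g'] g'_st
    using nn h by (subst integrable_density) auto
  also have "\<dots> \<longleftrightarrow> integrable lebesgue (\<lambda>x. stereo_jac x * g (stereo x))"
    using integrable_completion[OF jm] integrable_cong_AE[OF gm measurable_completion[OF jm] AEl] by simp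
  finally show ?int .
  have "(LINT \<xi>|sphere_measure. g \<xi>) = (LINT \<xi>|surface_measure. g' \<xi>)"
    unfolding integral_cong_AE[OF m m' AEc] unfolding sphere_measure_eq integral_completion[OF g'_surf] ..
  also have "\<dots> = (LINT x|lborel. stereo_jac x * h x)"
    unfolding surface_measure_eq integral_distr[OF st g'] g'_st
    using nn h by (subst integral_density) auto
  also have "\<dots> = (LINT x|lebesgue. stereo_jac x * g (stereo x))"
    using integral_completion[OF jm] integral_cong_AE[OF gm measurable_completion[OF jm] AEl] by simp
  finally show ?eq .
qed

text \<open>From the south pole the squared chordal distance to \<open>stereo x\<close> is 4 / (1 +
  |x|^2), so the integrand in the chart is a pure power of 1 + |x|^2 with exponent -q, q = 4 -
  \<alpha> / 2. The convergence condition q > 2 is \<alpha> < 4.\<close>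

lemma nn_integral_riesz_kernel:
  fixes \<alpha> :: real
  assumes \<alpha>: "0 < \<alpha>" "\<alpha> < 4" and \<xi>: "norm \<xi> = 1"
  shows "(\<integral>\<^sup>+ \<eta>. ennreal (norm (\<xi> - \<eta>) powr (- \<alpha>)) \<partial>surface_measure) = ennreal (mu0 \<alpha>)"
proof -
  have sp: "norm south_pole = 1" by (simp add: south_pole_def norm_Pair)
  obtain T :: "R5 \<Rightarrow> R5" where T: "linear T" "\<And>a. norm (T a) = norm a" "T south_pole = \<xi>" "distr lborel borel T = lborel"
    using isometry_between_unit_vectors[where 'n = 5, of south_pole \<xi>] \<xi> sp by auto
  have [measurable]: "T \<in> borel_measurable borel"
    using linear_continuous_on[of T UNIV] T(1)
    by (intro borel_measurable_continuous_onI) (simp add: linear_conv_bounded_linear)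
  have [measurable]: "cball 0 1 - {0} \<in> sets (borel :: R5 measure)"
    by (intro sets.Diff borel_closed) auto
  have T0: "T z = 0 \<longleftrightarrow> z = 0" for z using T(2)[of z] by (metis norm_eq_zero)
  have Tsgn: "sgn (T z) = T (sgn z)" for z
    using T(1,2) by (simp add: sgn_div_norm linear_cmul)
  \<comment> \<open>The rotation is performed in the cone formula, where it is a linear change of
    variables preserving \<open>lborel\<close>; in the chart it would be a Moebius map.\<close>
  have "(\<integral>\<^sup>+ \<eta>. ennreal (norm (\<xi> - \<eta>) powr (- \<alpha>)) \<partial>surface_measure)
      = 5 * (\<integral>\<^sup>+ z. ennreal (norm (\<xi> - sgn z) powr (- \<alpha>)) * indicator (cball 0 1 - {0}) z \<partial>distr lborel borel T)"
    unfolding T(4) by (rule nn_integral_surface_measure_cone) measurable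
  also have "\<dots> = 5 * (\<integral>\<^sup>+ z. ennreal (norm (south_pole - sgn z) powr (- \<alpha>)) * indicator (cball 0 1 - {0}) z \<partial>lborel)"
  proof (subst nn_integral_distr, measurable, rule arg_cong[where f = "\<lambda>t. 5 * t"], rule nn_integral_cong)
    fix z
    have "\<xi> - sgn (T z) = T (south_pole - sgn z)"
      using T(1) by (simp add: Tsgn T(3)[symmetric] linear_diff)
    then show "ennreal (norm (\<xi> - sgn (T z)) powr (- \<alpha>)) * indicator (cball 0 1 - {0}) (T z)
        = ennreal (norm (south_pole - sgn z) powr (- \<alpha>)) * indicator (cball 0 1 - {0}) z"
      using T(2) by (simp add: indicator_def T0)
  qed
  also have "\<dots> = (\<integral>\<^sup>+ \<eta>. ennreal (norm (south_pole - \<eta>) powr (- \<alpha>)) \<partial>surface_measure)"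
    by (rule nn_integral_surface_measure_cone[symmetric]) measurable
  also have "\<dots> = (\<integral>\<^sup>+ x. ennreal (stereo_jac x) * ennreal (norm (south_pole - stereo x) powr (- \<alpha>)) \<partial>lborel)"
    by (rule nn_integral_surface_measure) measurable
  also have "\<dots> = (\<integral>\<^sup>+ x. ennreal (2 powr (4 - \<alpha>)) * ennreal ((1 + (norm (x::R4))\<^sup>2) powr (- (4 - \<alpha> / 2))) \<partial>lborel)"
  proof (rule nn_integral_cong)
    fix x :: R4
    define r where "r = 1 + (norm x)\<^sup>2"
    have r: "r > 0" by (simp add: r_def add_pos_nonneg)
    have "(norm (south_pole - stereo x))\<^sup>2 = 2 - 2 * (south_pole \<bullet> stereo x)"
      using sp by (simp add: power2_norm_eq_inner inner_diff inner_commute norm_eq_1[THEN iffD1, OF norm_stereo] norm_eq_1)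
    also have "south_pole \<bullet> stereo x = 1 - 2 / r"
      using r by (simp add: south_pole_def stereo_def r_def divide_simps)
    finally have "(norm (south_pole - stereo x))\<^sup>2 = 4 / r" by simp
    then have "norm (south_pole - stereo x) = sqrt (4 / r)"
      using real_sqrt_unique[of "norm (south_pole - stereo x)"] by simp
    also have "\<dots> = 2 * r powr (- (1 / 2))"
    proof -
      have "r powr (- (1 / 2)) = 1 / sqrt r"
        unfolding powr_minus_divide using r powr_half_sqrt[of r] by simp
      then show ?thesis by (simp add: real_sqrt_divide)
    qed
    finally have k: "norm (south_pole - stereo x) powr (- \<alpha>) = 2 powr (- \<alpha>) * r powr (\<alpha> / 2)"
      using r by (simp add: powr_mult powr_powr)
    have j: "stereo_jac x = 2 powr 4 * r powr (- 4)"
      using r by (simp add: stereo_jac_def r_def[symmetric] powr_minus_divide)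
    have "stereo_jac x * norm (south_pole - stereo x) powr (- \<alpha>)
        = (2 powr 4 * 2 powr (- \<alpha>)) * (r powr (- 4) * r powr (\<alpha> / 2))"
      unfolding j k by (simp only: mult_ac)
    also have "\<dots> = 2 powr (4 - \<alpha>) * r powr (- (4 - \<alpha> / 2))"
      unfolding powr_add[symmetric] by (simp only: minus_diff_eq) (simp add: algebra_simps)
    finally show "ennreal (stereo_jac x) * ennreal (norm (south_pole - stereo x) powr (- \<alpha>))
        = ennreal (2 powr (4 - \<alpha>)) * ennreal ((1 + (norm x)\<^sup>2) powr (- (4 - \<alpha> / 2)))"
      using stereo_jac_pos[of x] by (simp add: r_def ennreal_mult[symmetric])
  qed
  also have "\<dots> = ennreal (2 powr (4 - \<alpha>)) * ennreal (pi\<^sup>2 / ((4 - \<alpha> / 2 - 1) * (4 - \<alpha> / 2 - 2)))"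
    using \<alpha> by (subst nn_integral_cmult, simp, subst nn_integral_power_decay_R4) simp_all
  also have "\<dots> = ennreal (mu0 \<alpha>)"
  proof -
    have "(4 - \<alpha> / 2 - 1) * (4 - \<alpha> / 2 - 2) = (6 - \<alpha>) * (4 - \<alpha>) / 4" by (simp add: field_simps)
    moreover have "2 powr (6 - \<alpha>) = 4 * 2 powr (4 - \<alpha>)"
      using powr_add[of 2 2 "4 - \<alpha>"] by simp
    ultimately have "2 powr (4 - \<alpha>) * (pi\<^sup>2 / ((4 - \<alpha> / 2 - 1) * (4 - \<alpha> / 2 - 2))) = mu0 \<alpha>"
      by (simp only: mu0_def) simp
    then show ?thesis using \<alpha> by (subst ennreal_mult[symmetric]) auto
  qed
  finally show ?thesis .
qed

subsection \<open>Transporting the linearised equation to the sphere\<close>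

lemma sph_smooth_bounded:
  fixes f :: "R5 \<Rightarrow> real"
  assumes "sph_smooth f"
  obtains B where "0 \<le> B" "\<And>x. \<bar>f (stereo x)\<bar> \<le> B"
proof -
  have "continuous_on (sphere 0 1) (\<lambda>y. f (sgn y))"
    using assms unfolding sph_smooth_def
    by (intro continuous_on_subset[OF smooth_on_continuous]) auto
  then have "compact ((\<lambda>y. f (sgn y)) ` sphere 0 1)"
    by (rule compact_continuous_image) simp
  then have "bounded ((\<lambda>y. f (sgn y)) ` sphere 0 1)"
    by (rule compact_imp_bounded)
  then obtain B where B: "\<And>y. norm y = 1 \<Longrightarrow> \<bar>f (sgn y)\<bar> \<le> B"
    unfolding bounded_iff by (metis imageI mem_sphere_0 real_norm_def)
  from B[of "stereo x" for x] have "\<bar>f (stereo x)\<bar> \<le> B" for x by simp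
  moreover from this[of 0] have "0 \<le> B" by linarith
  ultimately show thesis using that by blast
qed

text \<open>Combined with \<open>sph_smooth_bounded\<close>, this makes the fourth-order term
  integrable against \<phi>.\<close>

lemma sph_smooth_paneitz:
  assumes "sph_smooth \<psi>" shows "sph_smooth (paneitz \<psi>)"
proof -
  have "sph_smooth (\<lambda>\<eta>. (- 1) * sph_laplacian \<psi> \<eta> + 2 * \<psi> \<eta>)"
    using sph_smooth_sph_laplacian[OF assms refl] assms unfolding sph_smooth_def
    by (intro smooth_on_add smooth_on_mult smooth_on_const) auto
  from sph_smooth_sph_laplacian[OF this refl]
  have "smooth_on (- {0}) (\<lambda>y. (- 1) * sph_laplacian (\<lambda>\<eta>. (- 1) * sph_laplacian \<psi> \<eta> + 2 * \<psi> \<eta>) (sgn y))"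
    unfolding sph_smooth_def by (intro smooth_on_mult smooth_on_const) auto
  then show ?thesis by (simp add: sph_smooth_def paneitz_def)
qed

section \<open>The Riesz kernel in the chart\<close>

lemma dist_stereo_square:
  "(norm (stereo x - stereo y))\<^sup>2 = 4 * (norm (x - y))\<^sup>2 / ((1 + (norm x)\<^sup>2) * (1 + (norm y)\<^sup>2))"
proof -
  define X where "X = (norm x)\<^sup>2"
  define Y where "Y = (norm y)\<^sup>2"
  have X: "1 + X > 0" and Y: "1 + Y > 0"
    using one_plus_norm_square_pos by (auto simp: X_def Y_def)
  have "(norm (stereo x - stereo y))\<^sup>2 = (norm (stereo x))\<^sup>2 + (norm (stereo y))\<^sup>2 - 2 * (stereo x \<bullet> stereo y)"
    by (simp add: power2_norm_eq_inner inner_diff inner_commute del: norm_stereo)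
  also have "\<dots> = 2 - 2 * (stereo x \<bullet> stereo y)"
    by simp
  also have "stereo x \<bullet> stereo y = (4 * (x \<bullet> y) + (1 - X) * (1 - Y)) / ((1 + X) * (1 + Y))"
    using X Y by (simp add: stereo_def X_def[symmetric] Y_def[symmetric] add_divide_distrib)
  also have "2 - 2 * ((4 * (x \<bullet> y) + (1 - X) * (1 - Y)) / ((1 + X) * (1 + Y)))
      = 4 * (X + Y - 2 * (x \<bullet> y)) / ((1 + X) * (1 + Y))"
    using X Y by (simp add: divide_simps) (simp add: algebra_simps)
  also have "X + Y - 2 * (x \<bullet> y) = (norm (x - y))\<^sup>2"
    by (simp add: X_def Y_def power2_norm_eq_inner inner_diff inner_commute)
  finally show ?thesis by (simp add: X_def Y_def)
qed

text \<open>On the diagonal both sides are 0, since \<open>0 powr a = 0\<close>.\<close>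

lemma dist_stereo_powr:
  "norm (stereo x - stereo y) powr (- \<alpha>)
    = 2 powr (- \<alpha>) * norm (x - y) powr (- \<alpha>) * (1 + (norm x)\<^sup>2) powr (\<alpha> / 2) * (1 + (norm y)\<^sup>2) powr (\<alpha> / 2)"
proof -
  define X where "X = 1 + (norm x)\<^sup>2"
  define Y where "Y = 1 + (norm y)\<^sup>2"
  have X: "X > 0" and Y: "Y > 0"
    using one_plus_norm_square_pos by (auto simp: X_def Y_def)
  have p: "r powr (- (1 / 2)) = 1 / sqrt r" if "0 < r" for r
    unfolding powr_minus_divide using that powr_half_sqrt[of r] by simp
  have "norm (stereo x - stereo y) = sqrt (4 * (norm (x - y))\<^sup>2 / (X * Y))"
    using dist_stereo_square[of x y] by (metis X_def Y_def norm_ge_zero real_sqrt_unique)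
  also have "\<dots> = 2 * norm (x - y) * X powr (- (1 / 2)) * Y powr (- (1 / 2))"
    unfolding p[OF X] p[OF Y] by (simp add: real_sqrt_divide real_sqrt_mult)
  finally show ?thesis
    using X Y by (simp add: powr_mult powr_powr X_def[symmetric] Y_def[symmetric])
qed

lemma C_const_pos:
  assumes "0 < \<alpha>" "\<alpha> < 4" shows "0 < C_const \<alpha>"
  using assms by (simp add: C_const_def)

lemma kappa_pos:
  assumes "0 < \<alpha>" "\<alpha> < 4" shows "0 < kappa \<alpha>"
  using C_const_pos[OF assms] by (simp add: kappa_def)

lemma mu0_pos: "0 < \<alpha> \<Longrightarrow> \<alpha> < 4 \<Longrightarrow> 0 < mu0 \<alpha>"
  by (simp add: mu0_def)

text \<open>The exponent of 1 + |x|^2 is -4 + \<alpha> / 2 = -(8 - \<alpha>) / 2, exactly the decay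
  of exp U. On the diagonal division by zero and \<open>powr\<close> at 0 make both sides 0.\<close>

lemma kernel_stereo:
  assumes \<alpha>: "0 < \<alpha>" "\<alpha> < 4"
  shows "exp (U_sol \<alpha> x) * exp (U_sol \<alpha> y) / norm (x - y) powr \<alpha>
    = kappa \<alpha> * stereo_jac x * stereo_jac y * norm (stereo x - stereo y) powr (- \<alpha>)"
proof -
  note C = C_const_pos[OF \<alpha>]
  define \<beta> where "\<beta> = (8 - \<alpha>) / 2"
  have E: "exp (U_sol \<alpha> z) = C_const \<alpha> powr \<beta> * (1 + (norm z)\<^sup>2) powr (- \<beta>)" for z
    using C one_plus_norm_square_pos[of z]
    by (simp add: U_sol_def \<beta>_def[symmetric] powr_def ln_div exp_add[symmetric] right_diff_distrib)
  have J: "stereo_jac z = 2 powr 4 * (1 + (norm z)\<^sup>2) powr (- 4)" for z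
    using one_plus_norm_square_pos[of z] by (simp add: stereo_jac_def powr_minus_divide)
  define X where "X = 1 + (norm x)\<^sup>2"
  define Y where "Y = 1 + (norm y)\<^sup>2"
  have e: "- 4 + \<alpha> / 2 = - \<beta>" by (simp add: \<beta>_def field_simps)
  have "kappa \<alpha> * stereo_jac x * stereo_jac y * norm (stereo x - stereo y) powr (- \<alpha>)
      = C_const \<alpha> powr (8 - \<alpha>) * (2 powr (- (8 - \<alpha>)) * 2 powr 4 * 2 powr 4 * 2 powr (- \<alpha>))
        * norm (x - y) powr (- \<alpha>) * (X powr (- 4) * X powr (\<alpha> / 2)) * (Y powr (- 4) * Y powr (\<alpha> / 2))"
    unfolding kappa_def J dist_stereo_powr X_def Y_def by (simp only: mult_ac)
  \<comment> \<open>The power of 2 in \<open>kappa\<close> is the one that absorbs the two Jacobian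
    constants 16 and the factor 2 of the chordal distance.\<close>
  also have "2 powr (- (8 - \<alpha>)) * 2 powr 4 * 2 powr 4 * 2 powr (- \<alpha>) = (1::real)"
    unfolding powr_add[symmetric] by simp
  also have "C_const \<alpha> powr (8 - \<alpha>) = C_const \<alpha> powr \<beta> * C_const \<alpha> powr \<beta>"
    unfolding powr_add[symmetric] by (simp add: \<beta>_def)
  also have "X powr (- 4) * X powr (\<alpha> / 2) = X powr (- \<beta>)"
    unfolding powr_add[symmetric] e ..
  also have "Y powr (- 4) * Y powr (\<alpha> / 2) = Y powr (- \<beta>)"
    unfolding powr_add[symmetric] e ..
  finally show ?thesis
    unfolding E X_def[symmetric] Y_def[symmetric] by (simp add: powr_minus_divide)
qed

section \<open>Integrability and exchange of integrals\<close>

lemma lebesgue_integral_AE_borel: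
  fixes u u' :: "'a::euclidean_space \<Rightarrow> real"
  assumes u': "u' \<in> borel_measurable lborel" and ae: "AE x in lborel. u x = u' x"
  shows "(LINT x|lebesgue. u x) = (LINT x|lborel. u' x)"
proof -
  have "(LINT x|lebesgue. u x) = (LINT x|lebesgue. u' x)"
    by (rule integral_cong_AE[OF borel_measurable_completion_AE[OF u' ae] measurable_completion[OF u']
          AE_completion[OF ae]])
  then show ?thesis by (simp add: integral_completion[OF u'])
qed

lemma integrable_stereo_jac: "integrable lborel stereo_jac"
proof (rule integrableI_nonneg)
  have "(\<integral>\<^sup>+ x. ennreal (stereo_jac x) \<partial>lborel)
      = (\<integral>\<^sup>+ x. ennreal 16 * ennreal ((1 + (norm (x::R4))\<^sup>2) powr (- 4)) \<partial>lborel)"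
  proof (rule nn_integral_cong)
    fix x :: R4
    have "stereo_jac x = 16 * (1 + (norm x)\<^sup>2) powr (- 4)"
      using one_plus_norm_square_pos[of x] by (simp add: stereo_jac_def powr_minus_divide)
    then show "ennreal (stereo_jac x) = ennreal 16 * ennreal ((1 + (norm x)\<^sup>2) powr (- 4))"
      by (simp add: ennreal_mult)
  qed
  also have "\<dots> < \<infinity>"
    by (subst nn_integral_cmult, simp, subst nn_integral_power_decay_R4)
       (simp_all add: ennreal_mult_less_top)
  finally show "(\<integral>\<^sup>+ x. ennreal (stereo_jac x) \<partial>lborel) < \<infinity>" .
qed (use stereo_jac_pos in \<open>auto simp: less_imp_le\<close>)

text \<open>The embedding of L^2 in L^1 for a finite measure, by |t| <= 1 + t^2, with a bounded
  factor carried along.\<close>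

lemma integrable_stereo_jac_L2w:
  assumes \<phi> [measurable]: "\<phi> \<in> borel_measurable lborel"
    and L2: "integrable lborel (\<lambda>x. (\<phi> x)\<^sup>2 / (1 + (norm x)\<^sup>2) ^ 4)"
    and g [measurable]: "g \<in> borel_measurable lborel" and B: "0 \<le> B" "\<And>x. \<bar>g x\<bar> \<le> B"
  shows "integrable lborel (\<lambda>x. stereo_jac x * \<phi> x * g x)"
proof (rule Bochner_Integration.integrable_bound)
  show "integrable lborel (\<lambda>x. B * (stereo_jac x + 16 * ((\<phi> x)\<^sup>2 / (1 + (norm x)\<^sup>2) ^ 4)))"
    by (intro integrable_mult_right Bochner_Integration.integrable_add integrable_stereo_jac L2)
  show "AE x in lborel. norm (stereo_jac x * \<phi> x * g x)
      \<le> norm (B * (stereo_jac x + 16 * ((\<phi> x)\<^sup>2 / (1 + (norm x)\<^sup>2) ^ 4)))"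
  proof (rule AE_I2)
    fix x :: R4
    have J: "16 * ((\<phi> x)\<^sup>2 / (1 + (norm x)\<^sup>2) ^ 4) = stereo_jac x * (\<phi> x)\<^sup>2"
      by (simp add: stereo_jac_def)
    have "\<bar>\<phi> x\<bar> \<le> 1 + (\<phi> x)\<^sup>2"
    proof -
      have "0 \<le> (\<bar>\<phi> x\<bar> - 1)\<^sup>2" by simp
      then have "2 * \<bar>\<phi> x\<bar> \<le> 1 + (\<phi> x)\<^sup>2" by (simp add: power2_diff)
      then show ?thesis by linarith
    qed
    then have "\<bar>\<phi> x\<bar> * \<bar>g x\<bar> \<le> (1 + (\<phi> x)\<^sup>2) * B"
      using B by (intro mult_mono) auto
    then have "stereo_jac x * (\<bar>\<phi> x\<bar> * \<bar>g x\<bar>) \<le> stereo_jac x * ((1 + (\<phi> x)\<^sup>2) * B)"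
      using stereo_jac_pos[of x] by (intro mult_left_mono) auto
    moreover have "0 \<le> B * (stereo_jac x + stereo_jac x * (\<phi> x)\<^sup>2)"
      using B stereo_jac_pos[of x] by simp
    ultimately show "norm (stereo_jac x * \<phi> x * g x)
        \<le> norm (B * (stereo_jac x + 16 * ((\<phi> x)\<^sup>2 / (1 + (norm x)\<^sup>2) ^ 4)))"
      unfolding J using stereo_jac_pos[of x] by (simp add: abs_mult algebra_simps)
  qed
qed measurable

text \<open>Both exponentials are put into the kernel, including the one that \<open>lin_rhs\<close>
  keeps outside its integral; this makes it symmetric.\<close>

definition conv_kernel :: "real \<Rightarrow> R4 \<Rightarrow> R4 \<Rightarrow> real" where
  "conv_kernel \<alpha> x y = exp (U_sol \<alpha> x) * exp (U_sol \<alpha> y) / norm (x - y) powr \<alpha>"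

lemma conv_kernel_commute: "conv_kernel \<alpha> x y = conv_kernel \<alpha> y x"
  by (simp add: conv_kernel_def norm_minus_commute mult.commute)

lemma conv_kernel_nonneg: "0 \<le> conv_kernel \<alpha> x y"
  by (simp add: conv_kernel_def)

lemma U_sol_measurable [measurable]: "U_sol \<alpha> \<in> borel_measurable borel"
  unfolding U_sol_def[abs_def] by measurable

lemma conv_kernel_measurable [measurable]:
  "(\<lambda>(x, y). conv_kernel \<alpha> x y) \<in> borel_measurable (borel \<Otimes>\<^sub>M borel)"
  unfolding conv_kernel_def[abs_def] by measurable

text \<open>This value serves twice: it is the coefficient of the local term of the equation, and it
  bounds the double integral in \<open>conv_kernel_Fubini\<close>.\<close>

lemma nn_integral_conv_kernel:
  assumes \<alpha>: "0 < \<alpha>" "\<alpha> < 4"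
  shows "(\<integral>\<^sup>+ y. ennreal (conv_kernel \<alpha> x y) \<partial>lborel) = ennreal (kappa \<alpha> * mu0 \<alpha> * stereo_jac x)"
proof -
  have c: "0 \<le> kappa \<alpha> * stereo_jac x"
    using kappa_pos[OF \<alpha>] stereo_jac_pos[of x] by simp
  have "(\<integral>\<^sup>+ y. ennreal (conv_kernel \<alpha> x y) \<partial>lborel)
      = (\<integral>\<^sup>+ y. ennreal (kappa \<alpha> * stereo_jac x)
          * (ennreal (stereo_jac y) * ennreal (norm (stereo x - stereo y) powr (- \<alpha>))) \<partial>lborel)"
  proof (rule nn_integral_cong)
    fix y
    show "ennreal (conv_kernel \<alpha> x y) = ennreal (kappa \<alpha> * stereo_jac x)
          * (ennreal (stereo_jac y) * ennreal (norm (stereo x - stereo y) powr (- \<alpha>)))"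
      unfolding conv_kernel_def kernel_stereo[OF \<alpha>]
      using c stereo_jac_pos[of y] by (simp add: ennreal_mult[symmetric] mult_ac)
  qed
  also have "\<dots> = ennreal (kappa \<alpha> * stereo_jac x)
      * (\<integral>\<^sup>+ y. ennreal (stereo_jac y) * ennreal (norm (stereo x - stereo y) powr (- \<alpha>)) \<partial>lborel)"
    by (rule nn_integral_cmult) measurable
  also have "(\<integral>\<^sup>+ y. ennreal (stereo_jac y) * ennreal (norm (stereo x - stereo y) powr (- \<alpha>)) \<partial>lborel) = ennreal (mu0 \<alpha>)"
    using nn_integral_surface_measure[of "\<lambda>\<eta>. ennreal (norm (stereo x - \<eta>) powr (- \<alpha>))"]
      nn_integral_riesz_kernel[OF \<alpha>, of "stereo x"] by simp
  finally show ?thesis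
    using c mu0_pos[OF \<alpha>] by (simp add: ennreal_mult[symmetric] mult_ac)
qed

lemma integral_conv_kernel:
  assumes \<alpha>: "0 < \<alpha>" "\<alpha> < 4"
  shows "(LINT y|lborel. conv_kernel \<alpha> x y) = kappa \<alpha> * mu0 \<alpha> * stereo_jac x"
  using nn_integral_conv_kernel[OF \<alpha>, of x] kappa_pos[OF \<alpha>] mu0_pos[OF \<alpha>] stereo_jac_pos[of x]
  by (subst integral_eq_nn_integral) (simp_all add: conv_kernel_nonneg)

text \<open>Integrate absolute values in x first: by symmetry of the kernel and the bound on
  \<open>f\<close>, the inner integral is at most a constant times
  \<open>stereo_jac y * \<bar>\<phi> y\<bar>\<close>, which is integrable. So the double integral
  converges absolutely.\<close>

lemma conv_kernel_Fubini:
  assumes \<alpha>: "0 < \<alpha>" "\<alpha> < 4"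
    and \<phi> [measurable]: "\<phi> \<in> borel_measurable borel"
    and int: "integrable lborel (\<lambda>x. stereo_jac x * \<phi> x)"
    and f [measurable]: "f \<in> borel_measurable borel" and B: "0 \<le> B" "\<And>x. \<bar>f x\<bar> \<le> B"
  shows "integrable lborel (\<lambda>x. (LINT y|lborel. conv_kernel \<alpha> x y * \<phi> y) * f x)" (is ?int1)
    and "integrable lborel (\<lambda>x. \<phi> x * (LINT y|lborel. conv_kernel \<alpha> x y * f y))" (is ?int2)
    and "(LINT x|lborel. (LINT y|lborel. conv_kernel \<alpha> x y * \<phi> y) * f x)
      = (LINT x|lborel. \<phi> x * (LINT y|lborel. conv_kernel \<alpha> x y * f y))" (is ?eq)
proof -
  define P where "P x y = conv_kernel \<alpha> x y * \<phi> y * f x" for x y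
  have Pm: "case_prod P \<in> borel_measurable (lborel \<Otimes>\<^sub>M lborel)"
    unfolding P_def[abs_def] by measurable
  have P: "integrable (lborel \<Otimes>\<^sub>M lborel) (case_prod P)"
  proof (rule integrableI_bounded[OF Pm])
    have "(\<integral>\<^sup>+ z. ennreal (norm (case_prod P z)) \<partial>(lborel \<Otimes>\<^sub>M lborel))
        = (\<integral>\<^sup>+ y. \<integral>\<^sup>+ x. ennreal (norm (P x y)) \<partial>lborel \<partial>lborel)"
      using lborel_pair.nn_integral_snd[of "\<lambda>z. ennreal (norm (case_prod P z))"] Pm by simp
    also have "\<dots> \<le> (\<integral>\<^sup>+ y. \<integral>\<^sup>+ x. ennreal (B * \<bar>\<phi> y\<bar>) * ennreal (conv_kernel \<alpha> y x) \<partial>lborel \<partial>lborel)"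
    proof (intro nn_integral_mono)
      fix x y
      have "\<bar>f x\<bar> * (\<bar>\<phi> y\<bar> * conv_kernel \<alpha> x y) \<le> B * (\<bar>\<phi> y\<bar> * conv_kernel \<alpha> x y)"
        using B by (intro mult_right_mono) (auto simp: conv_kernel_nonneg)
      then show "ennreal (norm (P x y)) \<le> ennreal (B * \<bar>\<phi> y\<bar>) * ennreal (conv_kernel \<alpha> y x)"
        using B by (subst ennreal_mult[symmetric])
          (auto simp: P_def abs_mult conv_kernel_nonneg conv_kernel_commute[of \<alpha> y x] mult_ac)
    qed
    also have "\<dots> = (\<integral>\<^sup>+ y. ennreal (B * kappa \<alpha> * mu0 \<alpha>) * ennreal (norm (stereo_jac y * \<phi> y)) \<partial>lborel)"
    proof (rule nn_integral_cong)
      fix y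
      have "(\<integral>\<^sup>+ x. ennreal (B * \<bar>\<phi> y\<bar>) * ennreal (conv_kernel \<alpha> y x) \<partial>lborel)
          = ennreal (B * \<bar>\<phi> y\<bar>) * ennreal (kappa \<alpha> * mu0 \<alpha> * stereo_jac y)"
        by (subst nn_integral_cmult) (simp_all add: nn_integral_conv_kernel[OF \<alpha>])
      also have "\<dots> = ennreal (B * kappa \<alpha> * mu0 \<alpha>) * ennreal (norm (stereo_jac y * \<phi> y))"
        using B kappa_pos[OF \<alpha>] mu0_pos[OF \<alpha>] stereo_jac_pos[of y]
        by (simp add: ennreal_mult[symmetric] abs_mult mult_ac)
      finally show "(\<integral>\<^sup>+ x. ennreal (B * \<bar>\<phi> y\<bar>) * ennreal (conv_kernel \<alpha> y x) \<partial>lborel)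
          = ennreal (B * kappa \<alpha> * mu0 \<alpha>) * ennreal (norm (stereo_jac y * \<phi> y))" .
    qed
    also have "\<dots> < \<infinity>"
      using int by (subst nn_integral_cmult) (auto simp: integrable_iff_bounded ennreal_mult_less_top)
    finally show "(\<integral>\<^sup>+ z. ennreal (norm (case_prod P z)) \<partial>(lborel \<Otimes>\<^sub>M lborel)) < \<infinity>" .
  qed
  have P1: "(LINT y|lborel. P x y) = (LINT y|lborel. conv_kernel \<alpha> x y * \<phi> y) * f x" for x
    by (simp add: P_def)
  have P2: "(LINT x|lborel. P x y) = \<phi> y * (LINT x|lborel. conv_kernel \<alpha> y x * f x)" for y
    by (simp add: P_def conv_kernel_commute[of \<alpha> _ y] mult.assoc mult.left_commute[of _ "\<phi> y"])
  show ?int1 using lborel_pair.integrable_fst'[OF P] by (simp add: P1)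
  show ?int2 using lborel_pair.integrable_snd[OF P] by (simp add: P2)
  show ?eq using lborel_pair.Fubini_integral[OF P] by (simp add: P1 P2)
qed

text \<open>The squared distance from \<open>stereo x\<close> to the south pole is 4 / (1 + |x|^2).
  If the support stays at distance e from the pole, then |x| is at most 2 / e on the support of the
  pull-back.\<close>

lemma test_fun_stereo:
  assumes "sph_test_fun (sphere 0 1 - {south_pole}) \<psi>"
  shows "test_fun (\<lambda>x. \<psi> (stereo x))"
proof -
  let ?Z = "{\<xi> \<in> sphere 0 1. \<psi> \<xi> \<noteq> 0}"
  have psi: "sph_smooth \<psi>" and cl: "closure ?Z \<subseteq> sphere 0 1 - {south_pole}"
    using assms by (auto simp: sph_test_fun_def)
  have "south_pole \<notin> closure ?Z" using cl by blast
  then obtain e where e: "e > 0" "\<And>\<xi>. \<xi> \<in> ?Z \<Longrightarrow> e \<le> dist \<xi> south_pole"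
    unfolding closure_approachable by (auto simp: not_less)
  have "norm x \<le> 2 / e" if "\<psi> (stereo x) \<noteq> 0" for x
  proof -
    have "e \<le> dist (stereo x) south_pole" using e(2) that by simp
    then have "e\<^sup>2 \<le> (norm (stereo x - south_pole))\<^sup>2"
      using e(1) by (simp add: dist_norm power_mono)
    also have "\<dots> = 4 / (1 + (norm x)\<^sup>2)"
    proof -
      have "(norm (stereo x - south_pole))\<^sup>2
          = (norm (stereo x))\<^sup>2 + (norm south_pole)\<^sup>2 - 2 * (stereo x \<bullet> south_pole)"
        by (simp add: power2_norm_eq_inner inner_diff inner_commute del: norm_stereo)
      also have "\<dots> = 2 - 2 * (stereo x \<bullet> south_pole)"
        by (simp add: south_pole_def norm_Pair)
      also have "\<dots> = 2 + 2 * ((1 - (norm x)\<^sup>2) / (1 + (norm x)\<^sup>2))"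
        by (simp add: south_pole_def stereo_def)
      also have "\<dots> = 4 / (1 + (norm x)\<^sup>2)"
        using one_plus_norm_square_pos[of x] by (simp add: divide_simps)
      finally show ?thesis .
    qed
    finally have "e\<^sup>2 * (1 + (norm x)\<^sup>2) \<le> 4"
      using one_plus_norm_square_pos[of x] by (simp add: pos_le_divide_eq)
    then have "e\<^sup>2 + (e * norm x)\<^sup>2 \<le> 2\<^sup>2" by (simp add: power_mult_distrib distrib_left)
    with zero_le_power2[of e] have "(e * norm x)\<^sup>2 \<le> 2\<^sup>2" by linarith
    then have "e * norm x \<le> 2" by (rule power2_le_imp_le) simp
    then show ?thesis using e(1) by (simp add: pos_le_divide_eq mult.commute)
  qed
  then have "bounded {x. \<psi> (stereo x) \<noteq> 0}"
    unfolding bounded_iff by blast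
  then show ?thesis
    using smooth_on_compose_stereo[OF psi] by (simp add: test_fun_def compact_closure)
qed

lemma stereo_jac_paneitz:
  assumes "sph_smooth \<psi>"
  shows "stereo_jac x * paneitz \<psi> (stereo x) = laplacian (laplacian (\<lambda>x. \<psi> (stereo x))) x"
proof -
  have "stereo_jac x * stereo_inv_factor x ^ 4 = 1"
    using one_plus_norm_square_pos[of x] by (simp add: stereo_jac_def stereo_inv_factor_def power_divide)
  then show ?thesis
    unfolding paneitz_stereo[OF assms] by (simp add: mult.assoc[symmetric])
qed

text \<open>The Jacobian absorbs both weights: m^4 in the Paneitz term and the factor left over in
  the kernel. The result is the operator of the linearised equation acting on the test
  function.\<close>

lemma stereo_jac_L_op:
  assumes \<alpha>: "0 < \<alpha>" "\<alpha> < 4" and psi: "sph_smooth \<psi>"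
  defines "f \<equiv> \<lambda>x. \<psi> (stereo x)"
  shows "stereo_jac x * L_op \<alpha> \<psi> (stereo x)
    = laplacian (laplacian f) x - (LINT y|lborel. conv_kernel \<alpha> x y * f y)
      - kappa \<alpha> * mu0 \<alpha> * (stereo_jac x * f x)"
proof -
  have f: "smooth_on UNIV f"
    unfolding f_def by (rule smooth_on_compose_stereo[OF psi])
  have fm [measurable]: "f \<in> borel_measurable borel"
    using smooth_on_continuous[OF f] by (rule borel_measurable_continuous_onI)
  have m: "(\<lambda>y. norm (stereo x - stereo y) powr (- \<alpha>) * f y) \<in> borel_measurable lborel"
    by measurable
  have "riesz \<alpha> \<psi> (stereo x) = (LINT y|lebesgue. stereo_jac y * (norm (stereo x - stereo y) powr (- \<alpha>) * f y))"
    unfolding riesz_def f_def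
    by (rule integral_sphere_stereo) (use measurable_completion[OF m] in \<open>simp add: f_def\<close>)
  also have "\<dots> = (LINT y|lborel. stereo_jac y * (norm (stereo x - stereo y) powr (- \<alpha>) * f y))"
    by (rule integral_completion) measurable
  finally have "stereo_jac x * (kappa \<alpha> * riesz \<alpha> \<psi> (stereo x))
      = (LINT y|lborel. stereo_jac x * kappa \<alpha> * (stereo_jac y * (norm (stereo x - stereo y) powr (- \<alpha>) * f y)))"
    by simp
  also have "\<dots> = (LINT y|lborel. conv_kernel \<alpha> x y * f y)"
    unfolding conv_kernel_def kernel_stereo[OF \<alpha>] by (simp only: mult_ac)
  finally have R: "stereo_jac x * (kappa \<alpha> * riesz \<alpha> \<psi> (stereo x)) = (LINT y|lborel. conv_kernel \<alpha> x y * f y)" .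
  with stereo_jac_paneitz[OF psi, of x] show ?thesis
    unfolding L_op_def by (simp add: f_def algebra_simps)
qed

theorem lemma4p3:
  fixes \<alpha> :: real and \<phi> :: "real ^ 4 \<Rightarrow> real" and \<Phi> :: "(real ^ 4) \<times> real \<Rightarrow> real"
  assumes "0 < \<alpha>" and "\<alpha> < 4"
    and "L2w \<phi>"
    and "lin_dist_sol \<alpha> \<phi>"
    and "\<Phi> = \<phi> \<circ> inv stereo"
  shows "L2 sphere_measure \<Phi> \<and>
    (\<forall>\<psi>. sph_test_fun (sphere 0 1 - {south_pole}) \<psi> \<longrightarrow> L_dist \<alpha> \<Phi> \<psi> = 0)"
proof (intro conjI allI impI)
  note \<alpha> = assms(1,2)
  have \<phi>: "\<phi> \<in> borel_measurable lebesgue"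
    and \<phi>2: "integrable lebesgue (\<lambda>x. \<bar>\<phi> x\<bar>\<^sup>2 / (1 + (norm x)\<^sup>2) ^ 4)"
    using assms(3) by (auto simp: L2w_def)
  \<comment> \<open>Injectivity fixes \<open>inv stereo\<close> on the range. Its value at the south
    pole is an arbitrary choice, at a single point of measure zero.\<close>
  have \<Phi>S: "\<Phi> (stereo x) = \<phi> x" for x
    using inj_stereo by (simp add: assms(5))
  show "L2 sphere_measure \<Phi>"
    unfolding L2_def
  proof
    show "\<Phi> \<in> borel_measurable sphere_measure"
      by (rule borel_measurable_sphere_stereo) (simp add: \<Phi>S \<phi>)
    have "integrable lebesgue (\<lambda>x. 16 * (\<bar>\<phi> x\<bar>\<^sup>2 / (1 + (norm x)\<^sup>2) ^ 4))"
      using \<phi>2 by (rule integrable_mult_right)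
    then show "integrable sphere_measure (\<lambda>\<xi>. \<bar>\<Phi> \<xi>\<bar>\<^sup>2)"
      using \<phi> by (subst integrable_sphere_stereo) (simp_all add: \<Phi>S stereo_jac_def)
  qed
  fix \<psi> :: "R5 \<Rightarrow> real"
  assume test: "sph_test_fun (sphere 0 1 - {south_pole}) \<psi>"
  then have psi: "sph_smooth \<psi>" by (simp add: sph_test_fun_def)
  define f where "f = (\<lambda>x. \<psi> (stereo x))"
  have f: "smooth_on UNIV f"
    unfolding f_def by (rule smooth_on_compose_stereo[OF psi])
  have fm [measurable]: "f \<in> borel_measurable borel"
    using smooth_on_continuous[OF f] by (rule borel_measurable_continuous_onI)
  have lm [measurable]: "laplacian (laplacian f) \<in> borel_measurable borel"
    by (intro borel_measurable_continuous_onI smooth_on_continuous smooth_on_laplacian f open_UNIV)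
  obtain B where B: "0 \<le> B" "\<And>x. \<bar>f x\<bar> \<le> B"
    using sph_smooth_bounded[OF psi] unfolding f_def by blast
  obtain B' where B': "0 \<le> B'" "\<And>x. \<bar>paneitz \<psi> (stereo x)\<bar> \<le> B'"
    using sph_smooth_bounded[OF sph_smooth_paneitz[OF psi]] by blast
  \<comment> \<open>Fubini asks for measurability with respect to the Borel product, so \<phi> is
    exchanged for a Borel representative.\<close>
  obtain \<phi>' where \<phi>' [measurable]: "\<phi>' \<in> borel_measurable lborel" and ae: "AE x in lborel. \<phi> x = \<phi>' x"
    using completion_ex_borel_measurable_real[OF \<phi>] by blast
  have \<phi>'2: "integrable lborel (\<lambda>x. (\<phi>' x)\<^sup>2 / (1 + (norm x)\<^sup>2) ^ 4)"
  proof -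
    have m: "(\<lambda>x. (\<phi>' x)\<^sup>2 / (1 + (norm x)\<^sup>2) ^ 4) \<in> borel_measurable lborel" by measurable
    have ae': "AE x in lborel. \<bar>\<phi> x\<bar>\<^sup>2 / (1 + (norm x)\<^sup>2) ^ 4 = (\<phi>' x)\<^sup>2 / (1 + (norm x)\<^sup>2) ^ 4"
      using ae by eventually_elim simp
    have "integrable lebesgue (\<lambda>x. (\<phi>' x)\<^sup>2 / (1 + (norm x)\<^sup>2) ^ 4)"
      using \<phi>2 integrable_cong_AE[OF borel_measurable_completion_AE[OF m ae'] measurable_completion[OF m]
          AE_completion[OF ae']] by blast
    then show ?thesis by (simp add: integrable_completion[OF m])
  qed
  note int_bdd = integrable_stereo_jac_L2w[OF \<phi>' \<phi>'2]
  have int1: "integrable lborel (\<lambda>x. stereo_jac x * \<phi>' x)"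
    using int_bdd[of "\<lambda>_. 1" 1] by simp
  have intf: "integrable lborel (\<lambda>x. stereo_jac x * \<phi>' x * f x)"
    using int_bdd[of f B] B by simp
  define c where "c = kappa \<alpha> * mu0 \<alpha>"
  define G where "G x = (LINT y|lborel. conv_kernel \<alpha> x y * \<phi>' y)" for x
  define K where "K x = (LINT y|lborel. conv_kernel \<alpha> x y * f y)" for x
  have Gm [measurable]: "G \<in> borel_measurable lborel"
    unfolding G_def[abs_def] by measurable
  have Km [measurable]: "K \<in> borel_measurable lborel"
    unfolding K_def[abs_def] by measurable
  have \<phi>'m: "\<phi>' \<in> borel_measurable borel" using \<phi>' by simp
  note fub = conv_kernel_Fubini[OF \<alpha> \<phi>'m int1 fm B, folded G_def K_def]
  have lap_eq: "laplacian (laplacian f) x = stereo_jac x * paneitz \<psi> (stereo x)" for x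
    using stereo_jac_paneitz[OF psi] by (simp add: f_def)
  \<comment> \<open>The bi-Laplacian of the pull-back is the Jacobian times a bounded function on
    the sphere, so the bound used for \<open>f\<close> covers this product as well.\<close>
  have intl: "integrable lborel (\<lambda>x. \<phi>' x * laplacian (laplacian f) x)"
  proof -
    have "(\<lambda>x. paneitz \<psi> (stereo x)) = (\<lambda>x. laplacian (laplacian f) x / stereo_jac x)"
      using stereo_jac_pos by (auto simp: lap_eq fun_eq_iff less_le)
    then have "(\<lambda>x. paneitz \<psi> (stereo x)) \<in> borel_measurable lborel" by simp
    from int_bdd[OF this B'] show ?thesis by (simp add: lap_eq mult_ac)
  qed
  have rhs: "lin_rhs \<alpha> \<phi> x * f x = G x * f x + c * (stereo_jac x * \<phi> x * f x)" for x
  proof -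
    \<comment> \<open>The convolution sees \<phi> only under the integral, so the exchange is valid
      at every x; in the local term \<phi> itself stays until the outer integral.\<close>
    have "(LINT y|lebesgue. exp (U_sol \<alpha> y) * \<phi> y / norm (x - y) powr \<alpha>)
        = (LINT y|lborel. exp (U_sol \<alpha> y) * \<phi>' y / norm (x - y) powr \<alpha>)"
      using ae by (intro lebesgue_integral_AE_borel) auto
    then have "(LINT y|lebesgue. exp (U_sol \<alpha> y) * \<phi> y / norm (x - y) powr \<alpha>) * exp (U_sol \<alpha> x)
        = (LINT y|lborel. exp (U_sol \<alpha> y) * \<phi>' y / norm (x - y) powr \<alpha> * exp (U_sol \<alpha> x))"
      by (simp only: integral_mult_left_zero)
    also have "\<dots> = G x"
      unfolding G_def conv_kernel_def by (intro Bochner_Integration.integral_cong) (simp_all add: mult_ac)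
    finally have 1: "(LINT y|lebesgue. exp (U_sol \<alpha> y) * \<phi> y / norm (x - y) powr \<alpha>) * exp (U_sol \<alpha> x) = G x" .
    have "(LINT y|lebesgue. exp (U_sol \<alpha> y) / norm (x - y) powr \<alpha>) * exp (U_sol \<alpha> x)
        = (LINT y|lborel. exp (U_sol \<alpha> y) / norm (x - y) powr \<alpha>) * exp (U_sol \<alpha> x)"
      by (subst integral_completion) simp_all
    also have "\<dots> = (LINT y|lborel. exp (U_sol \<alpha> y) / norm (x - y) powr \<alpha> * exp (U_sol \<alpha> x))"
      by (simp only: integral_mult_left_zero)
    also have "\<dots> = (LINT y|lborel. conv_kernel \<alpha> x y)"
      unfolding conv_kernel_def by (intro Bochner_Integration.integral_cong) (simp_all add: mult_ac)
    also have "\<dots> = c * stereo_jac x"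
      by (simp add: integral_conv_kernel[OF \<alpha>] c_def)
    finally show ?thesis
      unfolding lin_rhs_def 1 by (simp add: algebra_simps)
  qed
  have "(LINT x|lborel. \<phi>' x * laplacian (laplacian f) x) = (LINT x|lebesgue. \<phi> x * laplacian (laplacian f) x)"
    using ae by (intro lebesgue_integral_AE_borel[symmetric]) auto
  also have "\<dots> = (LINT x|lebesgue. lin_rhs \<alpha> \<phi> x * f x)"
    using assms(4) test_fun_stereo[OF test] by (simp add: lin_dist_sol_def f_def)
  also have "\<dots> = (LINT x|lborel. G x * f x + c * (stereo_jac x * \<phi>' x * f x))"
    unfolding rhs
  proof (rule lebesgue_integral_AE_borel)
    show "AE x in lborel. G x * f x + c * (stereo_jac x * \<phi> x * f x)
        = G x * f x + c * (stereo_jac x * \<phi>' x * f x)"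
      using ae by eventually_elim simp
  qed measurable
  \<comment> \<open>Splitting is legitimate since both terms are integrable; the symmetric kernel
    then passes from \<phi> to the test function.\<close>
  also have "\<dots> = (LINT x|lborel. G x * f x) + c * (LINT x|lborel. stereo_jac x * \<phi>' x * f x)"
    using fub(1) intf by simp
  finally have eq: "(LINT x|lborel. \<phi>' x * laplacian (laplacian f) x)
      = (LINT x|lborel. \<phi>' x * K x) + c * (LINT x|lborel. stereo_jac x * \<phi>' x * f x)"
    using fub(3) by simp
  have Lop: "stereo_jac x * L_op \<alpha> \<psi> (stereo x) = laplacian (laplacian f) x - K x - c * (stereo_jac x * f x)" for x
    unfolding stereo_jac_L_op[OF \<alpha> psi] K_def f_def c_def ..
  have "L_op \<alpha> \<psi> (stereo x) = (laplacian (laplacian f) x - K x - c * (stereo_jac x * f x)) / stereo_jac x" for x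
    using Lop[of x] stereo_jac_pos[of x] by (simp add: field_simps)
  then have "(\<lambda>x. L_op \<alpha> \<psi> (stereo x)) \<in> borel_measurable lborel" by simp
  then have m: "(\<lambda>x. \<Phi> (stereo x) * L_op \<alpha> \<psi> (stereo x)) \<in> borel_measurable lebesgue"
    unfolding \<Phi>S by (rule borel_measurable_times[OF \<phi> measurable_completion])
  have "L_dist \<alpha> \<Phi> \<psi> = (LINT x|lebesgue. stereo_jac x * (\<phi> x * L_op \<alpha> \<psi> (stereo x)))"
    unfolding L_dist_def integral_sphere_stereo[OF m] \<Phi>S ..
  also have "\<dots> = (LINT x|lborel. \<phi>' x * laplacian (laplacian f) x - \<phi>' x * K x - c * (stereo_jac x * \<phi>' x * f x))"
  proof (rule lebesgue_integral_AE_borel)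
    show "AE x in lborel. stereo_jac x * (\<phi> x * L_op \<alpha> \<psi> (stereo x))
        = \<phi>' x * laplacian (laplacian f) x - \<phi>' x * K x - c * (stereo_jac x * \<phi>' x * f x)"
      using ae
    proof eventually_elim
      case (elim x)
      have "stereo_jac x * (\<phi> x * L_op \<alpha> \<psi> (stereo x)) = \<phi>' x * (stereo_jac x * L_op \<alpha> \<psi> (stereo x))"
        by (simp add: elim)
      then show ?case unfolding Lop by (simp add: algebra_simps)
    qed
  qed measurable
  also have "\<dots> = 0"
    \<comment> \<open>With all three terms integrable, the integral splits and \<open>eq\<close>
      says that they balance.\<close>
    using intl fub(2) intf eq by simp
  finally show "L_dist \<alpha> \<Phi> \<psi> = 0" .
qed

end
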